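(* Let $\{Q^s\mid s>s_0\}$ be a chain of Banach manifolds with a compatible weak Riemannian metric $\gamma$, and let $\Phi:G\times Q^s\to Q^s$ be an action of a finite dimensional Lie group $G$ satisfying all the hypotheses listed in the context. Let $H$ be a compact subgroup of $G$. Then the $H$-fixed point set $(Q^s)^H:=\{q\in Q^s\mid G_q\supset H\}$ is a smooth submanifold of $Q^s$ whose tangent space at $q\in(Q^s)^H$ is $$T_q(Q^s)^H=[T_qQ^s]^H:=\{v_q\in T_qQ^s\mid T_q\Phi_h(v_q)=v_q\ \ \forall h\in H\}.$$
   Context: Chain of Banach manifolds: a collection $\{Q^s\mid s>s_0\}$ of smooth Banach manifolds such that for all $r>s>s_0$ there is a smooth inclusion $j_{(r,s)}:Q^r\hookrightarrow Q^s$ with dense range, such that for all $q\in Q^r$ the range of $T_qj_{(r,s)}:T_qQ^r\to T_qQ^s$ is dense in $T_qQ^s$, and such that for each chart $\varphi^s:U^s\to T_qQ^s$ of $Q^s$ at a point $q\in Q^r$, $r>s$, the map $\varphi^r:=\varphi^s|_{U^s\cap Q^r}$ takes values in $T_qQ^r$ and is a chart of $Q^r$. Each $Q^s$ carries a weak Riemannian metric $\gamma_s$ with $j_{(r,s)}^*\gamma_s=\gamma_r$; it is denoted simply $\gamma$. Hypotheses on the action: $G$ is a finite dimensional Lie group; for every $s>s_0$ there is an action $\Phi:G\times Q^s\to Q^s$, $\Phi(g,q)=\Phi_g(q)=\Phi^q(g)$, which is continuous; proper (whenever $(q_n)$ and $(\Phi_{g_n}(q_n))$ converge in $Q^s$,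 $(g_n)$ has a convergent subsequence in $G$); compatible (each $\Phi_g$ commutes with all $j_{(r,s)}$); and such that (1) for all $s>s_0$ and $g\in G$, $\Phi_g:Q^s\to Q^s$ is smooth; (2) for all $s>s_0+1$ and $q\in Q^s$, $\Phi^q:G\to Q^{s-1}$ is $C^1$. The isotropy group of $q$ is $G_q:=\{g\in G\mid\Phi_g(q)=q\}$ (compact, by properness). *)

theory Defs
  imports
    "HOL-Analysis.Analysis"
    "HOL-Library.Extended_Nat"
    "HOL-Algebra.Group_Action"
begin

section \<open>Differential calculus on Banach spaces\<close>

text \<open>
  A Banach space is represented as a closed subspace \<open>E\<close> of a type \<open>'a\<close> of class \<^class>\<open>banach\<close>. This
  loses no generality: a family of Banach spaces that depends on a parameter embeds isometrically,
  as closed subspaces, into its \<open>l\<^sup>1\<close>-direct sum. In what follows \<open>U\<close> is (relatively) open in \<open>E\<close>, and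
  linear maps are only required to be defined and bounded on \<open>E\<close>. They need not extend to \<open>'a\<close>, so
  \<open>has_deriv_in\<close> is \<open>has_derivative\<close> with \<open>bounded_linear\<close> relativised to \<open>E\<close>.
\<close>

definition bounded_linear_in ::
  "'a::real_normed_vector set \<Rightarrow> ('a \<Rightarrow> 'b::real_normed_vector) \<Rightarrow> bool" where
  "bounded_linear_in E A \<longleftrightarrow>
     (\<forall>x\<in>E. \<forall>y\<in>E. A (x + y) = A x + A y) \<and>
     (\<forall>a. \<forall>x\<in>E. A (a *\<^sub>R x) = a *\<^sub>R A x) \<and>
     (\<exists>K. \<forall>x\<in>E. norm (A x) \<le> norm x * K)"

definition has_deriv_in ::
  "'a::real_normed_vector set \<Rightarrow> 'a set \<Rightarrow> ('a \<Rightarrow> 'b::real_normed_vector) \<Rightarrow> ('a \<Rightarrow> 'b) \<Rightarrow> 'a \<Rightarrow> bool" where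
  "has_deriv_in E U f A x \<longleftrightarrow>
     bounded_linear_in E A \<and>
     ((\<lambda>y. (f y - f x - A (y - x)) /\<^sub>R norm (y - x)) \<longlongrightarrow> 0) (at x within U)"

definition deriv_in ::
  "'a::real_normed_vector set \<Rightarrow> 'a set \<Rightarrow> ('a \<Rightarrow> 'b::real_normed_vector) \<Rightarrow> 'a \<Rightarrow> 'a \<Rightarrow> 'b" where
  "deriv_in E U f x v = (THE w. \<exists>A. has_deriv_in E U f A x \<and> w = A v)"

definition bounded_multilinear_in ::
  "'a::real_normed_vector set \<Rightarrow> nat \<Rightarrow> ('a list \<Rightarrow> 'b::real_normed_vector) \<Rightarrow> bool" where
  "bounded_multilinear_in E n T \<longleftrightarrow>
     (\<forall>vs\<in>lists E. length vs = n \<longrightarrow> (\<forall>i<n.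
        (\<forall>x\<in>E. \<forall>y\<in>E. T (vs[i := x + y]) = T (vs[i := x]) + T (vs[i := y])) \<and>
        (\<forall>a. \<forall>x\<in>E. T (vs[i := a *\<^sub>R x]) = a *\<^sub>R T (vs[i := x])))) \<and>
     (\<exists>K. \<forall>vs\<in>lists E. length vs = n \<longrightarrow> norm (T vs) \<le> K * prod_list (map norm vs))"

text \<open>
  \<open>Ck_on k E U f\<close>: \<open>f\<close> is of class \<open>C\<^sup>k\<close> on \<open>U\<close> (in the sense of Frechet), for \<open>k\<close> finite or \<open>\<infinity>\<close>. The
  \<open>n\<close>-th derivative \<open>D n x\<close> at \<open>x\<close> is a bounded \<open>n\<close>-linear map, applied to the list of its \<open>n\<close>
  arguments. Continuity and differentiability of \<open>D n\<close> are with respect to the operator norm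
  of \<open>n\<close>-linear maps, and \<open>D (n + 1) x (h # vs)\<close> is the derivative of \<open>D n\<close> at \<open>x\<close> in direction \<open>h\<close>,
  evaluated at \<open>vs\<close>.
\<close>

definition Ck_on ::
  "enat \<Rightarrow> 'a::real_normed_vector set \<Rightarrow> 'a set \<Rightarrow> ('a \<Rightarrow> 'b::real_normed_vector) \<Rightarrow> bool" where
  "Ck_on k E U f \<longleftrightarrow> (\<exists>D :: nat \<Rightarrow> 'a \<Rightarrow> 'a list \<Rightarrow> 'b.
     (\<forall>x\<in>U. D 0 x [] = f x) \<and>
     (\<forall>n. enat n \<le> k \<longrightarrow> (\<forall>x\<in>U. bounded_multilinear_in E n (D n x))) \<and>
     (\<forall>n. enat n \<le> k \<longrightarrow> (\<forall>x\<in>U. \<forall>e>0. \<exists>d>0. \<forall>y\<in>U. dist y x < d \<longrightarrow>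
        (\<forall>vs\<in>lists E. length vs = n \<longrightarrow>
           norm (D n y vs - D n x vs) \<le> e * prod_list (map norm vs)))) \<and>
     (\<forall>n. enat n < k \<longrightarrow> (\<forall>x\<in>U. \<forall>e>0. \<exists>d>0. \<forall>y\<in>U. dist y x < d \<longrightarrow>
        (\<forall>vs\<in>lists E. length vs = n \<longrightarrow>
           norm (D n y vs - D n x vs - D (Suc n) x ((y - x) # vs))
             \<le> e * norm (y - x) * prod_list (map norm vs)))))"

section \<open>Banach manifolds\<close>

text \<open>A chart has a domain, a coordinate map and the Banach space in which it takes its values.\<close>

record ('q, 'e) chart =
  chart_dom :: "'q set"
  chart_map :: "'q \<Rightarrow> 'e"
  chart_space :: "'e set"

record ('q, 'e) manifold =
  mtop :: "'q topology"
  atlas :: "('q, 'e) chart set"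

abbreviation points :: "('q, 'e) manifold \<Rightarrow> 'q set" where
  "points M \<equiv> topspace (mtop M)"

definition chart_inv :: "('q, 'e) chart \<Rightarrow> 'e \<Rightarrow> 'q" where
  "chart_inv c = inv_into (chart_dom c) (chart_map c)"

definition banach_chart :: "'q topology \<Rightarrow> ('q, 'e::real_normed_vector) chart \<Rightarrow> bool" where
  "banach_chart X c \<longleftrightarrow>
     openin X (chart_dom c) \<and>
     subspace (chart_space c) \<and> closed (chart_space c) \<and>
     openin (top_of_set (chart_space c)) (chart_map c ` chart_dom c) \<and>
     homeomorphic_map (subtopology X (chart_dom c)) (top_of_set (chart_map c ` chart_dom c))
       (chart_map c)"

definition local_dom ::
  "('q, 'e) chart \<Rightarrow> ('p, 'f) chart \<Rightarrow> ('q \<Rightarrow> 'p) \<Rightarrow> 'e set" where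
  "local_dom c d f = chart_map c ` {x \<in> chart_dom c. f x \<in> chart_dom d}"

definition local_rep ::
  "('q, 'e) chart \<Rightarrow> ('p, 'f) chart \<Rightarrow> ('q \<Rightarrow> 'p) \<Rightarrow> 'e \<Rightarrow> 'f" where
  "local_rep c d f = chart_map d \<circ> f \<circ> chart_inv c"

definition Ck_compatible ::
  "('q, 'e::real_normed_vector) chart \<Rightarrow> ('q, 'e) chart \<Rightarrow> bool" where
  "Ck_compatible c d \<longleftrightarrow>
     Ck_on \<infinity> (chart_space c) (local_dom c d (\<lambda>x. x)) (local_rep c d (\<lambda>x. x)) \<and>
     Ck_on \<infinity> (chart_space d) (local_dom d c (\<lambda>x. x)) (local_rep d c (\<lambda>x. x))"

definition smooth_manifold :: "('q, 'e::real_normed_vector) manifold \<Rightarrow> bool" where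
  "smooth_manifold M \<longleftrightarrow>
     Hausdorff_space (mtop M) \<and>
     (\<forall>c\<in>atlas M. banach_chart (mtop M) c) \<and>
     (\<Union>c\<in>atlas M. chart_dom c) = points M \<and>
     (\<forall>c\<in>atlas M. \<forall>d\<in>atlas M. Ck_compatible c d)"

text \<open>Membership in the maximal atlas.\<close>

definition admissible_chart :: "('q, 'e::real_normed_vector) manifold \<Rightarrow> ('q, 'e) chart \<Rightarrow> bool" where
  "admissible_chart M c \<longleftrightarrow> banach_chart (mtop M) c \<and> (\<forall>d\<in>atlas M. Ck_compatible c d)"

definition Ck_map ::
  "enat \<Rightarrow> ('q, 'e::real_normed_vector) manifold \<Rightarrow> ('p, 'f::real_normed_vector) manifold
     \<Rightarrow> ('q \<Rightarrow> 'p) \<Rightarrow> bool" where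
  "Ck_map k M N f \<longleftrightarrow>
     continuous_map (mtop M) (mtop N) f \<and>
     (\<forall>c\<in>atlas M. \<forall>d\<in>atlas N. Ck_on k (chart_space c) (local_dom c d f) (local_rep c d f))"

subsection \<open>Tangent spaces and tangent maps\<close>

text \<open>
  A tangent vector at \<open>q\<close> is the family of its components in all charts of the atlas around \<open>q\<close>, where
  components are related by the derivatives of the chart transitions (and, for extensionality,
  are \<open>0\<close> in the charts that do not contain \<open>q\<close>). The linear structure is pointwise. Every single
  component is an isomorphism onto the model space of the chart, so the Banach space topology
  of \<open>T\<^sub>qM\<close> is the subspace topology of the product topology on functions; this is what \<^const>\<open>closure\<close>
  refers to below.
\<close>

type_synonym ('q, 'e) tvec = "('q, 'e) chart \<Rightarrow> 'e"

definition charts_at :: "('q, 'e) manifold \<Rightarrow> 'q \<Rightarrow> ('q, 'e) chart set" where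
  "charts_at M q = {c \<in> atlas M. q \<in> chart_dom c}"

definition tangent_space ::
  "('q, 'e::real_normed_vector) manifold \<Rightarrow> 'q \<Rightarrow> ('q, 'e) tvec set" where
  "tangent_space M q = {v.
     (\<forall>c\<in>charts_at M q. v c \<in> chart_space c) \<and>
     (\<forall>c\<in>charts_at M q. \<forall>d\<in>charts_at M q.
        v d = deriv_in (chart_space c) (local_dom c d (\<lambda>x. x)) (local_rep c d (\<lambda>x. x))
                (chart_map c q) (v c)) \<and>
     (\<forall>c. c \<notin> charts_at M q \<longrightarrow> v c = 0)}"

definition tangent_map ::
  "('q, 'e::real_normed_vector) manifold \<Rightarrow> ('p, 'f::real_normed_vector) manifold
     \<Rightarrow> ('q \<Rightarrow> 'p) \<Rightarrow> 'q \<Rightarrow> ('q, 'e) tvec \<Rightarrow> ('p, 'f) tvec" where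
  "tangent_map M N f q v = (\<lambda>d.
     if d \<in> charts_at N (f q)
     then THE w. \<forall>c\<in>charts_at M q.
            w = deriv_in (chart_space c) (local_dom c d f) (local_rep c d f) (chart_map c q) (v c)
     else 0)"

text \<open>The tangent vector at \<open>q\<close> with component \<open>u\<close> in the chart \<open>c\<close>.\<close>

definition tvec_of ::
  "('q, 'e::real_normed_vector) manifold \<Rightarrow> 'q \<Rightarrow> ('q, 'e) chart \<Rightarrow> 'e \<Rightarrow> ('q, 'e) tvec" where
  "tvec_of M q c u = (THE v. v \<in> tangent_space M q \<and> v c = u)"

text \<open>
  A chart \<open>\<phi> : U \<rightarrow> T\<^sub>qM\<close> of \<open>M\<close> at \<open>q\<close>: read through any of the isomorphisms of \<open>T\<^sub>qM\<close> with a model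
  space, it belongs to the maximal atlas.
\<close>

definition tangent_chart ::
  "('q, 'e::real_normed_vector) manifold \<Rightarrow> 'q \<Rightarrow> 'q set \<Rightarrow> ('q \<Rightarrow> ('q, 'e) tvec) \<Rightarrow> bool" where
  "tangent_chart M q U \<phi> \<longleftrightarrow>
     q \<in> U \<and> U \<subseteq> points M \<and> \<phi> ` U \<subseteq> tangent_space M q \<and>
     (\<forall>c\<in>charts_at M q. admissible_chart M
        \<lparr>chart_dom = U, chart_map = (\<lambda>x. \<phi> x c), chart_space = chart_space c\<rparr>)"

subsection \<open>Weak Riemannian metrics\<close>

text \<open>
  Smoothness of \<open>q \<mapsto> \<gamma>\<^sub>q\<close> is expressed as joint smoothness of the local representative
  \<open>(x, u, v) \<mapsto> \<gamma>\<^sub>x(u, v)\<close>, which includes the continuity of each \<open>\<gamma>\<^sub>q\<close>. The metric is weak in that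
  \<open>\<gamma>\<^sub>q\<close> need not induce the topology of \<open>T\<^sub>qM\<close>.
\<close>

definition weak_riemannian_metric ::
  "('q, 'e::real_normed_vector) manifold
     \<Rightarrow> ('q \<Rightarrow> ('q, 'e) tvec \<Rightarrow> ('q, 'e) tvec \<Rightarrow> real) \<Rightarrow> bool" where
  "weak_riemannian_metric M \<gamma> \<longleftrightarrow>
     (\<forall>q\<in>points M.
        (\<forall>v\<in>tangent_space M q. \<forall>w\<in>tangent_space M q. \<gamma> q v w = \<gamma> q w v) \<and>
        (\<forall>u\<in>tangent_space M q. \<forall>v\<in>tangent_space M q. \<forall>w\<in>tangent_space M q. \<forall>a.
           \<gamma> q (\<lambda>c. a *\<^sub>R u c + v c) w = a * \<gamma> q u w + \<gamma> q v w) \<and>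
        (\<forall>v\<in>tangent_space M q. v \<noteq> (\<lambda>c. 0) \<longrightarrow> \<gamma> q v v > 0)) \<and>
     (\<forall>c\<in>atlas M.
        Ck_on \<infinity> (chart_space c \<times> chart_space c \<times> chart_space c)
          (chart_map c ` chart_dom c \<times> chart_space c \<times> chart_space c)
          (\<lambda>(x, u, v). \<gamma> (chart_inv c x)
             (tvec_of M (chart_inv c x) c u) (tvec_of M (chart_inv c x) c v)))"

subsection \<open>Submanifolds\<close>

definition complemented_in :: "'e::real_normed_vector set \<Rightarrow> 'e set \<Rightarrow> bool" where
  "complemented_in E F \<longleftrightarrow>
     subspace F \<and> closed F \<and> F \<subseteq> E \<and>
     (\<exists>F'. subspace F' \<and> closed F' \<and> F' \<subseteq> E \<and> F \<inter> F' = {0} \<and> {x + y | x y. x \<in> F \<and> y \<in> F'} = E)"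

definition slice_chart ::
  "('q, 'e::real_normed_vector) manifold \<Rightarrow> 'q set \<Rightarrow> ('q, 'e) chart \<Rightarrow> 'e set \<Rightarrow> bool" where
  "slice_chart M S c F \<longleftrightarrow>
     admissible_chart M c \<and> complemented_in (chart_space c) F \<and>
     chart_map c ` (chart_dom c \<inter> S) = chart_map c ` chart_dom c \<inter> F"

text \<open>Submanifolds are split; their model spaces may vary between connected components.\<close>

definition smooth_submanifold :: "('q, 'e::real_normed_vector) manifold \<Rightarrow> 'q set \<Rightarrow> bool" where
  "smooth_submanifold M S \<longleftrightarrow>
     S \<subseteq> points M \<and> (\<forall>q\<in>S. \<exists>c F. slice_chart M S c F \<and> q \<in> chart_dom c)"

definition induced_manifold ::
  "('q, 'e::real_normed_vector) manifold \<Rightarrow> 'q set \<Rightarrow> ('q, 'e) manifold" where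
  "induced_manifold M S =
     \<lparr>mtop = subtopology (mtop M) S,
      atlas = {\<lparr>chart_dom = chart_dom c \<inter> S, chart_map = chart_map c, chart_space = F\<rparr> | c F.
                 slice_chart M S c F}\<rparr>"

text \<open>As usual, \<open>T\<^sub>qS\<close> is regarded as a subspace of \<open>T\<^sub>qM\<close> via the tangent map of the inclusion.\<close>

definition submanifold_tangent_space ::
  "('q, 'e::real_normed_vector) manifold \<Rightarrow> 'q set \<Rightarrow> 'q \<Rightarrow> ('q, 'e) tvec set" where
  "submanifold_tangent_space M S q =
     tangent_map (induced_manifold M S) M (\<lambda>x. x) q ` tangent_space (induced_manifold M S) q"

section \<open>Chains of Banach manifolds\<close>

text \<open>
  The inclusions \<open>Q\<^sup>r \<hookrightarrow> Q\<^sup>s\<close> are literal inclusions of sets. The set \<open>C s\<close> consists of the charts of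
  \<open>Q\<^sup>s\<close> with values in tangent spaces that come with the chain, as triples of base point, domain and
  map. They form an atlas, not a maximal one: the restriction property cannot hold for the
  maximal atlas unless \<open>T\<^sub>qQ\<^sup>r = T\<^sub>qQ\<^sup>s\<close>. That \<open>\<phi>\<close> takes on \<open>U \<inter> Q\<^sup>r\<close> values in \<open>T\<^sub>qQ\<^sup>r\<close>, and then is a chart,
  means that it factors through the tangent map of the inclusion by a chart \<open>\<psi>\<close> of \<open>Q\<^sup>r\<close>.
\<close>

definition banach_chain ::
  "real \<Rightarrow> (real \<Rightarrow> ('q, 'e::banach) manifold)
     \<Rightarrow> (real \<Rightarrow> ('q \<times> 'q set \<times> ('q \<Rightarrow> ('q, 'e) tvec)) set) \<Rightarrow> bool" where
  "banach_chain s0 Q C \<longleftrightarrow>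
     (\<forall>s>s0. smooth_manifold (Q s)) \<and>
     (\<forall>s>s0. (\<forall>(q, U, \<phi>)\<in>C s. q \<in> points (Q s) \<and> tangent_chart (Q s) q U \<phi>) \<and>
             (\<Union>(q, U, \<phi>)\<in>C s. U) = points (Q s)) \<and>
     (\<forall>s>s0. \<forall>r>s.
        points (Q r) \<subseteq> points (Q s) \<and>
        Ck_map \<infinity> (Q r) (Q s) (\<lambda>x. x) \<and>
        mtop (Q s) closure_of points (Q r) = points (Q s) \<and>
        (\<forall>q\<in>points (Q r). tangent_space (Q s) q \<subseteq>
           closure (tangent_map (Q r) (Q s) (\<lambda>x. x) q ` tangent_space (Q r) q)) \<and>
        (\<forall>(q, U, \<phi>)\<in>C s. q \<in> points (Q r) \<longrightarrow>
           (\<exists>\<psi>. (q, U \<inter> points (Q r), \<psi>) \<in> C r \<and>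
              (\<forall>x\<in>U \<inter> points (Q r). tangent_map (Q r) (Q s) (\<lambda>x. x) q (\<psi> x) = \<phi> x))))"

definition compatible_weak_metric ::
  "real \<Rightarrow> (real \<Rightarrow> ('q, 'e::banach) manifold)
     \<Rightarrow> (real \<Rightarrow> 'q \<Rightarrow> ('q, 'e) tvec \<Rightarrow> ('q, 'e) tvec \<Rightarrow> real) \<Rightarrow> bool" where
  "compatible_weak_metric s0 Q \<gamma> \<longleftrightarrow>
     (\<forall>s>s0. weak_riemannian_metric (Q s) (\<gamma> s)) \<and>
     (\<forall>s>s0. \<forall>r>s. \<forall>q\<in>points (Q r). \<forall>v\<in>tangent_space (Q r) q. \<forall>w\<in>tangent_space (Q r) q.
        \<gamma> s q (tangent_map (Q r) (Q s) (\<lambda>x. x) q v) (tangent_map (Q r) (Q s) (\<lambda>x. x) q w) = \<gamma> r q v w)"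

section \<open>Lie groups and their actions on chains\<close>

definition prod_chart ::
  "('q, 'e) chart \<Rightarrow> ('p, 'f) chart \<Rightarrow> ('q \<times> 'p, 'e \<times> 'f) chart" where
  "prod_chart c d = \<lparr>chart_dom = chart_dom c \<times> chart_dom d,
     chart_map = map_prod (chart_map c) (chart_map d),
     chart_space = chart_space c \<times> chart_space d\<rparr>"

definition prod_manifold ::
  "('q, 'e) manifold \<Rightarrow> ('p, 'f) manifold \<Rightarrow> ('q \<times> 'p, 'e \<times> 'f) manifold" where
  "prod_manifold M N = \<lparr>mtop = prod_topology (mtop M) (mtop N),
     atlas = {prod_chart c d | c d. c \<in> atlas M \<and> d \<in> atlas N}\<rparr>"

text \<open>
  The manifold \<open>L\<close> underlying the group \<open>G\<close> is modelled on subspaces of a Euclidean space; this includes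
  discrete groups, modelled on \<open>{0}\<close>.
\<close>

definition lie_group :: "('g, 'b) monoid_scheme \<Rightarrow> ('g, 'd::euclidean_space) manifold \<Rightarrow> bool" where
  "lie_group G L \<longleftrightarrow>
     group G \<and> smooth_manifold L \<and> points L = carrier G \<and>
     Ck_map \<infinity> (prod_manifold L L) L (\<lambda>(g, h). g \<otimes>\<^bsub>G\<^esub> h) \<and>
     Ck_map \<infinity> L L (\<lambda>g. inv\<^bsub>G\<^esub> g)"

definition proper_action ::
  "'g topology \<Rightarrow> 'q topology \<Rightarrow> ('g \<Rightarrow> 'q \<Rightarrow> 'q) \<Rightarrow> bool" where
  "proper_action X Y \<Phi> \<longleftrightarrow>
     (\<forall>(g :: nat \<Rightarrow> 'g) (q :: nat \<Rightarrow> 'q).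
        range g \<subseteq> topspace X \<and> range q \<subseteq> topspace Y \<and>
        (\<exists>l. limitin Y q l sequentially) \<and>
        (\<exists>l. limitin Y (\<lambda>n. \<Phi> (g n) (q n)) l sequentially) \<longrightarrow>
        (\<exists>\<sigma> l. strict_mono \<sigma> \<and> limitin X (g \<circ> \<sigma>) l sequentially))"

definition chain_action ::
  "real \<Rightarrow> (real \<Rightarrow> ('q, 'e::banach) manifold)
     \<Rightarrow> ('g, 'b) monoid_scheme \<Rightarrow> ('g, 'd::euclidean_space) manifold
     \<Rightarrow> (real \<Rightarrow> 'g \<Rightarrow> 'q \<Rightarrow> 'q) \<Rightarrow> bool" where
  "chain_action s0 Q G L \<Phi> \<longleftrightarrow>
     (\<forall>s>s0. group_action G (points (Q s)) (\<Phi> s)) \<and>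
     (\<forall>s>s0. continuous_map (prod_topology (mtop L) (mtop (Q s))) (mtop (Q s)) (\<lambda>(g, q). \<Phi> s g q)) \<and>
     (\<forall>s>s0. proper_action (mtop L) (mtop (Q s)) (\<Phi> s)) \<and>
     (\<forall>s>s0. \<forall>r>s. \<forall>g\<in>carrier G. \<forall>q\<in>points (Q r). \<Phi> s g q = \<Phi> r g q) \<and>
     (\<forall>s>s0. \<forall>g\<in>carrier G. Ck_map \<infinity> (Q s) (Q s) (\<Phi> s g)) \<and>
     (\<forall>s>s0 + 1. \<forall>q\<in>points (Q s). Ck_map 1 L (Q (s - 1)) (\<lambda>g. \<Phi> s g q))"

definition fixed_point_set ::
  "('q, 'e) manifold \<Rightarrow> ('g, 'b) monoid_scheme \<Rightarrow> ('g \<Rightarrow> 'q \<Rightarrow> 'q) \<Rightarrow> 'g set \<Rightarrow> 'q set" where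
  "fixed_point_set M G \<Phi> H = {q \<in> points M. H \<subseteq> stabilizer G \<Phi> q}"

definition fixed_tangent_vectors ::
  "('q, 'e::real_normed_vector) manifold \<Rightarrow> ('g \<Rightarrow> 'q \<Rightarrow> 'q) \<Rightarrow> 'g set \<Rightarrow> 'q \<Rightarrow> ('q, 'e) tvec set" where
  "fixed_tangent_vectors M \<Phi> H q =
     {v \<in> tangent_space M q. \<forall>h\<in>H. tangent_map M M (\<Phi> h) q v = v}"

end

theory Submission
  imports Defs
begin

text \<open>
Fix one of the manifolds \<open>Q\<^sup>s\<close>. The compact group \<open>H\<close> acts on it continuously, and each single element acts by a
smooth map. Let \<open>q\<close> be a fixed point, choose a chart around \<open>q\<close> and write \<open>F h\<close> for the action of \<open>h\<close> in this
chart, \<open>x\<^sub>0\<close> for the coordinates of \<open>q\<close> and \<open>A h\<close> for the derivative of \<open>F h\<close> at \<open>x\<^sub>0\<close>. Then \<open>A\<close> is a linear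
representation of \<open>H\<close> on the model space \<open>E\<close>, and the average
  \<open>\<psi> x = \<integral> A h\<^sup>-\<^sup>1 (F h x - x\<^sub>0) dh\<close>
satisfies \<open>\<psi> (F h x) = A h (\<psi> x)\<close> by the invariance of the integral, and its derivative at \<open>x\<^sub>0\<close> is the identity.
By the inverse function theorem \<open>\<psi>\<close> is a new chart around \<open>q\<close>, in which \<open>H\<close> acts linearly. In this chart the
fixed points of the action are the points of the space of vectors that are fixed by all \<open>A h\<close>. That space
is complemented, since averaging \<open>A h v\<close> over \<open>H\<close> is a projection onto it. So the chart is a slice chart
(\<open>slice_at_fixed_point\<close>). As \<open>\<psi>\<close> has derivative the identity, the tangent space of the fixed point set
consists of the vectors that are fixed by all \<open>A h\<close>, that is by all tangent maps of the action
(\<open>fixed_points_tangent_space\<close>).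

Three points need work.

The map \<open>\<psi>\<close> has to be smooth, although the action is only continuous in \<open>h\<close>: differentiation under the
integral requires bounds on the derivatives of \<open>F h\<close> that are uniform in \<open>h\<close>. They come from the Baire
category theorem. For each order the group is the union of countably many closed sets on each of which such
a bound holds; one of these sets has an interior point, and a translation in the group moves that point to
any other one (\<open>locally_uniform_cube_bounded\<close>, \<open>uniform_cube_bounded\<close>).

This argument, the average, the composition of smooth maps and the inverse function theorem are needed for
derivatives of every order. Instead of derivatives, smoothness is described by bounds on iterated
differences: \<open>f\<close> is smooth iff near each point and for each \<open>k\<close> the \<open>k\<close>-th differences of \<open>f\<close> with increments
\<open>h\<^sub>1, \<dots>, h\<^sub>k\<close> are at most \<open>C \<parallel>h\<^sub>1\<parallel> \<cdots> \<parallel>h\<^sub>k\<parallel>\<close> (\<open>Ck_imp_cube_smooth\<close>, \<open>cube_smooth_imp_Ck\<close>). Such bounds evidently pass to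
pointwise limits and to averages. They are stable under composition by an exact formula for the differences
of a composite (\<open>cube_diff_compose\<close>), and the same formula gives them for inverse maps (\<open>cube_smooth_inverse\<close>).

The integral is an invariant mean for continuous functions with values in a Banach space. It is obtained by
von Neumann's method: averages of right translates of a function come uniformly close to a constant, and the
limiting constant is unique because left and right averages commute (\<open>exists_right_approx\<close>,
\<open>mean_approx_unique\<close>).
\<close>

section \<open>Iterated differences over cubes\<close>

text \<open>
  If \<open>y S = f (x + sum h S)\<close>, this is the iterated difference of \<open>f\<close> at \<open>x\<close> with the increments \<open>h i\<close> for \<open>i \<in> I\<close>.
  The points \<open>y S\<close> need not be of that form, since nonlinear maps do not preserve parallelepipeds.
\<close>

definition cube_diff :: "'i set \<Rightarrow> ('i set \<Rightarrow> 'b::real_vector) \<Rightarrow> 'b" where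
  "cube_diff I y = (\<Sum>S\<in>Pow I. (-1) ^ card (I - S) *\<^sub>R y S)"

lemma cube_diff_empty [simp]: "cube_diff {} y = y {}"
  by (simp add: cube_diff_def)

lemma cube_diff_insert:
  assumes "finite I" "i \<notin> I"
  shows "cube_diff (insert i I) y = cube_diff I (\<lambda>S. y (insert i S)) - cube_diff I y"
proof -
  have inj: "inj_on (insert i) (Pow I)"
    using assms(2) by (intro inj_onI) (auto simp: insert_ident)
  have disj: "Pow I \<inter> insert i ` Pow I = {}"
    using assms(2) by auto
  have 1: "(\<Sum>S\<in>Pow I. (-1) ^ card (insert i I - S) *\<^sub>R y S) = - cube_diff I y"
    unfolding cube_diff_def sum_negf [symmetric]
  proof (rule sum.cong)
    fix S assume "S \<in> Pow I"
    then have "insert i I - S = insert i (I - S)" "finite (I - S)" "i \<notin> I - S"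
      using assms by auto
    then show "(-1) ^ card (insert i I - S) *\<^sub>R y S = - ((-1) ^ card (I - S) *\<^sub>R y S)"
      by simp
  qed simp
  have 2: "(\<Sum>S\<in>insert i ` Pow I. (-1) ^ card (insert i I - S) *\<^sub>R y S)
      = cube_diff I (\<lambda>S. y (insert i S))"
    unfolding cube_diff_def sum.reindex [OF inj] comp_def
  proof (rule sum.cong)
    fix S assume "S \<in> Pow I"
    then have "insert i I - insert i S = I - S" using assms by auto
    then show "(-1) ^ card (insert i I - insert i S) *\<^sub>R y (insert i S)
        = (-1) ^ card (I - S) *\<^sub>R y (insert i S)" by simp
  qed simp
  show ?thesis
    using 1 2 disj assms(1) unfolding cube_diff_def [of "insert i I"] Pow_insert
    by (subst sum.union_disjoint) auto
qed

lemma cube_diff_singleton [simp]: "cube_diff {i} y = y {i} - y {}"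
  by (simp add: cube_diff_insert)

lemma cube_diff_two: "i \<noteq> j \<Longrightarrow> cube_diff {i, j} y = y {i, j} - y {j} - y {i} + y {}"
  by (simp add: cube_diff_insert)

lemma cube_diff_cong: "(\<And>S. S \<subseteq> I \<Longrightarrow> y S = z S) \<Longrightarrow> cube_diff I y = cube_diff I z"
  unfolding cube_diff_def by (intro sum.cong) auto

lemma cube_diff_add: "cube_diff I (\<lambda>S. y S + z S) = cube_diff I y + cube_diff I z"
  by (simp add: cube_diff_def scaleR_add_right sum.distrib)

lemma cube_diff_diff: "cube_diff I (\<lambda>S. y S - z S) = cube_diff I y - cube_diff I z"
  by (simp add: cube_diff_def scaleR_diff_right sum_subtractf)

lemma cube_diff_scaleR: "cube_diff I (\<lambda>S. a *\<^sub>R y S) = a *\<^sub>R cube_diff I y"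
  by (simp add: cube_diff_def scaleR_sum_right mult.commute)

lemma cube_diff_zero [simp]: "cube_diff I (\<lambda>S. 0) = 0"
  by (simp add: cube_diff_def)

lemma cube_diff_sum: "cube_diff I (\<lambda>S. \<Sum>u\<in>A. y u S) = (\<Sum>u\<in>A. cube_diff I (y u))"
  unfolding cube_diff_def scaleR_sum_right by (rule sum.swap)

lemma cube_diff_mem:
  "subspace E \<Longrightarrow> (\<And>S. S \<subseteq> I \<Longrightarrow> y S \<in> E) \<Longrightarrow> cube_diff I y \<in> E"
  unfolding cube_diff_def by (intro subspace_sum subspace_scale) auto

lemma tendsto_cube_diff:
  fixes y :: "'c \<Rightarrow> 'i set \<Rightarrow> 'b::real_normed_vector"
  assumes "\<And>S. S \<subseteq> I \<Longrightarrow> ((\<lambda>n. y n S) \<longlongrightarrow> z S) F"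
  shows "((\<lambda>n. cube_diff I (y n)) \<longlongrightarrow> cube_diff I z) F"
  unfolding cube_diff_def by (intro tendsto_sum tendsto_scaleR tendsto_const assms) auto

lemma cube_diff_reindex:
  assumes "inj_on \<pi> I"
  shows "cube_diff (\<pi> ` I) y = cube_diff I (\<lambda>S. y (\<pi> ` S))"
proof -
  have "inj_on ((`) \<pi>) (Pow I)" using assms by (rule inj_on_image_Pow)
  then show ?thesis
    unfolding cube_diff_def image_Pow_surj [OF refl, symmetric]
    using assms
    by (subst sum.reindex)
      (auto intro!: sum.cong simp: inj_on_image_set_diff [symmetric, where C=I] card_image inj_on_diff)
qed

text \<open>Moebius inversion on the Boolean lattice.\<close>

lemma sum_cube_diff:
  "finite I \<Longrightarrow> (\<Sum>T\<in>Pow I. cube_diff T y) = y I"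
proof (induction I arbitrary: y rule: finite_induct)
  case (insert i I)
  have inj: "inj_on (insert i) (Pow I)"
    using insert.hyps by (intro inj_onI) (auto simp: insert_ident)
  have "(\<Sum>T\<in>Pow (insert i I). cube_diff T y)
      = (\<Sum>T\<in>Pow I. cube_diff T y) + (\<Sum>T\<in>Pow I. cube_diff (insert i T) y)"
    unfolding Pow_insert using insert.hyps
    by (subst sum.union_disjoint) (auto simp: sum.reindex [OF inj])
  also have "(\<Sum>T\<in>Pow I. cube_diff (insert i T) y)
      = (\<Sum>T\<in>Pow I. cube_diff T (\<lambda>S. y (insert i S)) - cube_diff T y)"
    using insert.hyps by (intro sum.cong cube_diff_insert) (auto intro: finite_subset)
  finally show ?case
    by (simp add: sum_subtractf insert.IH)
qed simp

text \<open>
The difference over \<open>I\<close> annihilates whatever depends on a proper subset of the coordinates only.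
\<close>

lemma cube_diff_indicator:
  "finite I \<Longrightarrow> T \<subseteq> I \<Longrightarrow> cube_diff I (\<lambda>S. if T \<subseteq> S then w else 0) = (if T = I then w else 0)"
proof (induction I arbitrary: T rule: finite_induct)
  case (insert i I)
  show ?case
  proof (cases "i \<in> T")
    case True
    have "cube_diff I (\<lambda>S. if T \<subseteq> S then w else 0) = cube_diff I (\<lambda>S. 0)"
      by (rule cube_diff_cong) (use True insert.hyps in auto)
    moreover have "cube_diff I (\<lambda>S. if T \<subseteq> insert i S then w else 0)
        = cube_diff I (\<lambda>S. if T - {i} \<subseteq> S then w else 0)"
      by (rule cube_diff_cong) auto
    moreover have "T - {i} = I \<longleftrightarrow> T = insert i I"
      using True insert.hyps by auto
    moreover have "cube_diff I (\<lambda>S. if T - {i} \<subseteq> S then w else 0) = (if T - {i} = I then w else 0)"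
      by (rule insert.IH) (use insert.prems in auto)
    ultimately show ?thesis
      unfolding cube_diff_insert [OF insert.hyps] by simp
  next
    case False
    have "cube_diff I (\<lambda>S. if T \<subseteq> insert i S then w else 0)
        = cube_diff I (\<lambda>S. if T \<subseteq> S then w else 0)"
      by (rule cube_diff_cong) (use False in auto)
    then show ?thesis
      using False insert.hyps by (auto simp: cube_diff_insert)
  qed
qed auto

text \<open>
This is the analogue of the formula of Faa di Bruno. By Moebius inversion \<open>y S\<close> is \<open>y {}\<close> plus the sum of the
\<open>z T\<close> with \<open>{} \<noteq> T \<subseteq> S\<close>, hence a vertex of the parallelepiped that all \<open>z T\<close> span at \<open>y {}\<close>. A second inversion, on
that parallelepiped, writes \<open>g (y S)\<close> as a sum over families of subsets of \<open>S\<close>, and the difference over \<open>I\<close>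
keeps just the families that cover \<open>I\<close>.
\<close>

lemma cube_diff_compose:
  fixes g :: "'b::real_vector \<Rightarrow> 'c::real_vector" and y :: "'i set \<Rightarrow> 'b"
  assumes I: "finite I"
  defines "z \<equiv> \<lambda>T. cube_diff T y"
  shows "cube_diff I (\<lambda>S. g (y S)) =
    (\<Sum>\<U> | \<U> \<subseteq> Pow I - {{}} \<and> \<Union>\<U> = I. cube_diff \<U> (\<lambda>\<T>. g (y {} + (\<Sum>T\<in>\<T>. z T))))"
proof -
  define W where "W \<U> = cube_diff \<U> (\<lambda>\<T>. g (y {} + (\<Sum>T\<in>\<T>. z T)))" for \<U>
  let ?P = "Pow (Pow I - {{}})"
  have fin: "finite ?P" using I by simp
  have gy: "g (y S) = (\<Sum>\<U>\<in>?P. if \<Union>\<U> \<subseteq> S then W \<U> else 0)" if S: "S \<subseteq> I" for S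
  proof -
    have fS: "finite S" using S I finite_subset by blast
    have "y S = (\<Sum>T\<in>Pow S. z T)"
      unfolding z_def using sum_cube_diff [OF fS, of y] by simp
    also have "\<dots> = y {} + (\<Sum>T\<in>Pow S - {{}}. z T)"
      using fS by (subst sum.remove [of _ "{}"]) (auto simp: z_def)
    finally have "g (y S) = (\<Sum>\<U>\<in>Pow (Pow S - {{}}). W \<U>)"
      unfolding W_def using fS by (subst sum_cube_diff) auto
    also have "Pow (Pow S - {{}}) = {\<U>\<in>?P. \<Union>\<U> \<subseteq> S}"
      using S by auto
    finally show ?thesis
      using fin by (simp only: sum.inter_filter)
  qed
  have "cube_diff I (\<lambda>S. g (y S)) = cube_diff I (\<lambda>S. \<Sum>\<U>\<in>?P. if \<Union>\<U> \<subseteq> S then W \<U> else 0)"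
    by (rule cube_diff_cong) (simp add: gy)
  also have "\<dots> = (\<Sum>\<U>\<in>?P. if \<Union>\<U> = I then W \<U> else 0)"
    unfolding cube_diff_sum
    by (intro sum.cong cube_diff_indicator I refl) auto
  also have "\<dots> = (\<Sum>\<U>\<in>{\<U>\<in>?P. \<Union>\<U> = I}. W \<U>)"
    using fin by (simp only: sum.inter_filter)
  finally show ?thesis
    unfolding W_def by (simp add: Pow_def)
qed

section \<open>Smoothness through bounds on cube differences\<close>

text \<open>
The differences of \<open>f\<close> up to order \<open>k\<close> are bounded on all parallelepipeds whose vertices lie in the ball of radius
\<open>\<delta>\<close> around \<open>x\<close>. No derivative occurs, so the condition passes to pointwise limits of functions.
\<close>

definition cube_bounded ::
  "'a::real_normed_vector set \<Rightarrow> ('a \<Rightarrow> 'b::real_normed_vector) \<Rightarrow> 'a \<Rightarrow> nat \<Rightarrow> real \<Rightarrow> real \<Rightarrow> bool" where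
  "cube_bounded E f x k \<delta> C \<longleftrightarrow>
     (\<forall>(I :: nat set) h y. finite I \<longrightarrow> card I \<le> k \<longrightarrow> y \<in> E \<longrightarrow> h ` I \<subseteq> E \<longrightarrow>
        (\<forall>S\<subseteq>I. y + sum h S \<in> ball x \<delta>) \<longrightarrow>
        norm (cube_diff I (\<lambda>S. f (y + sum h S))) \<le> C * (\<Prod>i\<in>I. norm (h i)))"

text \<open>
In the formula for composites the increments are indexed by sets of indices, therefore other index types than
\<open>nat\<close> have to be admitted.
\<close>

lemma cube_boundedD:
  fixes I :: "'i set"
  assumes f: "cube_bounded E f x k \<delta> C" and I: "finite I" "card I \<le> k" and E: "y \<in> E" "h ` I \<subseteq> E"
    and ball: "\<And>S. S \<subseteq> I \<Longrightarrow> y + sum h S \<in> ball x \<delta>"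
  shows "norm (cube_diff I (\<lambda>S. f (y + sum h S))) \<le> C * (\<Prod>i\<in>I. norm (h i))"
proof -
  obtain \<pi> :: "nat \<Rightarrow> 'i" where \<pi>: "bij_betw \<pi> {..<card I} I"
    using ex_bij_betw_nat_finite [OF I(1)] by (auto simp: atLeast0LessThan)
  let ?J = "{..<card I}"
  have inj: "inj_on \<pi> ?J" and img: "\<pi> ` ?J = I" using \<pi> by (auto simp: bij_betw_def)
  have sum: "sum h (\<pi> ` S) = sum (h \<circ> \<pi>) S" if "S \<subseteq> ?J" for S
    using inj that by (subst sum.reindex) (auto intro: inj_on_subset)
  have ball': "\<forall>S\<subseteq>?J. y + sum (h \<circ> \<pi>) S \<in> ball x \<delta>"
  proof (intro allI impI)
    fix S assume S: "S \<subseteq> ?J"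
    have "\<pi> ` S \<subseteq> I" using S img by blast
    then show "y + sum (h \<circ> \<pi>) S \<in> ball x \<delta>" using ball sum [OF S] by metis
  qed
  have "(h \<circ> \<pi>) ` ?J \<subseteq> E" using E(2) img by auto
  then have "norm (cube_diff ?J (\<lambda>S. f (y + sum (h \<circ> \<pi>) S))) \<le> C * (\<Prod>i\<in>?J. norm ((h \<circ> \<pi>) i))"
    using f I(2) E(1) ball' unfolding cube_bounded_def by simp
  also have "cube_diff ?J (\<lambda>S. f (y + sum (h \<circ> \<pi>) S)) = cube_diff ?J (\<lambda>S. f (y + sum h (\<pi> ` S)))"
    by (rule cube_diff_cong) (simp add: sum)
  also have "\<dots> = cube_diff I (\<lambda>S. f (y + sum h S))"
    using cube_diff_reindex [OF inj, of "\<lambda>S. f (y + sum h S)"] img by simp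
  also have "(\<Prod>i\<in>?J. norm ((h \<circ> \<pi>) i)) = (\<Prod>i\<in>I. norm (h i))"
    using prod.reindex_bij_betw [OF \<pi>, of "\<lambda>i. norm (h i)"] by simp
  finally show ?thesis .
qed

lemma cube_bounded_mono:
  assumes "cube_bounded E f x k \<delta> C" "k' \<le> k" "ball x' \<delta>' \<subseteq> ball x \<delta>" "C \<le> C'"
  shows "cube_bounded E f x' k' \<delta>' C'"
  unfolding cube_bounded_def
proof (intro allI impI)
  fix I :: "nat set" and h y
  assume A: "finite I" "card I \<le> k'" "y \<in> E" "h ` I \<subseteq> E" "\<forall>S\<subseteq>I. y + sum h S \<in> ball x' \<delta>'"
  have "norm (cube_diff I (\<lambda>S. f (y + sum h S))) \<le> C * (\<Prod>i\<in>I. norm (h i))"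
    by (rule cube_boundedD [OF assms(1)]) (use A assms(2,3) in \<open>auto simp: subset_eq\<close>)
  also have "\<dots> \<le> C' * (\<Prod>i\<in>I. norm (h i))"
    using assms(4) by (intro mult_right_mono prod_nonneg) auto
  finally show "norm (cube_diff I (\<lambda>S. f (y + sum h S))) \<le> C' * (\<Prod>i\<in>I. norm (h i))" .
qed

lemma subspace_base_sum:
  assumes "subspace E" "y \<in> E" "h ` I \<subseteq> E" "S \<subseteq> I"
  shows "y + sum h S \<in> E"
  using assms by (intro subspace_add subspace_sum) auto

lemma cube_bounded_cong:
  assumes "cube_bounded E f x k \<delta> C" "subspace E" and "\<And>y. y \<in> E \<Longrightarrow> y \<in> ball x \<delta> \<Longrightarrow> g y = f y"
  shows "cube_bounded E g x k \<delta> C"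
  unfolding cube_bounded_def
proof (intro allI impI)
  fix I :: "nat set" and h y
  assume A: "finite I" "card I \<le> k" "y \<in> E" "h ` I \<subseteq> E" "\<forall>S\<subseteq>I. y + sum h S \<in> ball x \<delta>"
  have "cube_diff I (\<lambda>S. g (y + sum h S)) = cube_diff I (\<lambda>S. f (y + sum h S))"
    using A assms(3) subspace_base_sum [OF assms(2) A(3,4)] by (intro cube_diff_cong) blast
  then show "norm (cube_diff I (\<lambda>S. g (y + sum h S))) \<le> C * (\<Prod>i\<in>I. norm (h i))"
    using cube_boundedD [OF assms(1), of I y h] A by auto
qed

lemma cube_bounded_bound:
  assumes "cube_bounded E f x k \<delta> C" "y \<in> E" "y \<in> ball x \<delta>"
  shows "norm (f y) \<le> C"
  using cube_boundedD [OF assms(1), where I="{}::nat set" and y=y and h="\<lambda>_. 0"] assms by simp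

lemma cube_bounded_Lipschitz:
  assumes "cube_bounded E f x k \<delta> C" "1 \<le> k" "subspace E" "y \<in> E" "z \<in> E" "y \<in> ball x \<delta>" "z \<in> ball x \<delta>"
  shows "norm (f z - f y) \<le> C * norm (z - y)"
proof -
  have "norm (cube_diff {0::nat} (\<lambda>S. f (y + sum (\<lambda>_. z - y) S))) \<le> C * (\<Prod>i\<in>{0::nat}. norm (z - y))"
    by (rule cube_boundedD [OF assms(1)]) (use assms in \<open>auto simp: subset_singleton_iff subspace_diff\<close>)
  then show ?thesis by simp
qed

lemma cube_bounded_second:
  assumes "cube_bounded E f x k \<delta> C" "2 \<le> k" "y \<in> E" "u \<in> E" "v \<in> E"
    "y \<in> ball x \<delta>" "y + u \<in> ball x \<delta>" "y + v \<in> ball x \<delta>" "y + u + v \<in> ball x \<delta>"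
  shows "norm (f (y + u + v) - f (y + u) - f (y + v) + f y) \<le> C * norm u * norm v"
proof -
  let ?h = "\<lambda>i::nat. if i = 0 then u else v"
  have "norm (cube_diff {0::nat, 1} (\<lambda>S. f (y + sum ?h S))) \<le> C * (\<Prod>i\<in>{0::nat, 1}. norm (?h i))"
  proof (rule cube_boundedD [OF assms(1)])
    fix S :: "nat set" assume "S \<subseteq> {0, 1}"
    then have "S \<in> Pow {0, 1}" by simp
    then consider "S = {}" | "S = {0}" | "S = {1}" | "S = {0, 1}" unfolding Pow_insert by auto
    then show "y + sum ?h S \<in> ball x \<delta>"
      by cases (use assms in \<open>simp_all add: add.assoc [symmetric]\<close>)
  qed (use assms in auto)
  moreover have "cube_diff {0::nat, 1} (\<lambda>S. f (y + sum ?h S)) = f (y + u + v) - f (y + v) - f (y + u) + f y"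
    by (subst cube_diff_two) (simp_all add: add.assoc)
  moreover have "\<dots> = f (y + u + v) - f (y + u) - f (y + v) + f y"
    by simp
  ultimately show ?thesis by (simp add: mult.assoc)
qed

text \<open>
In the formula for the differences of a composite every family covers \<open>I\<close>, so that each \<open>a i\<close> occurs at least
once as a factor; further factors are at most \<open>1\<close>. The powers of \<open>2\<close> count subsets of \<open>I\<close> and families of
such subsets. The vertices \<open>Y S\<close> may form any cube, not just the image of a parallelepiped: the proof of smoothness
of inverse maps makes use of this.
\<close>

lemma cube_diff_compose_bound:
  fixes g :: "'b::real_normed_vector \<Rightarrow> 'c::real_normed_vector" and Y :: "nat set \<Rightarrow> 'b"
  assumes g: "cube_bounded E g p (2 ^ k) \<epsilon> C" and E: "subspace E"
    and I: "finite I" "card I \<le> k" and Y: "\<And>S. S \<subseteq> I \<Longrightarrow> Y S \<in> E"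
    and a: "\<And>i. i \<in> I \<Longrightarrow> 0 \<le> a i \<and> a i \<le> \<rho>" "0 \<le> \<rho>" "\<rho> \<le> 1"
    and K: "1 \<le> K" and C: "0 \<le> C"
    and z: "\<And>T. T \<subseteq> I \<Longrightarrow> T \<noteq> {} \<Longrightarrow> norm (cube_diff T Y) \<le> K * prod a T"
    and p: "dist p (Y {}) + 2 ^ k * K * \<rho> < \<epsilon>"
  shows "norm (cube_diff I (\<lambda>S. g (Y S))) \<le> 2 ^ 2 ^ k * C * K ^ 2 ^ k * prod a I"
proof -
  define z where "z T = cube_diff T Y" for T
  define P where "P = Pow I - {{}}"
  let ?A = "{\<U>. \<U> \<subseteq> P \<and> \<Union>\<U> = I}"
  have finP: "finite P" using I(1) unfolding P_def by simp
  have cardP: "card \<U> \<le> 2 ^ k" if "\<U> \<subseteq> P" for \<U>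
  proof -
    have "card \<U> \<le> card (Pow I)" using that I(1) unfolding P_def by (intro card_mono) auto
    also have "\<dots> \<le> 2 ^ k" using I by (simp add: card_Pow)
    finally show ?thesis .
  qed
  have a1: "a i \<le> 1" if "i \<in> I" for i using a that by fastforce
  have prod_le: "prod a T \<le> prod a T'" if "T' \<subseteq> T" "T \<subseteq> I" for T T'
  proof -
    have "prod a T = prod a T' * prod a (T - T')"
      using that I(1) by (metis finite_subset mult.commute prod.subset_diff)
    also have "\<dots> \<le> prod a T' * 1"
      using that a a1 by (intro mult_left_mono prod_le_1 prod_nonneg) auto
    finally show ?thesis by simp
  qed
  have zb: "norm (z T) \<le> K * prod a T" if "T \<in> P" for T
    using that z unfolding P_def z_def by auto
  have z\<rho>: "norm (z T) \<le> K * \<rho>" if T: "T \<in> P" for T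
  proof -
    obtain i where i: "i \<in> T" "i \<in> I" using T unfolding P_def by auto
    have "prod a T \<le> prod a {i}" using T i unfolding P_def by (intro prod_le) auto
    also have "\<dots> \<le> \<rho>" using a i by simp
    finally show ?thesis using zb [OF T] K by (smt (verit) mult_left_mono)
  qed
  have zE: "z T \<in> E" if "T \<in> P" for T
    using that Y unfolding P_def z_def by (intro cube_diff_mem E) auto
  have term_bound: "norm (cube_diff \<U> (\<lambda>\<T>. g (Y {} + sum z \<T>))) \<le> C * K ^ 2 ^ k * prod a I"
    if \<U>: "\<U> \<subseteq> P" "\<Union>\<U> = I" for \<U>
  proof -
    have fin\<U>: "finite \<U>" using \<U>(1) finP by (rule finite_subset)
    have "norm (cube_diff \<U> (\<lambda>\<T>. g (Y {} + sum z \<T>))) \<le> C * (\<Prod>T\<in>\<U>. norm (z T))"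
    proof (rule cube_boundedD [OF g fin\<U>])
      fix \<T> assume \<T>: "\<T> \<subseteq> \<U>"
      show "Y {} + sum z \<T> \<in> ball p \<epsilon>"
      proof (cases "\<T> = {}")
        case True
        have "0 \<le> 2 ^ k * K * \<rho>" using a K by simp
        then show ?thesis using True p by simp
      next
        case False
        have "norm (sum z \<T>) \<le> (\<Sum>T\<in>\<T>. K * \<rho>)"
          using \<T> \<U>(1) by (intro sum_norm_le z\<rho>) auto
        also have "\<dots> = card \<T> * (K * \<rho>)" by simp
        also have "\<dots> \<le> 2 ^ k * (K * \<rho>)"
        proof (rule mult_right_mono)
          show "real (card \<T>) \<le> 2 ^ k" 
            using cardP [of \<T>] \<T> \<U>(1) by (metis numeral_power_eq_of_nat_cancel_iff of_nat_le_iff of_nat_numeral of_nat_power order_trans)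
          obtain T where "T \<in> P" using False \<T> \<U>(1) by auto
          then show "0 \<le> K * \<rho>" using z\<rho> [of T] norm_ge_zero order_trans by blast
        qed
        finally have "norm (sum z \<T>) \<le> 2 ^ k * K * \<rho>" by simp
        moreover have "dist p (Y {} + sum z \<T>) \<le> dist p (Y {}) + norm (sum z \<T>)"
          by (metis add_diff_cancel_left' dist_norm dist_triangle norm_minus_commute)
        ultimately show ?thesis using p by simp
      qed
    qed (use \<U> cardP Y zE in auto)
    also have "\<dots> \<le> C * (K ^ 2 ^ k * prod a I)"
    proof (intro mult_left_mono C)
      have "(\<Prod>T\<in>\<U>. norm (z T)) \<le> (\<Prod>T\<in>\<U>. K * prod a T)"
        using \<U>(1) zb by (intro prod_mono) auto
      also have "\<dots> = K ^ card \<U> * (\<Prod>T\<in>\<U>. prod a T)"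
        by (simp add: prod.distrib)
      also have "\<dots> \<le> K ^ 2 ^ k * prod a I"
      proof (rule mult_mono)
        show "K ^ card \<U> \<le> K ^ 2 ^ k" using K cardP [OF \<U>(1)] by (intro power_increasing) auto
        have "(\<Prod>T\<in>\<V>. prod a T) \<le> prod a (\<Union>\<V>)" if "finite \<V>" "\<V> \<subseteq> P" for \<V>
          using that
        proof (induction \<V> rule: finite_induct)
          case (insert T \<V>)
          have TI: "T \<subseteq> I" "\<Union>\<V> \<subseteq> I" using insert.prems unfolding P_def by auto
          have fT: "finite T" "finite (\<Union>\<V>)" using finite_subset [OF TI(1) I(1)] finite_subset [OF TI(2) I(1)] by simp_all
          have nn: "0 \<le> prod a S" if "S \<subseteq> I" for S using that a by (intro prod_nonneg) auto
          have "(\<Prod>T\<in>insert T \<V>. prod a T) \<le> prod a T * prod a (\<Union>\<V>)"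
            using insert nn [OF TI(1)] by (simp add: mult_left_mono)
          also have "\<dots> \<le> prod a T * prod a (\<Union>\<V> - T)"
            using TI by (intro mult_left_mono prod_le nn) auto
          also have "\<dots> = prod a (T \<union> (\<Union>\<V> - T))"
            using fT by (subst prod.union_disjoint) auto
          also have "T \<union> (\<Union>\<V> - T) = \<Union>(insert T \<V>)" by auto
          finally show ?case .
        qed simp
        then show "(\<Prod>T\<in>\<U>. prod a T) \<le> prod a I" using \<U> fin\<U> by blast
        show "0 \<le> (\<Prod>T\<in>\<U>. prod a T)" 
          using \<U> a by (intro prod_nonneg) auto
      qed (use K in auto)
      finally show "(\<Prod>T\<in>\<U>. norm (z T)) \<le> K ^ 2 ^ k * prod a I" .
    qed
    finally show ?thesis by (simp add: mult.assoc)
  qed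
  have nn: "0 \<le> C * K ^ 2 ^ k * prod a I"
    using a C K by (intro mult_nonneg_nonneg prod_nonneg) auto
  have "norm (cube_diff I (\<lambda>S. g (Y S))) \<le> (\<Sum>\<U>\<in>?A. C * K ^ 2 ^ k * prod a I)"
    unfolding cube_diff_compose [OF I(1)] z_def [symmetric] P_def [symmetric]
    by (intro sum_norm_le term_bound) auto
  also have "\<dots> = card ?A * (C * K ^ 2 ^ k * prod a I)" by simp
  also have "\<dots> \<le> 2 ^ 2 ^ k * (C * K ^ 2 ^ k * prod a I)"
  proof (rule mult_right_mono [OF _ nn])
    have "card ?A \<le> card (Pow P)" using finP by (intro card_mono) auto
    also have "\<dots> \<le> 2 ^ 2 ^ k" using cardP [of P] finP by (simp add: card_Pow)
    finally show "real (card ?A) \<le> 2 ^ 2 ^ k"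
      by (metis of_nat_le_iff of_nat_numeral of_nat_power)
  qed
  finally show ?thesis by (simp add: mult.assoc)
qed

lemma cube_diff_const: "finite I \<Longrightarrow> I \<noteq> {} \<Longrightarrow> cube_diff I (\<lambda>S. w) = 0"
proof -
  assume "finite I" "I \<noteq> {}"
  then obtain i J where "I = insert i J" "i \<notin> J" "finite J"
    by (metis Set.set_insert all_not_in_conv finite_insert)
  then show ?thesis by (simp add: cube_diff_insert)
qed

lemma cube_diff_affine:
  assumes "finite I" "2 \<le> card I" shows "cube_diff I (\<lambda>S. y + sum h S) = 0"
proof -
  have "I \<noteq> {}" using assms by auto
  then obtain i J where I: "I = insert i J" "i \<notin> J" "finite J"
    using assms by (metis Set.set_insert all_not_in_conv finite_insert)
  have J: "J \<noteq> {}" using assms I by auto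
  have "cube_diff I (\<lambda>S. y + sum h S) = cube_diff J (\<lambda>S. (y + sum h (insert i S)) - (y + sum h S))"
    unfolding I(1) cube_diff_insert [OF I(3,2)] cube_diff_diff ..
  also have "\<dots> = cube_diff J (\<lambda>S. h i)"
    using I by (intro cube_diff_cong) (metis (no_types, lifting) add_diff_cancel_right add_diff_cancel_left finite_subset subset_iff sum.insert add_diff_cancel_left' add_diff_cancel_right')
  finally show ?thesis using I J by (simp add: cube_diff_const)
qed

lemma cube_diff_top:
  assumes "finite I"
  shows "cube_diff I (\<lambda>S. if S = I then w else y S) = cube_diff I y + (w - y I)"
proof -
  have "cube_diff I (\<lambda>S. if S = I then w else y S)
      = cube_diff I (\<lambda>S. y S + (if I \<subseteq> S then w - y I else 0))"
    by (rule cube_diff_cong) auto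
  then show ?thesis
    using assms by (simp add: cube_diff_add cube_diff_indicator)
qed

lemma norm_cube_diff_le:
  fixes y :: "'i set \<Rightarrow> 'b::real_normed_vector"
  assumes "finite I" "\<And>S. S \<subseteq> I \<Longrightarrow> norm (y S) \<le> B"
  shows "norm (cube_diff I y) \<le> 2 ^ card I * B"
proof -
  have "norm (cube_diff I y) \<le> (\<Sum>S\<in>Pow I. B)"
    unfolding cube_diff_def using assms by (intro sum_norm_le) (auto simp: power_abs)
  then show ?thesis using assms by (simp add: card_Pow)
qed

lemma norm_increment_le:
  fixes h :: "'i \<Rightarrow> 'a::real_normed_vector"
  assumes "\<And>S. S \<subseteq> I \<Longrightarrow> y + sum h S \<in> ball x \<delta>" "i \<in> I"
  shows "norm (h i) \<le> 2 * \<delta>"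
proof -
  have "y \<in> ball x \<delta>" "y + h i \<in> ball x \<delta>" using assms(1) [of "{}"] assms(1) [of "{i}"] assms(2) by auto
  then have "dist y (y + h i) < \<delta> + \<delta>"
    by (intro dist_triangle_lt [where z = x]) (auto simp: dist_commute intro: add_strict_mono)
  then show ?thesis by (simp add: dist_norm)
qed

text \<open>
The radius and the bound for the composite depend on the bounds for \<open>f\<close> and \<open>g\<close> alone, which makes the lemma
applicable to families of maps. For the same reason \<open>g\<close> is controlled around a point \<open>p\<close> near \<open>f x\<close>: the point
\<open>f x\<close> varies with \<open>f\<close>.
\<close>

lemma cube_bounded_compose:
  assumes "1 \<le> k" "0 \<le> C" "0 \<le> D" "0 < \<delta>" "0 < \<epsilon>" and EF: "subspace E" "subspace F"
  obtains \<delta>' C' where "0 < \<delta>'" "\<delta>' \<le> \<delta>" "0 \<le> C'"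
    "\<And>f g x p. cube_bounded E f x k \<delta> C \<Longrightarrow> cube_bounded F g p (2 ^ k) \<epsilon> D \<Longrightarrow> dist p (f x) \<le> \<epsilon> / 2 \<Longrightarrow> x \<in> E \<Longrightarrow>
       (\<And>y. y \<in> E \<Longrightarrow> y \<in> ball x \<delta> \<Longrightarrow> f y \<in> F) \<Longrightarrow> cube_bounded E (\<lambda>y. g (f y)) x k \<delta>' C'"
proof -
  define K where "K = max 1 C"
  have K: "1 \<le> K" "C \<le> K" "0 < K" by (auto simp: K_def)
  define \<delta>' where "\<delta>' = min \<delta> (min (1/2) (\<epsilon> / (4 * K * (1 + 2 ^ (k+1)))))"
  define C' where "C' = 2 ^ 2 ^ k * D * K ^ 2 ^ k"
  have pos: "0 < 4 * K * (1 + 2 ^ (k+1))" using K by (intro mult_pos_pos add_pos_pos) auto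
  have \<delta>': "0 < \<delta>'" "\<delta>' \<le> \<delta>" "\<delta>' \<le> 1/2" using assms pos by (auto simp: \<delta>'_def)
  have "\<delta>' \<le> \<epsilon> / (4 * K * (1 + 2 ^ (k+1)))" by (simp add: \<delta>'_def)
  then have "\<delta>' * (4 * K * (1 + 2 ^ (k+1))) \<le> \<epsilon>" using pos by (simp add: pos_le_divide_eq)
  moreover have "\<delta>' * (4 * K * (1 + 2 ^ (k+1))) = 4 * (K * \<delta>' + 2 ^ k * K * (2 * \<delta>'))"
    by (simp add: algebra_simps)
  moreover have "0 < K * \<delta>' + 2 ^ k * K * (2 * \<delta>')"
    using K \<delta>' by (intro add_pos_pos mult_pos_pos) auto
  moreover have "X < e / 2" if "d \<le> e" "d = 4 * X" "0 < X" for X d e :: real using that by linarith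
  ultimately have small: "K * \<delta>' + 2 ^ k * K * (2 * \<delta>') < \<epsilon> / 2" by blast
  show thesis
  proof (rule that [OF \<delta>'(1,2)])
    show "0 \<le> C'" using assms K by (simp add: C'_def)
    fix f :: "'a \<Rightarrow> 'b" and g :: "'b \<Rightarrow> 'c" and x p
    assume f: "cube_bounded E f x k \<delta> C" and g: "cube_bounded F g p (2 ^ k) \<epsilon> D" and p: "dist p (f x) \<le> \<epsilon> / 2"
      and x: "x \<in> E" and fF: "\<And>y. y \<in> E \<Longrightarrow> y \<in> ball x \<delta> \<Longrightarrow> f y \<in> F"
    show "cube_bounded E (\<lambda>y. g (f y)) x k \<delta>' C'"
      unfolding cube_bounded_def
    proof (intro allI impI)
      fix I :: "nat set" and h y
      assume A: "finite I" "card I \<le> k" "y \<in> E" "h ` I \<subseteq> E" "\<forall>S\<subseteq>I. y + sum h S \<in> ball x \<delta>'"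
      have yS: "y + sum h S \<in> E" "y + sum h S \<in> ball x \<delta>" if "S \<subseteq> I" for S
        using subspace_base_sum [OF EF(1) A(3,4) that] A(5) that subset_ball [OF \<delta>'(2), of x] by blast+
      have y: "y \<in> ball x \<delta>'" using A(5) by auto
      have fy: "norm (f y - f x) \<le> K * \<delta>'"
      proof -
        have "norm (f y - f x) \<le> C * norm (y - x)"
          using x A(3) y \<delta>' assms by (intro cube_bounded_Lipschitz [OF f _ EF(1)]) auto
        also have "\<dots> \<le> K * \<delta>'"
          using y K assms by (intro mult_mono) (auto simp: dist_norm norm_minus_commute)
        finally show ?thesis .
      qed
      show "norm (cube_diff I (\<lambda>S. g (f (y + sum h S)))) \<le> C' * (\<Prod>i\<in>I. norm (h i))"
        unfolding C'_def
      proof (rule cube_diff_compose_bound [OF g EF(2) A(1,2), where \<rho> = "2 * \<delta>'"])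
        show "f (y + sum h S) \<in> F" if "S \<subseteq> I" for S using fF yS that by blast
        show "0 \<le> norm (h i) \<and> norm (h i) \<le> 2 * \<delta>'" if "i \<in> I" for i
          using norm_increment_le [of I y h x \<delta>' i] A(5) that by auto
        show "norm (cube_diff T (\<lambda>S. f (y + sum h S))) \<le> K * (\<Prod>i\<in>T. norm (h i))" if "T \<subseteq> I" for T
        proof -
          have "norm (cube_diff T (\<lambda>S. f (y + sum h S))) \<le> C * (\<Prod>i\<in>T. norm (h i))"
            using A that yS order_trans [OF card_mono [OF A(1) that] A(2)]
            by (intro cube_boundedD [OF f] finite_subset [OF that]) auto
          also have "\<dots> \<le> K * (\<Prod>i\<in>T. norm (h i))"
            using K by (intro mult_right_mono prod_nonneg) auto
          finally show ?thesis .
        qed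
        have "dist p (f y) \<le> dist p (f x) + norm (f y - f x)"
          by (metis dist_norm dist_triangle dist_commute)
        then show "dist p (f (y + sum h {})) + 2 ^ k * K * (2 * \<delta>') < \<epsilon>"
          using p fy small by simp
      qed (use \<delta>' K assms in auto)
    qed
  qed
qed

definition cube_smooth :: "'a::real_normed_vector set \<Rightarrow> 'a set \<Rightarrow> ('a \<Rightarrow> 'b::real_normed_vector) \<Rightarrow> bool" where
  "cube_smooth E U f \<longleftrightarrow> (\<forall>x\<in>U. \<forall>k. \<exists>\<delta>>0. \<exists>C\<ge>0. cube_bounded E f x k \<delta> C)"

lemma openin_subspace_ball:
  fixes E :: "'a::real_normed_vector set"
  assumes "openin (top_of_set E) U" "x \<in> U"
  obtains \<delta> where "0 < \<delta>" "E \<inter> ball x \<delta> \<subseteq> U"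
  using assms unfolding openin_contains_ball by (metis Int_commute)

lemma cube_smoothE:
  assumes "cube_smooth E U f" "openin (top_of_set E) U" "x \<in> U" "0 < \<epsilon>"
  obtains \<delta> C where "0 < \<delta>" "\<delta> \<le> \<epsilon>" "0 \<le> C" "cube_bounded E f x k \<delta> C" "E \<inter> ball x \<delta> \<subseteq> U"
proof -
  obtain \<delta>1 C where 1: "0 < \<delta>1" "0 \<le> C" "cube_bounded E f x k \<delta>1 C"
    using assms(1,3) unfolding cube_smooth_def by metis
  obtain \<delta>2 where 2: "0 < \<delta>2" "E \<inter> ball x \<delta>2 \<subseteq> U"
    using openin_subspace_ball [OF assms(2,3)] by blast
  let ?d = "min \<epsilon> (min \<delta>1 \<delta>2)"
  show thesis
  proof (rule that [of ?d C])
    show "cube_bounded E f x k ?d C" by (rule cube_bounded_mono [OF 1(3)]) auto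
    show "E \<inter> ball x ?d \<subseteq> U" using 2 by (force simp: subset_eq)
  qed (use 1 2 assms in auto)
qed

lemma cube_smoothI:
  assumes "\<And>x k. x \<in> U \<Longrightarrow> 1 \<le> k \<Longrightarrow> \<exists>\<delta>>0. \<exists>C\<ge>0. cube_bounded E f x k \<delta> C"
  shows "cube_smooth E U f"
  unfolding cube_smooth_def
proof (intro ballI allI)
  fix x k assume "x \<in> U"
  then obtain \<delta> C where "\<delta> > 0" "C \<ge> 0" "cube_bounded E f x (max 1 k) \<delta> C" using assms [of x "max 1 k"] by auto
  then show "\<exists>\<delta>>0. \<exists>C\<ge>0. cube_bounded E f x k \<delta> C" 
    by (metis cube_bounded_mono max.cobounded2 order_refl)
qed

lemma cube_smooth_cong:
  assumes "cube_smooth E U f" "subspace E" "openin (top_of_set E) U" "\<And>x. x \<in> U \<Longrightarrow> g x = f x"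
  shows "cube_smooth E U g"
proof (rule cube_smoothI)
  fix x and k :: nat assume x: "x \<in> U"
  obtain \<delta> C where d: "0 < \<delta>" "0 \<le> C" "cube_bounded E f x k \<delta> C" "E \<inter> ball x \<delta> \<subseteq> U"
    using cube_smoothE [OF assms(1,3) x zero_less_one] by metis
  have "cube_bounded E g x k \<delta> C"
    by (rule cube_bounded_cong [OF d(3) assms(2)]) (use d(4) assms(4) in auto)
  then show "\<exists>\<delta>>0. \<exists>C\<ge>0. cube_bounded E g x k \<delta> C" using d by blast
qed

lemma cube_smooth_subset: "cube_smooth E U f \<Longrightarrow> U' \<subseteq> U \<Longrightarrow> cube_smooth E U' f"
  unfolding cube_smooth_def by blast

lemma cube_smooth_compose:
  assumes f: "cube_smooth E U f" and g: "cube_smooth F V g" and E: "subspace E" "openin (top_of_set E) U"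
    and F: "subspace F" "V \<subseteq> F" and fU: "f ` U \<subseteq> V"
  shows "cube_smooth E U (\<lambda>x. g (f x))"
proof (rule cube_smoothI)
  fix x and k :: nat assume x: "x \<in> U" and k: "1 \<le> k"
  obtain \<delta> C where d: "0 < \<delta>" "0 \<le> C" "cube_bounded E f x k \<delta> C" "E \<inter> ball x \<delta> \<subseteq> U"
    using cube_smoothE [OF f E(2) x zero_less_one] by metis
  have "f x \<in> V" using fU x by auto
  then obtain \<epsilon> D where e: "0 < \<epsilon>" "0 \<le> D" "cube_bounded F g (f x) (2 ^ k) \<epsilon> D"
    using g unfolding cube_smooth_def by metis
  obtain \<delta>' C' where "0 < \<delta>'" "0 \<le> C'" and *: "\<And>f g x p. cube_bounded E f x k \<delta> C \<Longrightarrow> cube_bounded F g p (2 ^ k) \<epsilon> D \<Longrightarrow> dist p (f x) \<le> \<epsilon> / 2 \<Longrightarrow> x \<in> E \<Longrightarrow>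
       (\<And>y. y \<in> E \<Longrightarrow> y \<in> ball x \<delta> \<Longrightarrow> f y \<in> F) \<Longrightarrow> cube_bounded E (\<lambda>y. (g :: _ \<Rightarrow> 'c) (f y)) x k \<delta>' C'"
    by (rule cube_bounded_compose [OF k d(2) e(2) d(1) e(1) E(1) F(1)]) blast
  have "x \<in> E" using x E(2) openin_imp_subset by blast
  then have "cube_bounded E (\<lambda>y. g (f y)) x k \<delta>' C'"
    using e(1) d(4) fU F(2) by (intro * [OF d(3) e(3)]) (auto simp: subset_eq)
  then show "\<exists>\<delta>>0. \<exists>C\<ge>0. cube_bounded E (\<lambda>x. g (f x)) x k \<delta> C"
    using \<open>0 < \<delta>'\<close> \<open>0 \<le> C'\<close> by blast
qed

text \<open>
Smoothness of the inverse map, by induction on the order of the differences. Let \<open>Y S = \<phi> (y + sum h S)\<close> and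
change the vertex \<open>Y I\<close> in such a way that the difference over \<open>I\<close> becomes \<open>0\<close>. For the changed cube \<open>Y'\<close> the
induction hypothesis and the bound for composites control the difference of \<open>\<psi> \<circ> Y'\<close>. The difference of
\<open>\<psi> \<circ> Y\<close> vanishes when \<open>card I \<ge> 2\<close>, as \<open>\<psi> (Y S)\<close> is affine in \<open>S\<close>. The two cubes agree outside \<open>I\<close>, which leaves a
bound for \<open>\<psi> (Y' I) - \<psi> (Y I)\<close>, hence for \<open>Y' I - Y I\<close>, and up to sign this is the difference of \<open>Y\<close>.
\<close>

lemma cube_smooth_inverse:
  fixes \<psi> \<phi> :: "'a::real_normed_vector \<Rightarrow> 'a"
  assumes \<psi>: "cube_smooth E W \<psi>" and E: "subspace E" and W: "openin (top_of_set E) W"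
    and V: "openin (top_of_set E) V"
    and \<phi>: "\<And>y. y \<in> V \<Longrightarrow> \<phi> y \<in> W \<and> \<psi> (\<phi> y) = y"
    and M: "\<And>x y. x \<in> W \<Longrightarrow> y \<in> W \<Longrightarrow> norm (x - y) \<le> M * norm (\<psi> x - \<psi> y)" "0 \<le> M"
  shows "cube_smooth E V \<phi>"
proof -
  have WE: "W \<subseteq> E" and VE: "V \<subseteq> E" using V W openin_imp_subset by auto
  have Lip: "norm (\<phi> y - \<phi> z) \<le> M * norm (y - z)" if "y \<in> V" "z \<in> V" for y z
    using M(1) [of "\<phi> y" "\<phi> z"] \<phi> that by simp
  have "\<exists>\<delta>>0. \<exists>C\<ge>0. cube_bounded E \<phi> v k \<delta> C" if v: "v \<in> V" for v k
  proof (induction k)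
    case 0
    obtain \<delta> where d: "0 < \<delta>" "E \<inter> ball v \<delta> \<subseteq> V" using openin_subspace_ball [OF V v] by blast
    have "cube_bounded E \<phi> v 0 \<delta> (norm (\<phi> v) + M * \<delta>)"
      unfolding cube_bounded_def
    proof (intro allI impI)
      fix I :: "nat set" and h y
      assume A: "finite I" "card I \<le> 0" "y \<in> E" "h ` I \<subseteq> E" "\<forall>S\<subseteq>I. y + sum h S \<in> ball v \<delta>"
      have I: "I = {}" using A by simp
      have y: "y \<in> V" "norm (y - v) \<le> \<delta>" using A d by (auto simp: dist_norm norm_minus_commute)
      have "norm (\<phi> y) \<le> norm (\<phi> v) + norm (\<phi> y - \<phi> v)" by (metis add.commute diff_add_cancel norm_triangle_ineq)
      also have "norm (\<phi> y - \<phi> v) \<le> M * \<delta>"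
        using Lip [OF y(1) v] mult_left_mono [OF y(2) M(2)] by linarith
      finally show "norm (cube_diff I (\<lambda>S. \<phi> (y + sum h S))) \<le> (norm (\<phi> v) + M * \<delta>) * (\<Prod>i\<in>I. norm (h i))"
        using I by simp
    qed
    then show ?case using d M by (metis add_nonneg_nonneg less_imp_le mult_nonneg_nonneg norm_ge_zero)
  next
    case (Suc k)
    obtain \<delta>1 C1 where 1: "0 < \<delta>1" "0 \<le> C1" "cube_bounded E \<phi> v k \<delta>1 C1" using Suc by blast
    obtain \<delta>2 where 2: "0 < \<delta>2" "E \<inter> ball v \<delta>2 \<subseteq> V" using openin_subspace_ball [OF V v] by blast
    have \<phi>v: "\<phi> v \<in> W" using \<phi> v by auto
    obtain \<epsilon> D where e: "0 < \<epsilon>" "0 \<le> D" "cube_bounded E \<psi> (\<phi> v) (2 ^ Suc k) \<epsilon> D" "E \<inter> ball (\<phi> v) \<epsilon> \<subseteq> W"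
      using cube_smoothE [OF \<psi> W \<phi>v zero_less_one] by metis
    define K where "K = max 1 (max C1 M)"
    have K: "1 \<le> K" "C1 \<le> K" "M \<le> K" "0 < K" by (auto simp: K_def)
    define \<delta> where "\<delta> = min (min \<delta>1 \<delta>2) (min (1/2) (\<epsilon> / (2 * K * (1 + 2 ^ (k+2)))))"
    have pos: "0 < 2 * K * (1 + 2 ^ (k+2))" using K by (intro mult_pos_pos add_pos_pos) auto
    have d: "0 < \<delta>" "\<delta> \<le> \<delta>1" "\<delta> \<le> \<delta>2" using 1 2 e pos by (auto simp: \<delta>_def)
    have d2: "\<delta> \<le> 1/2" unfolding \<delta>_def by (meson min.cobounded1 min.cobounded2 order_trans)
    have "\<delta> \<le> \<epsilon> / (2 * K * (1 + 2 ^ (k+2)))" by (simp add: \<delta>_def)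
    then have "\<delta> * (2 * K * (1 + 2 ^ (k+2))) \<le> \<epsilon>" using pos by (simp add: pos_le_divide_eq)
    moreover have "\<delta> * (2 * K * (1 + 2 ^ (k+2))) = 2 * (K * \<delta> + 2 ^ Suc k * K * (2 * \<delta>))"
      by (simp add: algebra_simps)
    moreover have "0 < K * \<delta> + 2 ^ Suc k * K * (2 * \<delta>)"
      using K d by (intro add_pos_pos mult_pos_pos) auto
    moreover have "X < e" if "d \<le> e" "d = 2 * X" "0 < X" for X d e :: real using that by linarith
    ultimately have small: "K * \<delta> + 2 ^ Suc k * K * (2 * \<delta>) < \<epsilon>" by blast
    define C where "C = max K (M * (2 ^ 2 ^ Suc k * D * K ^ 2 ^ Suc k))"
    have "cube_bounded E \<phi> v (Suc k) \<delta> C"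
      unfolding cube_bounded_def
    proof (intro allI impI)
      fix I :: "nat set" and h y
      assume A: "finite I" "card I \<le> Suc k" "y \<in> E" "h ` I \<subseteq> E" "\<forall>S\<subseteq>I. y + sum h S \<in> ball v \<delta>"
      define Y where "Y S = \<phi> (y + sum h S)" for S
      have yS: "y + sum h S \<in> V" "norm (y + sum h S - v) \<le> \<delta>" if "S \<subseteq> I" for S
      proof -
        have b: "y + sum h S \<in> ball v \<delta>" using A(5) that by blast
        then show "y + sum h S \<in> V"
          using subspace_base_sum [OF E A(3,4) that] 2(2) subset_ball [OF d(3), of v] by blast
        show "norm (y + sum h S - v) \<le> \<delta>"
          using b by (simp add: dist_norm norm_minus_commute)
      qed
      have YW: "Y S \<in> W" "\<psi> (Y S) = y + sum h S" if "S \<subseteq> I" for S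
        using \<phi> yS that unfolding Y_def by auto
      have Ynear: "norm (Y S - \<phi> v) \<le> K * \<delta>" if "S \<subseteq> I" for S
      proof -
        have "norm (Y S - \<phi> v) \<le> M * norm (y + sum h S - v)"
          unfolding Y_def using Lip yS that v by blast
        also have "\<dots> \<le> K * \<delta>" using yS that K M by (intro mult_mono) auto
        finally show ?thesis .
      qed
      have nnp: "0 \<le> (\<Prod>i\<in>T. norm (h i))" for T by (intro prod_nonneg) auto
      have zk: "norm (cube_diff T Y) \<le> K * (\<Prod>i\<in>T. norm (h i))" if T: "T \<subseteq> I" "card T \<le> k" for T
      proof -
        have "norm (cube_diff T Y) \<le> C1 * (\<Prod>i\<in>T. norm (h i))"
          unfolding Y_def
        proof (intro cube_boundedD [OF 1(3)] T)
          show "y + sum h S \<in> ball v \<delta>1" if "S \<subseteq> T" for S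
            using A(5) that T(1) subset_ball [OF d(2), of v] by blast
        qed (use A T finite_subset in auto)
        also have "\<dots> \<le> K * (\<Prod>i\<in>T. norm (h i))" using K by (intro mult_right_mono nnp)
        finally show ?thesis .
      qed
      have "norm (cube_diff I Y) \<le> C * (\<Prod>i\<in>I. norm (h i))"
      proof (cases "card I = Suc k")
        case False
        then have "norm (cube_diff I Y) \<le> K * (\<Prod>i\<in>I. norm (h i))" using A zk by simp
        also have "\<dots> \<le> C * (\<Prod>i\<in>I. norm (h i))" by (intro mult_right_mono nnp) (simp add: C_def)
        finally show ?thesis .
      next
        case True
        have ne: "I \<noteq> {}" using True by auto
        define z where "z = cube_diff I Y"
        (* The choice of the new top vertex makes the difference of Y' over I vanish and leaves the others alone. *)
        define Y' where "Y' S = (if S = I then Y I - z else Y S)" for S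
        have zE: "z \<in> E" unfolding z_def using YW WE by (intro cube_diff_mem E) auto
        have Y'diff: "cube_diff T Y' = (if T = I then 0 else cube_diff T Y)" if "T \<subseteq> I" for T
        proof (cases "T = I")
          case True
          then show ?thesis unfolding Y'_def using cube_diff_top [OF A(1), of "Y I - z" Y] by (simp add: z_def)
        next
          case False
          then have "cube_diff T Y' = cube_diff T Y" unfolding Y'_def using that by (intro cube_diff_cong) auto
          then show ?thesis using False by simp
        qed
        have Y'E: "Y' S \<in> E" if "S \<subseteq> I" for S
          unfolding Y'_def using YW that WE zE subspace_diff [OF E, of "Y I" z] by auto
        have Y'I: "Y' I \<in> W"
        proof -
          have "cube_diff I (\<lambda>S. Y S - \<phi> v) = z"
            unfolding z_def cube_diff_diff using cube_diff_const [OF A(1) ne] by simp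
          then have "norm z \<le> 2 ^ card I * (K * \<delta>)"
            using norm_cube_diff_le [OF A(1), of "\<lambda>S. Y S - \<phi> v" "K * \<delta>"] Ynear by simp
          moreover have "norm (Y I - z - \<phi> v) \<le> norm (Y I - \<phi> v) + norm z"
            using norm_triangle_ineq4 [of "Y I - \<phi> v" z] by (simp add: algebra_simps)
          ultimately have "norm (Y I - z - \<phi> v) \<le> K * \<delta> + 2 ^ card I * (K * \<delta>)"
            using Ynear [of I] by fastforce
          also have "\<dots> \<le> K * \<delta> + 2 ^ Suc k * K * (2 * \<delta>)"
            using K d True by simp
          finally have "norm (Y I - z - \<phi> v) \<le> K * \<delta> + 2 ^ Suc k * K * (2 * \<delta>)" .
          then have "norm (Y I - z - \<phi> v) < \<epsilon>" using small by (rule le_less_trans)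
          then show ?thesis
            using e(4) Y'E [of I] by (auto simp: Y'_def dist_norm norm_minus_commute subset_eq)
        qed
        have \<psi>Y': "norm (cube_diff I (\<lambda>S. \<psi> (Y' S))) \<le> 2 ^ 2 ^ Suc k * D * K ^ 2 ^ Suc k * (\<Prod>i\<in>I. norm (h i))"
        proof (rule cube_diff_compose_bound [OF e(3) E A(1,2) Y'E, where \<rho> = "2 * \<delta>"])
          show "0 \<le> norm (h i) \<and> norm (h i) \<le> 2 * \<delta>" if "i \<in> I" for i
            using norm_increment_le [of I y h v \<delta> i] A(5) that by auto
          show "norm (cube_diff T Y') \<le> K * (\<Prod>i\<in>T. norm (h i))" if "T \<subseteq> I" for T
          proof (cases "T = I")
            case True
            then show ?thesis using Y'diff [OF that] K nnp by simp
          next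
            case False
            then have "card T < card I" using that A(1) by (intro psubset_card_mono) auto
            then show ?thesis using Y'diff [OF that] False zk [OF that] True by simp
          qed
          show "dist (\<phi> v) (Y' {}) + 2 ^ Suc k * K * (2 * \<delta>) < \<epsilon>"
            using small Ynear [of "{}"] ne by (simp add: Y'_def dist_norm norm_minus_commute)
        qed (use d d2 K e in auto)
        show ?thesis
        proof (cases "k = 0")
          case True
          then obtain i where I: "I = {i}" using \<open>card I = Suc k\<close> by (auto simp: card_Suc_eq)
          have "norm (cube_diff I Y) \<le> M * norm (h i)"
            using Lip [OF yS(1) [of "{i}"] yS(1) [of "{}"]] I by (simp add: Y_def)
          also have "\<dots> \<le> C * norm (h i)" using K by (intro mult_right_mono) (auto simp: C_def)
          finally show ?thesis using I by simp
        next
          case False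
          have "cube_diff I (\<lambda>S. \<psi> (Y S)) = cube_diff I (\<lambda>S. y + sum h S)"
            using YW by (intro cube_diff_cong) auto
          also have "\<dots> = 0" using True False A(1) by (intro cube_diff_affine) auto
          finally have "cube_diff I (\<lambda>S. if S = I then \<psi> (Y' I) else \<psi> (Y S)) = \<psi> (Y' I) - \<psi> (Y I)"
            using cube_diff_top [OF A(1), of "\<psi> (Y' I)" "\<lambda>S. \<psi> (Y S)"] by simp
          moreover have "cube_diff I (\<lambda>S. if S = I then \<psi> (Y' I) else \<psi> (Y S)) = cube_diff I (\<lambda>S. \<psi> (Y' S))"
            by (intro cube_diff_cong) (simp add: Y'_def)
          ultimately have eq: "cube_diff I (\<lambda>S. \<psi> (Y' S)) = \<psi> (Y' I) - \<psi> (Y I)" by simp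
          have "norm z = norm (Y' I - Y I)" by (simp add: Y'_def)
          also have "\<dots> \<le> M * norm (\<psi> (Y' I) - \<psi> (Y I))" using Y'I YW by (intro M(1)) auto
          also have "\<dots> \<le> M * (2 ^ 2 ^ Suc k * D * K ^ 2 ^ Suc k * (\<Prod>i\<in>I. norm (h i)))"
            unfolding eq [symmetric] by (intro mult_left_mono \<psi>Y' M(2))
          also have "\<dots> = M * (2 ^ 2 ^ Suc k * D * K ^ 2 ^ Suc k) * (\<Prod>i\<in>I. norm (h i))"
            by (simp only: mult.assoc)
          also have "\<dots> \<le> C * (\<Prod>i\<in>I. norm (h i))" by (intro mult_right_mono nnp) (simp add: C_def)
          finally show ?thesis by (simp add: z_def)
        qed
      qed
      then show "norm (cube_diff I (\<lambda>S. \<phi> (y + sum h S))) \<le> C * (\<Prod>i\<in>I. norm (h i))"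
        by (simp add: Y_def [abs_def])
    qed
    moreover have "0 \<le> C" using K by (simp add: C_def)
    ultimately show ?case using d by blast
  qed
  then show ?thesis by (intro cube_smoothI) blast
qed

section \<open>Cube differences and Frechet derivatives\<close>

text \<open>
Induction on the number of increments: along the edge \<open>h i\<close> the mean value inequality replaces one difference by
one derivative.
\<close>

lemma Ck_derivative_bound:
  fixes D :: "nat \<Rightarrow> 'a::real_normed_vector \<Rightarrow> 'a list \<Rightarrow> 'b::real_normed_vector"
  assumes E: "subspace E" and I: "finite I" "n + card I \<le> k"
    and lin: "\<And>n x. x \<in> U \<Longrightarrow> bounded_multilinear_in E n (D n x)"
    and der: "\<And>n x e. x \<in> U \<Longrightarrow> e > 0 \<Longrightarrow> \<exists>d>0. \<forall>y\<in>U. dist y x < d \<longrightarrow>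
        (\<forall>vs\<in>lists E. length vs = n \<longrightarrow>
           norm (D n y vs - D n x vs - D (Suc n) x ((y - x) # vs))
             \<le> e * norm (y - x) * prod_list (map norm vs))"
    and U: "E \<inter> ball x0 \<delta> \<subseteq> U"
    and B: "\<And>n y vs. n \<le> k \<Longrightarrow> y \<in> E \<Longrightarrow> y \<in> ball x0 \<delta> \<Longrightarrow> vs \<in> lists E \<Longrightarrow> length vs = n \<Longrightarrow>
       norm (D n y vs) \<le> B * prod_list (map norm vs)"
    and vs: "vs \<in> lists E" "length vs = n" and yh: "y \<in> E" "h ` I \<subseteq> E"
    and ball: "\<And>S. S \<subseteq> I \<Longrightarrow> y + sum h S \<in> ball x0 \<delta>"
  shows "norm (cube_diff I (\<lambda>S. D n (y + sum h S) vs)) \<le> B * prod_list (map norm vs) * (\<Prod>i\<in>I. norm (h i))"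
  using I vs yh ball
proof (induction I arbitrary: n vs y rule: finite_induct)
  case empty
  then show ?case using B [of n y vs] empty(6) [of "{}"] by simp
next
  case (insert i I)
  define u where "u t = cube_diff I (\<lambda>S. D n (y + t *\<^sub>R h i + sum h S) vs)" for t :: real
  define u' where "u' t = cube_diff I (\<lambda>S. D (Suc n) (y + t *\<^sub>R h i + sum h S) (h i # vs))" for t :: real
  have hi: "h i \<in> E" using insert.prems by auto
  have mem: "y + t *\<^sub>R h i + sum h S \<in> E" "y + t *\<^sub>R h i + sum h S \<in> ball x0 \<delta>"
    if t: "t \<in> {0..1}" and S: "S \<subseteq> I" for t S
  proof -
    show "y + t *\<^sub>R h i + sum h S \<in> E"
      using insert.prems S by (intro subspace_add subspace_sum subspace_scale E) (auto simp: subset_eq)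
    have fS: "finite S" "i \<notin> S" using S insert.hyps finite_subset by auto
    have "(1 - t) *\<^sub>R (y + sum h S) + t *\<^sub>R (y + sum h (insert i S)) \<in> ball x0 \<delta>"
      using S t by (intro convexD [OF convex_ball] insert.prems) auto
    moreover have "(1 - t) *\<^sub>R (y + sum h S) + t *\<^sub>R (y + sum h (insert i S)) = y + t *\<^sub>R h i + sum h S"
      using fS by (simp add: algebra_simps)
    ultimately show "y + t *\<^sub>R h i + sum h S \<in> ball x0 \<delta>" by simp
  qed
  have u': "norm (u' t) \<le> B * prod_list (map norm vs) * (\<Prod>i\<in>insert i I. norm (h i))" if "t \<in> {0..1}" for t
  proof -
    have "norm (u' t) \<le> B * prod_list (map norm (h i # vs)) * (\<Prod>i\<in>I. norm (h i))"
      unfolding u'_def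
    proof (rule insert.IH)
      show "y + t *\<^sub>R h i \<in> E" using mem [OF that, of "{}"] by simp
    qed (use insert.prems insert.hyps mem [OF that] in auto)
    then show ?thesis using insert.hyps by (simp add: mult_ac)
  qed
  have deriv: "(u has_derivative (\<lambda>s. s *\<^sub>R u' t)) (at t within {0..1})" if t: "t \<in> {0..1}" for t
  proof -
    have "((\<lambda>t. D n (y + t *\<^sub>R h i + sum h S) vs) has_derivative
        (\<lambda>s. s *\<^sub>R D (Suc n) (y + t *\<^sub>R h i + sum h S) (h i # vs))) (at t within {0..1})"
      if S: "S \<subseteq> I" for S
      unfolding has_derivative_within_alt
    proof (intro conjI allI impI bounded_linear_scaleR_left)
      fix e :: real assume e: "0 < e"
      define N where "N = norm (h i) * prod_list (map norm vs)"
      have N: "0 \<le> N" unfolding N_def by (intro mult_nonneg_nonneg prod_list_nonneg) auto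
      define p where "p t = y + t *\<^sub>R h i + sum h S" for t :: real
      have pU: "p s \<in> U" if "s \<in> {0..1}" for s using mem [OF that S] U by (auto simp: p_def)
      have "0 < e / (N + 1)" using e N by (intro divide_pos_pos) auto
      then obtain d where d: "d > 0" "\<And>z ws. z \<in> U \<Longrightarrow> dist z (p t) < d \<Longrightarrow> ws\<in>lists E \<Longrightarrow> length ws = n \<Longrightarrow>
           norm (D n z ws - D n (p t) ws - D (Suc n) (p t) ((z - p t) # ws))
             \<le> (e / (N + 1)) * norm (z - p t) * prod_list (map norm ws)"
        using der [OF pU [OF t]] by metis
      show "\<exists>d>0. \<forall>s\<in>{0..1}. norm (s - t) < d \<longrightarrow>
        norm (D n (y + s *\<^sub>R h i + sum h S) vs - D n (y + t *\<^sub>R h i + sum h S) vs -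
          (s - t) *\<^sub>R D (Suc n) (y + t *\<^sub>R h i + sum h S) (h i # vs)) \<le> e * norm (s - t)"
      proof (intro exI [of _ "d / (norm (h i) + 1)"] conjI ballI impI)
        show "0 < d / (norm (h i) + 1)" using d by (intro divide_pos_pos) (auto intro: add_nonneg_pos)
        fix s assume s: "s \<in> {0..1}" "norm (s - t) < d / (norm (h i) + 1)"
        have diff: "p s - p t = (s - t) *\<^sub>R h i" by (simp add: p_def algebra_simps)
        have "dist (p s) (p t) \<le> norm (s - t) * (norm (h i) + 1)"
          unfolding dist_norm diff norm_scaleR by (simp add: algebra_simps)
        also have "\<dots> < d" using s(2) by (simp add: pos_less_divide_eq add_nonneg_pos)
        finally have near: "dist (p s) (p t) < d" .
        have "\<forall>a. \<forall>x\<in>E. D (Suc n) (p t) ((h i # vs)[0 := a *\<^sub>R x]) = a *\<^sub>R D (Suc n) (p t) ((h i # vs)[0 := x])"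
          using lin [OF pU [OF t], of "Suc n"] hi insert.prems(2,3) unfolding bounded_multilinear_in_def
          by (metis Cons_in_lists_iff length_Cons zero_less_Suc)
        then have "D (Suc n) (p t) ((s - t) *\<^sub>R h i # vs) = (s - t) *\<^sub>R D (Suc n) (p t) (h i # vs)"
          using hi by simp
        then have "norm (D n (p s) vs - D n (p t) vs - (s - t) *\<^sub>R D (Suc n) (p t) (h i # vs))
            \<le> (e / (N + 1)) * norm ((s - t) *\<^sub>R h i) * prod_list (map norm vs)"
          using d(2) [OF pU [OF s(1)] near insert.prems(2,3)] by (simp add: diff)
        also have "\<dots> = e * norm (s - t) * (N / (N + 1))" by (simp add: N_def)
        also have "\<dots> \<le> e * norm (s - t) * 1" using e N by (intro mult_left_mono) auto
        finally show "norm (D n (y + s *\<^sub>R h i + sum h S) vs - D n (y + t *\<^sub>R h i + sum h S) vs -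
          (s - t) *\<^sub>R D (Suc n) (y + t *\<^sub>R h i + sum h S) (h i # vs)) \<le> e * norm (s - t)"
          by (simp add: p_def)
      qed
    qed
    then have "(u has_derivative (\<lambda>s. cube_diff I (\<lambda>S. s *\<^sub>R D (Suc n) (y + t *\<^sub>R h i + sum h S) (h i # vs)))) (at t within {0..1})"
      unfolding u_def cube_diff_def
      by (intro has_derivative_sum has_derivative_scaleR_right) auto
    then show ?thesis unfolding u'_def cube_diff_scaleR .
  qed
  let ?B = "B * prod_list (map norm vs) * (\<Prod>i\<in>insert i I. norm (h i))"
  have "norm (u 1 - u 0) \<le> ?B * norm (1 - 0 :: real)"
  proof (rule differentiable_bound [OF _ deriv])
    show "onorm (\<lambda>s. s *\<^sub>R u' t) \<le> ?B" if "t \<in> {0..1}" for t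
    proof (rule onorm_le)
      fix s :: real
      show "norm (s *\<^sub>R u' t) \<le> ?B * norm s" using mult_left_mono [OF u' [OF that], of "\<bar>s\<bar>"] by (simp add: mult.commute)
    qed
  qed auto
  moreover have "u 1 - u 0 = cube_diff (insert i I) (\<lambda>S. D n (y + sum h S) vs)"
  proof -
    have "cube_diff I (\<lambda>S. D n (y + sum h (insert i S)) vs) = u 1"
      unfolding u_def
    proof (rule cube_diff_cong)
      fix S assume S: "S \<subseteq> I"
      have fS: "finite S" "i \<notin> S" using S insert.hyps finite_subset by auto
      then show "D n (y + sum h (insert i S)) vs = D n (y + 1 *\<^sub>R h i + sum h S) vs" by (simp add: add.assoc)
    qed
    then show ?thesis using insert.hyps by (simp add: cube_diff_insert u_def)
  qed
  ultimately show ?case by simp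
qed

lemma Ck_imp_cube_smooth:
  fixes f :: "'a::real_normed_vector \<Rightarrow> 'b::real_normed_vector"
  assumes f: "Ck_on \<infinity> E U f" and E: "subspace E" and U: "openin (top_of_set E) U"
  shows "cube_smooth E U f"
proof (rule cube_smoothI)
  fix x and k :: nat assume x: "x \<in> U"
  obtain D where D0: "\<And>x. x \<in> U \<Longrightarrow> D 0 x [] = f x"
    and lin: "\<And>n x. x \<in> U \<Longrightarrow> bounded_multilinear_in E n (D n x)"
    and cont: "\<And>n x e. x \<in> U \<Longrightarrow> e > 0 \<Longrightarrow> \<exists>d>0. \<forall>y\<in>U. dist y x < d \<longrightarrow>
        (\<forall>vs\<in>lists E. length vs = n \<longrightarrow> norm (D n y vs - D n x vs) \<le> e * prod_list (map norm vs))"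
    and der: "\<And>n x e. x \<in> U \<Longrightarrow> e > 0 \<Longrightarrow> \<exists>d>0. \<forall>y\<in>U. dist y x < d \<longrightarrow>
        (\<forall>vs\<in>lists E. length vs = n \<longrightarrow>
           norm (D n y vs - D n x vs - D (Suc n) x ((y - x) # vs))
             \<le> e * norm (y - x) * prod_list (map norm vs))"
    using f unfolding Ck_on_def
    apply (elim exE conjE)
    subgoal for D by (rule that [of D]) simp_all
    done
  obtain \<delta>0 where \<delta>0: "0 < \<delta>0" "E \<inter> ball x \<delta>0 \<subseteq> U" using openin_subspace_ball [OF U x] by blast
  have "\<exists>\<delta>>0. \<exists>B\<ge>0. \<delta> \<le> \<delta>0 \<and> (\<forall>n\<le>k. \<forall>y vs. y \<in> E \<longrightarrow> y \<in> ball x \<delta> \<longrightarrow> vs \<in> lists E \<longrightarrow> length vs = n \<longrightarrow>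
       norm (D n y vs) \<le> B * prod_list (map norm vs))" for k
  proof (induction k)
    case 0
    show ?case
    proof -
      obtain d where d: "d > 0" "\<And>y. y \<in> U \<Longrightarrow> dist y x < d \<Longrightarrow> norm (D 0 y [] - D 0 x []) \<le> 1"
        using cont [OF x zero_less_one, of 0] by auto
      have "norm (D 0 y []) \<le> norm (D 0 x []) + 1" if "y \<in> U" "dist y x < d" for y
        using d(2) [OF that] norm_triangle_sub [of "D 0 y []" "D 0 x []"] by linarith
      then show ?thesis using d(1) \<delta>0
        by (intro exI [of _ "min d \<delta>0"] exI [of _ "norm (D 0 x []) + 1"] conjI)
          (auto simp: subset_eq dist_commute)
    qed
  next
    case (Suc k)
    then obtain \<delta> B where 1: "0 < \<delta>" "0 \<le> B" "\<delta> \<le> \<delta>0"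
      "\<And>n y vs. n \<le> k \<Longrightarrow> y \<in> E \<Longrightarrow> y \<in> ball x \<delta> \<Longrightarrow> vs \<in> lists E \<Longrightarrow> length vs = n \<Longrightarrow>
       norm (D n y vs) \<le> B * prod_list (map norm vs)" by metis
    obtain d where d: "d > 0" "\<And>y vs. y \<in> U \<Longrightarrow> dist y x < d \<Longrightarrow> vs \<in> lists E \<Longrightarrow> length vs = Suc k \<Longrightarrow>
        norm (D (Suc k) y vs - D (Suc k) x vs) \<le> 1 * prod_list (map norm vs)"
      using cont [OF x zero_less_one, of "Suc k"] by metis
    obtain K where K: "\<And>vs. vs \<in> lists E \<Longrightarrow> length vs = Suc k \<Longrightarrow> norm (D (Suc k) x vs) \<le> K * prod_list (map norm vs)"
      using lin [OF x, of "Suc k"] unfolding bounded_multilinear_in_def by metis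
    define B' where "B' = max B (K + 1)"
    have "norm (D n y vs) \<le> B' * prod_list (map norm vs)"
      if "n \<le> Suc k" "y \<in> E" "y \<in> ball x (min \<delta> d)" "vs \<in> lists E" "length vs = n" for n y vs
    proof (cases "n = Suc k")
      case True
      have nn: "0 \<le> prod_list (map norm vs)" by (intro prod_list_nonneg) auto
      have "y \<in> U" "dist y x < d" using that 1 \<delta>0 by (auto simp: subset_eq dist_commute)
      then have "norm (D n y vs) \<le> (K + 1) * prod_list (map norm vs)"
        using d(2) [of y vs] K [of vs] that True norm_triangle_sub [of "D n y vs" "D n x vs"]
        by (auto simp: algebra_simps)
      also have "\<dots> \<le> B' * prod_list (map norm vs)" by (intro mult_right_mono nn) (auto simp: B'_def)
      finally show ?thesis .
    next
      case False
      have nn: "0 \<le> prod_list (map norm vs)" by (intro prod_list_nonneg) auto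
      have "norm (D n y vs) \<le> B * prod_list (map norm vs)" using False that by (intro 1(4)) auto
      also have "\<dots> \<le> B' * prod_list (map norm vs)" by (intro mult_right_mono nn) (auto simp: B'_def)
      finally show ?thesis .
    qed
    moreover have "0 \<le> B'" using 1 by (auto simp: B'_def)
    moreover have "0 < min \<delta> d" "min \<delta> d \<le> \<delta>0" using 1 d by auto
    ultimately show ?case by meson
  qed
  then obtain \<delta> B where 1: "0 < \<delta>" "0 \<le> B" "\<delta> \<le> \<delta>0"
      "\<And>n y vs. n \<le> k \<Longrightarrow> y \<in> E \<Longrightarrow> y \<in> ball x \<delta> \<Longrightarrow> vs \<in> lists E \<Longrightarrow> length vs = n \<Longrightarrow>
       norm (D n y vs) \<le> B * prod_list (map norm vs)" by metis
  have sub: "E \<inter> ball x \<delta> \<subseteq> U" using \<delta>0 subset_ball [OF 1(3), of x] by blast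
  have "cube_bounded E f x k \<delta> B"
    unfolding cube_bounded_def
  proof (intro allI impI)
    fix I :: "nat set" and h y
    assume A: "finite I" "card I \<le> k" "y \<in> E" "h ` I \<subseteq> E" "\<forall>S\<subseteq>I. y + sum h S \<in> ball x \<delta>"
    have "norm (cube_diff I (\<lambda>S. D 0 (y + sum h S) [])) \<le> B * prod_list (map norm ([] :: 'a list)) * (\<Prod>i\<in>I. norm (h i))"
    proof (rule Ck_derivative_bound [where D = D and n = 0 and k = k and U = U and ?x0.0 = x and \<delta> = \<delta>, OF E A(1)])
      show "norm (D n y vs) \<le> B * prod_list (map norm vs)"
        if "n \<le> k" "y \<in> E" "y \<in> ball x \<delta>" "vs \<in> lists E" "length vs = n" for n y vs
        using that by (rule 1(4))
    qed (use A lin der sub in \<open>simp_all\<close>)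
    moreover have "cube_diff I (\<lambda>S. D 0 (y + sum h S) []) = cube_diff I (\<lambda>S. f (y + sum h S))"
      using A sub subspace_base_sum [OF E A(3,4)] by (intro cube_diff_cong D0) blast
    ultimately show "norm (cube_diff I (\<lambda>S. f (y + sum h S))) \<le> B * (\<Prod>i\<in>I. norm (h i))" by simp
  qed
  then show "\<exists>\<delta>>0. \<exists>C\<ge>0. cube_bounded E f x k \<delta> C" using 1 by blast
qed

text \<open>
The derivative of \<open>f\<close> at \<open>x\<close> in direction \<open>h\<close>. Halving the step changes the quotient by a second difference of
\<open>f\<close>, so that bounds on second differences make the dyadic quotients a Cauchy sequence.
\<close>

definition dir_deriv :: "('a::real_normed_vector \<Rightarrow> 'b::real_normed_vector) \<Rightarrow> 'a \<Rightarrow> 'a \<Rightarrow> 'b" where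
  "dir_deriv f x h = lim (\<lambda>j. 2 ^ j *\<^sub>R (f (x + (1 / 2 ^ j) *\<^sub>R h) - f x))"

lemma dyadic_step: "(\<lambda>j. (1 / 2 ^ j) *\<^sub>R (h :: 'a::real_normed_vector)) \<longlonglongrightarrow> 0"
proof -
  have "(\<lambda>j. (1 / 2) ^ j *\<^sub>R h) \<longlonglongrightarrow> 0 *\<^sub>R h"
    by (intro tendsto_scaleR LIMSEQ_power_zero tendsto_const) auto
  then show ?thesis by (simp add: power_divide)
qed

lemma eventually_dyadic_step:
  fixes h :: "'a::real_normed_vector"
  assumes "x \<in> ball x0 \<delta>"
  shows "\<forall>\<^sub>F j in sequentially. x + (1 / 2 ^ j) *\<^sub>R h \<in> ball x0 \<delta>"
proof -
  have "(\<lambda>j. x + (1 / 2 ^ j) *\<^sub>R h) \<longlonglongrightarrow> x + 0" by (intro tendsto_add tendsto_const dyadic_step)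
  then show ?thesis using assms by (intro topological_tendstoD) auto
qed

text \<open>
Subtracting the linear map with the same value at \<open>1\<close> leaves an additive function that vanishes on the integers. It
is bounded, since it is bounded on the unit interval, and a bounded additive function is \<open>0\<close>.
\<close>

lemma additive_bounded_scaleR:
  fixes A :: "real \<Rightarrow> 'b::real_normed_vector"
  assumes add: "\<And>s t. A (s + t) = A s + A t" and bd: "\<And>t. norm (A t) \<le> K * \<bar>t\<bar>"
  shows "A t = t *\<^sub>R A 1"
proof -
  define g where "g s = A s - s *\<^sub>R A 1" for s
  have g_add: "g (s + t) = g s + g t" for s t by (simp add: g_def add algebra_simps)
  have g1: "g 1 = 0" by (simp add: g_def)
  have g0: "g 0 = 0" using g_add [of 0 0] by simp
  have gneg: "g (- s) = - g s" for s using g_add [of s "- s"] g0 by (simp add: add_eq_0_iff)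
  have gnat: "g (real n * s) = real n *\<^sub>R g s" for n s
    by (induction n) (simp_all add: g0 g_add algebra_simps)
  have gint: "g (of_int z) = 0" for z
    using gnat [of "nat z" 1] gnat [of "nat (- z)" 1] gneg [of "of_int z"] g1 by (cases "z \<ge> 0") auto
  have bound: "norm (g s) \<le> K + norm (A 1)" if "0 \<le> s" "s \<le> 1" for s
  proof -
    have "0 \<le> K" using order_trans [OF norm_ge_zero bd [of 1]] by simp
    have "norm (g s) \<le> norm (A s) + norm (s *\<^sub>R A 1)" unfolding g_def by (rule norm_triangle_ineq4)
    also have "norm (A s) \<le> K * 1" using bd [of s] that \<open>0 \<le> K\<close> mult_left_mono [of s 1 K] by simp
    also have "norm (s *\<^sub>R A 1) \<le> 1 * norm (A 1)" using that by (simp add: mult_left_le_one_le)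
    finally show ?thesis by simp
  qed
  have le: "real n * norm (g t) \<le> K + norm (A 1)" for n
  proof -
    have "g (real n * t) = g (frac (real n * t)) + g (of_int \<lfloor>real n * t\<rfloor>)"
      using g_add [of "frac (real n * t)" "of_int \<lfloor>real n * t\<rfloor>"] by (simp add: frac_def)
    then have "norm (real n *\<^sub>R g t) = norm (g (frac (real n * t)))" using gint gnat by simp
    also have "\<dots> \<le> K + norm (A 1)" using frac_lt_1 [of "real n * t"] by (intro bound) auto
    finally show ?thesis by simp
  qed
  have "norm (g t) = 0"
  proof (rule ccontr)
    assume "norm (g t) \<noteq> 0"
    then have pos: "0 < norm (g t)" by simp
    obtain n where "(K + norm (A 1)) / norm (g t) < real n" using reals_Archimedean2 by blast
    then show False using le [of n] pos by (simp add: pos_divide_less_eq)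
  qed
  then show ?thesis by (simp add: g_def)
qed

context
  fixes E :: "'a::real_normed_vector set" and f :: "'a \<Rightarrow> 'b::banach" and x0 x :: 'a and \<delta> C :: real
  assumes f: "cube_bounded E f x0 2 \<delta> C" and C: "0 \<le> C" and E: "subspace E" and x: "x \<in> E" "x \<in> ball x0 \<delta>"
begin

lemma dyadic_quotient_step:
  assumes h: "h \<in> E" and b: "x + (1 / 2 ^ j) *\<^sub>R h \<in> ball x0 \<delta>"
  shows "norm (2 ^ Suc j *\<^sub>R (f (x + (1 / 2 ^ Suc j) *\<^sub>R h) - f x) - 2 ^ j *\<^sub>R (f (x + (1 / 2 ^ j) *\<^sub>R h) - f x))
    \<le> C * norm h ^ 2 / 4 * (1 / 2) ^ j"
proof -
  let ?u = "(1 / 2 ^ Suc j) *\<^sub>R h"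
  have uu: "x + ?u + ?u = x + (1 / 2 ^ j) *\<^sub>R h"
    by (simp add: add.assoc flip: scaleR_left_distrib)
  have mid: "x + ?u \<in> ball x0 \<delta>"
  proof -
    have "(1/2) *\<^sub>R x + (1/2) *\<^sub>R (x + (1 / 2 ^ j) *\<^sub>R h) \<in> ball x0 \<delta>"
      using x b by (intro convexD [OF convex_ball]) auto
    moreover have "(1/2) *\<^sub>R x + (1/2) *\<^sub>R (x + (1 / 2 ^ j) *\<^sub>R h) = x + ?u"
      by (simp add: scaleR_add_right flip: scaleR_left_distrib add.assoc)
    ultimately show ?thesis by simp
  qed
  have "norm (f (x + ?u + ?u) - f (x + ?u) - f (x + ?u) + f x) \<le> C * norm ?u * norm ?u"
  proof (rule cube_bounded_second [OF f])
    show "x + ?u + ?u \<in> ball x0 \<delta>" unfolding uu by (rule b)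
  qed (use x mid h in \<open>auto intro: subspace_scale [OF E]\<close>)
  then have "2 ^ j * norm (f (x + (1 / 2 ^ j) *\<^sub>R h) - f (x + ?u) - f (x + ?u) + f x) \<le> 2 ^ j * (C * norm ?u * norm ?u)"
    unfolding uu by (intro mult_left_mono) auto
  moreover have "2 ^ j * (C * norm ?u * norm ?u) = C * norm h ^ 2 / 4 * (1 / 2) ^ j"
    by (simp add: power2_eq_square field_simps)
  moreover have "norm (2 ^ Suc j *\<^sub>R (f (x + ?u) - f x) - 2 ^ j *\<^sub>R (f (x + (1 / 2 ^ j) *\<^sub>R h) - f x))
     = norm (2 ^ j *\<^sub>R (f (x + (1 / 2 ^ j) *\<^sub>R h) - f (x + ?u) - f (x + ?u) + f x))"
    by (subst norm_minus_commute) (simp add: algebra_simps scaleR_2 flip: scaleR_scaleR)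
  ultimately show ?thesis by simp
qed

lemma dir_deriv_LIMSEQ:
  assumes h: "h \<in> E"
  shows "(\<lambda>j. 2 ^ j *\<^sub>R (f (x + (1 / 2 ^ j) *\<^sub>R h) - f x)) \<longlonglongrightarrow> dir_deriv f x h"
    and "x + h \<in> ball x0 \<delta> \<Longrightarrow> norm (f (x + h) - f x - dir_deriv f x h) \<le> C * norm h ^ 2"
proof -
  define a where "a j = 2 ^ j *\<^sub>R (f (x + (1 / 2 ^ j) *\<^sub>R h) - f x)" for j
  have geo: "(\<lambda>j. C * norm h ^ 2 / 4 * (1 / 2) ^ j) sums (C * norm h ^ 2 / 4 * 2)"
    using sums_mult [OF geometric_sums [of "1/2 :: real"], of "C * norm h ^ 2 / 4"] by simp
  have "\<forall>\<^sub>F j in sequentially. norm (norm (a (Suc j) - a j)) \<le> C * norm h ^ 2 / 4 * (1 / 2) ^ j"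
    using eventually_dyadic_step [OF x(2), of h]
  proof (rule eventually_mono)
    fix j assume "x + (1 / 2 ^ j) *\<^sub>R h \<in> ball x0 \<delta>"
    then show "norm (norm (a (Suc j) - a j)) \<le> C * norm h ^ 2 / 4 * (1 / 2) ^ j"
      using dyadic_quotient_step [OF h] unfolding a_def by (simp only: real_norm_def abs_norm_cancel)
  qed
  then have sn: "summable (\<lambda>j. norm (a (Suc j) - a j))"
    using sums_summable [OF geo] by (rule summable_comparison_test_ev)
  then have s: "summable (\<lambda>j. a (Suc j) - a j)" by (rule summable_norm_cancel)
  have "(\<lambda>n. \<Sum>j<n. a (Suc j) - a j) \<longlonglongrightarrow> (\<Sum>j. a (Suc j) - a j)" using s by (rule summable_LIMSEQ)
  then have "(\<lambda>n. a n - a 0) \<longlonglongrightarrow> (\<Sum>j. a (Suc j) - a j)" by (simp add: sum_lessThan_telescope)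
  then have lim: "a \<longlonglongrightarrow> (\<Sum>j. a (Suc j) - a j) + a 0" 
    using tendsto_add [OF _ tendsto_const [of "a 0"]] by fastforce
  then have eq: "dir_deriv f x h = (\<Sum>j. a (Suc j) - a j) + a 0"
    unfolding dir_deriv_def a_def [symmetric] by (rule limI)
  show "(\<lambda>j. 2 ^ j *\<^sub>R (f (x + (1 / 2 ^ j) *\<^sub>R h) - f x)) \<longlonglongrightarrow> dir_deriv f x h"
    using lim eq by (simp only: a_def [symmetric])
  assume b: "x + h \<in> ball x0 \<delta>"
  have bj: "x + (1 / 2 ^ j) *\<^sub>R h \<in> ball x0 \<delta>" for j
  proof -
    have "(1 - 1 / 2 ^ j) *\<^sub>R x + (1 / 2 ^ j) *\<^sub>R (x + h) \<in> ball x0 \<delta>"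
      using x b by (intro convexD [OF convex_ball]) auto
    then show ?thesis by (simp add: algebra_simps)
  qed
  have "norm (f (x + h) - f x - dir_deriv f x h) = norm (\<Sum>j. a (Suc j) - a j)"
    unfolding eq by (simp add: a_def)
  also have "\<dots> \<le> (\<Sum>j. norm (a (Suc j) - a j))" using sn by (rule summable_norm)
  also have "\<dots> \<le> (\<Sum>j. C * norm h ^ 2 / 4 * (1 / 2) ^ j)"
    using dyadic_quotient_step [OF h bj] by (intro suminf_le sn sums_summable [OF geo]) (simp add: a_def)
  also have "\<dots> = C * norm h ^ 2 / 2" using sums_unique [OF geo] by simp
  also have "\<dots> \<le> C * norm h ^ 2" using C by (simp add: mult_nonneg_nonneg)
  finally show "norm (f (x + h) - f x - dir_deriv f x h) \<le> C * norm h ^ 2" .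
qed

lemma norm_dir_deriv_le: assumes h: "h \<in> E" shows "norm (dir_deriv f x h) \<le> C * norm h"
proof (rule tendsto_upperbound [OF tendsto_norm [OF dir_deriv_LIMSEQ(1) [OF h]]])
  show "\<forall>\<^sub>F j in sequentially. norm (2 ^ j *\<^sub>R (f (x + (1 / 2 ^ j) *\<^sub>R h) - f x)) \<le> C * norm h"
    using eventually_dyadic_step [OF x(2), of h]
  proof eventually_elim
    case (elim j)
    have "norm (f (x + (1 / 2 ^ j) *\<^sub>R h) - f x) \<le> C * norm ((x + (1 / 2 ^ j) *\<^sub>R h) - x)"
      using x h elim by (intro cube_bounded_Lipschitz [OF f _ E]) (auto intro: subspace_add subspace_scale E)
    then have "2 ^ j * norm (f (x + (1 / 2 ^ j) *\<^sub>R h) - f x) \<le> 2 ^ j * (C * norm ((1 / 2 ^ j) *\<^sub>R h))"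
      by (intro mult_left_mono) auto
    then show ?case by simp
  qed
qed simp

lemma dir_deriv_add: assumes "u \<in> E" "v \<in> E" shows "dir_deriv f x (u + v) = dir_deriv f x u + dir_deriv f x v"
proof -
  let ?s = "\<lambda>j h. (1 / 2 ^ j) *\<^sub>R (h :: 'a)"
  let ?q = "\<lambda>h j. 2 ^ j *\<^sub>R (f (x + ?s j h) - f x)"
  have "(\<lambda>j. ?q (u + v) j - ?q u j - ?q v j) \<longlonglongrightarrow> dir_deriv f x (u + v) - dir_deriv f x u - dir_deriv f x v"
    using assms by (intro tendsto_diff dir_deriv_LIMSEQ(1) subspace_add E)
  moreover have "(\<lambda>j. ?q (u + v) j - ?q u j - ?q v j) \<longlonglongrightarrow> 0"
  proof (rule Lim_null_comparison)
    show "\<forall>\<^sub>F j in sequentially. norm (?q (u + v) j - ?q u j - ?q v j) \<le> C * norm u * norm v * (1 / 2) ^ j"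
      using eventually_dyadic_step [OF x(2), of u] eventually_dyadic_step [OF x(2), of v]
        eventually_dyadic_step [OF x(2), of "u + v"]
    proof eventually_elim
      case (elim j)
      have eq: "x + ?s j u + ?s j v = x + ?s j (u + v)" by (simp add: scaleR_add_right)
      have "norm (f (x + ?s j u + ?s j v) - f (x + ?s j u) - f (x + ?s j v) + f x) \<le> C * norm (?s j u) * norm (?s j v)"
        using x assms elim by (intro cube_bounded_second [OF f]) (auto intro: subspace_scale E simp del: mem_ball simp: eq)
      then have "2 ^ j * norm (f (x + ?s j (u + v)) - f (x + ?s j u) - f (x + ?s j v) + f x) \<le> 2 ^ j * (C * norm (?s j u) * norm (?s j v))"
        unfolding eq by (intro mult_left_mono) auto
      moreover have "?q (u + v) j - ?q u j - ?q v j = 2 ^ j *\<^sub>R (f (x + ?s j (u + v)) - f (x + ?s j u) - f (x + ?s j v) + f x)"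
        by (simp add: scaleR_diff_right scaleR_add_right)
      moreover have "2 ^ j * (C * norm (?s j u) * norm (?s j v)) = C * norm u * norm v * (1 / 2) ^ j"
        by (simp add: field_simps)
      ultimately show ?case by simp
    qed
    have "(\<lambda>j. C * norm u * norm v * (1 / 2) ^ j) \<longlonglongrightarrow> C * norm u * norm v * 0"
      by (intro tendsto_mult LIMSEQ_power_zero tendsto_const) auto
    then show "(\<lambda>j. C * norm u * norm v * (1 / 2) ^ j) \<longlonglongrightarrow> 0" by simp
  qed
  ultimately have "dir_deriv f x (u + v) - dir_deriv f x u - dir_deriv f x v = 0" by (rule LIMSEQ_unique)
  then show ?thesis by (simp add: algebra_simps)
qed

lemma dir_deriv_scaleR: assumes v: "v \<in> E" shows "dir_deriv f x (a *\<^sub>R v) = a *\<^sub>R dir_deriv f x v"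
proof -
  have "dir_deriv f x (a *\<^sub>R v) = a *\<^sub>R dir_deriv f x (1 *\<^sub>R v)"
  proof (rule additive_bounded_scaleR)
    show "dir_deriv f x ((s + t) *\<^sub>R v) = dir_deriv f x (s *\<^sub>R v) + dir_deriv f x (t *\<^sub>R v)" for s t
      using v by (simp add: scaleR_left_distrib dir_deriv_add subspace_scale E)
    show "norm (dir_deriv f x (t *\<^sub>R v)) \<le> C * norm v * \<bar>t\<bar>" for t
      using norm_dir_deriv_le [of "t *\<^sub>R v"] v by (simp add: subspace_scale E mult_ac)
  qed
  then show ?thesis by simp
qed

end

text \<open>
A difference of the derivative in direction \<open>v\<close> is a limit of differences with one more increment, a small
multiple of \<open>v\<close>.
\<close>

lemma cube_bounded_dir_deriv:
  fixes T :: "'a::real_normed_vector \<Rightarrow> 'b::banach"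
  assumes T: "cube_bounded E T x (k + 2) \<delta> C" and C: "0 \<le> C" and E: "subspace E" and v: "v \<in> E"
  shows "cube_bounded E (\<lambda>y. dir_deriv T y v) x k \<delta> (C * norm v)"
  unfolding cube_bounded_def
proof (intro allI impI)
  fix I :: "nat set" and h y
  assume A: "finite I" "card I \<le> k" "y \<in> E" "h ` I \<subseteq> E" "\<forall>S\<subseteq>I. y + sum h S \<in> ball x \<delta>"
  have T2: "cube_bounded E T x 2 \<delta> C" by (rule cube_bounded_mono [OF T]) auto
  let ?q = "\<lambda>j p. 2 ^ j *\<^sub>R (T (p + (1 / 2 ^ j) *\<^sub>R v) - T p)"
  have lim: "(\<lambda>j. cube_diff I (\<lambda>S. ?q j (y + sum h S))) \<longlonglongrightarrow> cube_diff I (\<lambda>S. dir_deriv T (y + sum h S) v)"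
    using A v by (intro tendsto_cube_diff dir_deriv_LIMSEQ(1) [OF T2 C E]) (auto intro: subspace_base_sum [OF E])
  obtain i where i: "i \<notin> I" using A(1) ex_new_if_finite by blast
  have "\<forall>\<^sub>F j in sequentially. \<forall>S\<in>Pow I. (y + sum h S) + (1 / 2 ^ j) *\<^sub>R v \<in> ball x \<delta>"
    using A by (intro eventually_ball_finite ballI eventually_dyadic_step) auto
  then have "\<forall>\<^sub>F j in sequentially. norm (cube_diff I (\<lambda>S. ?q j (y + sum h S))) \<le> C * norm v * (\<Prod>i\<in>I. norm (h i))"
  proof eventually_elim
    case (elim j)
    define h' where "h' = h(i := (1 / 2 ^ j) *\<^sub>R v)"
    have h'I: "sum h' S = sum h S" if "S \<subseteq> I" for S
      using that i by (intro sum.cong) (auto simp: h'_def)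
    have h'i: "y + sum h' (insert i S) = y + sum h S + (1 / 2 ^ j) *\<^sub>R v" if "S \<subseteq> I" for S
    proof -
      have "finite S" "i \<notin> S" using that i A(1) finite_subset by auto
      then show ?thesis using h'I [OF that] by (simp add: h'_def algebra_simps)
    qed
    have "norm (cube_diff (insert i I) (\<lambda>S. T (y + sum h' S))) \<le> C * (\<Prod>i\<in>insert i I. norm (h' i))"
    proof (rule cube_boundedD [OF T])
      show "y + sum h' S \<in> ball x \<delta>" if "S \<subseteq> insert i I" for S
      proof (cases "i \<in> S")
        case True
        have S: "S - {i} \<subseteq> I" using that by auto
        show ?thesis using h'i [OF S, unfolded insert_Diff [OF True]] elim S by (metis PowI)
      next
        case False
        then have "S \<subseteq> I" using that by auto
        then show ?thesis using h'I A(5) by simp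
      qed
      show "h' ` insert i I \<subseteq> E" using A(4) v by (auto simp: h'_def intro: subspace_scale [OF E])
    qed (use A i in auto)
    also have "cube_diff (insert i I) (\<lambda>S. T (y + sum h' S)) = cube_diff I (\<lambda>S. T (y + sum h S + (1 / 2 ^ j) *\<^sub>R v) - T (y + sum h S))"
      unfolding cube_diff_insert [OF A(1) i] cube_diff_diff
      by (intro arg_cong2 [where f = minus] cube_diff_cong) (simp_all only: h'i h'I)
    also have "(\<Prod>i\<in>insert i I. norm (h' i)) = norm v / 2 ^ j * (\<Prod>i\<in>I. norm (h i))"
    proof -
      have "(\<Prod>i\<in>I. norm (h' i)) = (\<Prod>i\<in>I. norm (h i))"
        using i by (intro prod.cong) (auto simp: h'_def)
      then show ?thesis using A(1) i by (simp add: h'_def)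
    qed
    finally have "2 ^ j * norm (cube_diff I (\<lambda>S. T (y + sum h S + (1 / 2 ^ j) *\<^sub>R v) - T (y + sum h S)))
       \<le> 2 ^ j * (C * (norm v / 2 ^ j * (\<Prod>i\<in>I. norm (h i))))"
      by (intro mult_left_mono) auto
    then show ?case by (simp add: cube_diff_scaleR mult.assoc)
  qed
  then show "norm (cube_diff I (\<lambda>S. dir_deriv T (y + sum h S) v)) \<le> C * norm v * (\<Prod>i\<in>I. norm (h i))"
    by (intro tendsto_upperbound [OF tendsto_norm [OF lim]]) auto
qed

text \<open>
The iterated derivative, with the direction of the last differentiation at the head of the list, as in the
definition of \<^const>\<open>Ck_on\<close>.
\<close>

fun iter_dir_deriv :: "('a::real_normed_vector \<Rightarrow> 'b::real_normed_vector) \<Rightarrow> nat \<Rightarrow> 'a \<Rightarrow> 'a list \<Rightarrow> 'b" where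
  "iter_dir_deriv f 0 x vs = f x"
| "iter_dir_deriv f (Suc n) x vs = dir_deriv (\<lambda>y. iter_dir_deriv f n y (tl vs)) x (hd vs)"

text \<open>
The bounds on the differences of \<open>y \<mapsto> iter_dir_deriv f n y vs\<close> are proportional to the product of the norms of \<open>vs\<close>,
on a ball that does not depend on \<open>vs\<close>. Order one gives continuity and order two gives differentiability with
respect to the operator norm.
\<close>

lemma cube_smooth_imp_Ck:
  fixes f :: "'a::real_normed_vector \<Rightarrow> 'b::banach"
  assumes f: "cube_smooth E U f" and E: "subspace E" and U: "openin (top_of_set E) U"
  shows "Ck_on k E U f"
proof -
  let ?D = "iter_dir_deriv f"
  have UE: "U \<subseteq> E" using U openin_imp_subset by auto
  have P: "\<exists>\<delta>>0. \<exists>C\<ge>0. \<forall>vs\<in>lists E. length vs = n \<longrightarrow>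
      cube_bounded E (\<lambda>y. ?D n y vs) x k \<delta> (C * prod_list (map norm vs))" if "x \<in> U" for n x k
    using that
  proof (induction n arbitrary: k)
    case 0
    then obtain \<delta> C where "\<delta> > 0" "0 \<le> C" "cube_bounded E f x k \<delta> C" using f unfolding cube_smooth_def by blast
    then show ?case by auto
  next
    case (Suc n)
    obtain \<delta> C where IH: "\<delta> > 0" "0 \<le> C" "\<And>vs. vs \<in> lists E \<Longrightarrow> length vs = n \<Longrightarrow>
      cube_bounded E (\<lambda>y. ?D n y vs) x (k + 2) \<delta> (C * prod_list (map norm vs))"
      using Suc.IH [OF Suc.prems, of "k + 2"] by blast
    have "cube_bounded E (\<lambda>y. ?D (Suc n) y vs) x k \<delta> (C * prod_list (map norm vs))"
      if vs: "vs \<in> lists E" "length vs = Suc n" for vs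
    proof -
      obtain w ws where w: "vs = w # ws" "w \<in> E" "ws \<in> lists E" "length ws = n"
        using vs by (cases vs) auto
      have "0 \<le> C * prod_list (map norm ws)" using IH(2) by (intro mult_nonneg_nonneg prod_list_nonneg) auto
      from cube_bounded_dir_deriv [OF IH(3) [OF w(3,4)] this E w(2)] show ?thesis
        by (simp add: w(1) mult_ac)
    qed
    then show ?case using IH by blast
  qed
  define N where "N vs = prod_list (map norm vs)" for vs :: "'a list"
  have N: "0 \<le> N vs" for vs unfolding N_def by (intro prod_list_nonneg) auto
  have P': "\<exists>\<delta>>0. \<exists>C\<ge>0. \<forall>vs\<in>lists E. length vs = n \<longrightarrow> cube_bounded E (\<lambda>y. ?D n y vs) x k \<delta> (C * N vs)"
    if "x \<in> U" for n x k
    using P [OF that] unfolding N_def .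
  have lin: "(\<forall>a\<in>E. \<forall>b\<in>E. ?D n x (vs[i := a + b]) = ?D n x (vs[i := a]) + ?D n x (vs[i := b])) \<and>
      (\<forall>c. \<forall>a\<in>E. ?D n x (vs[i := c *\<^sub>R a]) = c *\<^sub>R ?D n x (vs[i := a]))"
    if "x \<in> U" "vs \<in> lists E" "length vs = n" "i < n" for n x vs i
    using that
  proof (induction n arbitrary: x vs i)
    case (Suc n)
    obtain w ws where w: "vs = w # ws" "w \<in> E" "ws \<in> lists E" "length ws = n"
      using Suc.prems by (cases vs) auto
    obtain \<delta> C where d: "\<delta> > 0" "0 \<le> C" "\<And>vs. vs \<in> lists E \<Longrightarrow> length vs = n \<Longrightarrow>
      cube_bounded E (\<lambda>y. ?D n y vs) x 2 \<delta> (C * N vs)"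
      using P' [OF Suc.prems(1), where n = n and k = 2] by blast
    have x: "x \<in> E" "x \<in> ball x \<delta>" using UE Suc.prems d by auto
    note fd = d(3) mult_nonneg_nonneg [OF d(2) N] E x
    show ?case
    proof (cases i)
      case 0
      then show ?thesis
        using dir_deriv_add [OF fd, OF w(3,4)] dir_deriv_scaleR [OF fd, OF w(3,4)] by (simp add: w(1))
    next
      case (Suc m)
      then have m: "m < n" using Suc.prems by simp
      obtain \<epsilon> where e: "0 < \<epsilon>" "E \<inter> ball x \<epsilon> \<subseteq> U" using openin_subspace_ball [OF U Suc.prems(1)] by blast
      have ev: "\<forall>\<^sub>F j in sequentially. x + (1 / 2 ^ j) *\<^sub>R w \<in> U"
      proof (rule eventually_mono)
        show "\<forall>\<^sub>F j in sequentially. x + (1 / 2 ^ j) *\<^sub>R w \<in> ball x \<epsilon>"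
          using e by (intro eventually_dyadic_step) simp
        show "x + (1 / 2 ^ j) *\<^sub>R w \<in> U" if "x + (1 / 2 ^ j) *\<^sub>R w \<in> ball x \<epsilon>" for j
          using that e(2) subspace_add [OF E x(1) subspace_scale [OF E w(2)]] by blast
      qed
      have mem: "ws[m := a] \<in> lists E" "length (ws[m := a]) = n" if "a \<in> E" for a
        using w that set_update_subset_insert [of ws m a] by (auto simp: in_lists_conv_set)
      let ?q = "\<lambda>j us. 2 ^ j *\<^sub>R (?D n (x + (1 / 2 ^ j) *\<^sub>R w) us - ?D n x us)"
      have L: "(\<lambda>j. ?q j (ws[m := a])) \<longlonglongrightarrow> ?D (Suc n) x (vs[i := a])" if "a \<in> E" for a
        using dir_deriv_LIMSEQ(1) [OF fd, OF mem [OF that] w(2)] by (simp add: w(1) Suc)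
      note IH = Suc.IH [OF _ w(3,4) m]
      show ?thesis
      proof (intro conjI ballI allI)
        fix a b assume ab: "a \<in> E" "b \<in> E"
        have "(\<lambda>j. ?q j (ws[m := a]) + ?q j (ws[m := b])) \<longlonglongrightarrow> ?D (Suc n) x (vs[i := a]) + ?D (Suc n) x (vs[i := b])"
          by (intro tendsto_add L ab)
        moreover have "\<forall>\<^sub>F j in sequentially. ?q j (ws[m := a]) + ?q j (ws[m := b]) = ?q j (ws[m := a + b])"
          using ev
        proof eventually_elim
          case (elim j)
          have "?D n (x + (1 / 2 ^ j) *\<^sub>R w) (ws[m := a + b]) = ?D n (x + (1 / 2 ^ j) *\<^sub>R w) (ws[m := a]) + ?D n (x + (1 / 2 ^ j) *\<^sub>R w) (ws[m := b])"
            "?D n x (ws[m := a + b]) = ?D n x (ws[m := a]) + ?D n x (ws[m := b])"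
            using IH [OF elim] IH [OF Suc.prems(1)] ab by blast+
          then show ?case by (simp only: scaleR_diff_right scaleR_add_right) (simp add: algebra_simps)
        qed
        ultimately have "(\<lambda>j. ?q j (ws[m := a + b])) \<longlonglongrightarrow> ?D (Suc n) x (vs[i := a]) + ?D (Suc n) x (vs[i := b])"
          by (rule Lim_transform_eventually)
        with L [OF subspace_add [OF E ab]]
        show "?D (Suc n) x (vs[i := a + b]) = ?D (Suc n) x (vs[i := a]) + ?D (Suc n) x (vs[i := b])"
          by (rule LIMSEQ_unique)
      next
        fix c a assume a: "a \<in> E"
        have "(\<lambda>j. c *\<^sub>R ?q j (ws[m := a])) \<longlonglongrightarrow> c *\<^sub>R ?D (Suc n) x (vs[i := a])"
          by (intro tendsto_scaleR tendsto_const L a)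
        moreover have "\<forall>\<^sub>F j in sequentially. c *\<^sub>R ?q j (ws[m := a]) = ?q j (ws[m := c *\<^sub>R a])"
          using ev
        proof eventually_elim
          case (elim j)
          have "?D n (x + (1 / 2 ^ j) *\<^sub>R w) (ws[m := c *\<^sub>R a]) = c *\<^sub>R ?D n (x + (1 / 2 ^ j) *\<^sub>R w) (ws[m := a])"
            "?D n x (ws[m := c *\<^sub>R a]) = c *\<^sub>R ?D n x (ws[m := a])"
            using IH [OF elim] IH [OF Suc.prems(1)] a by blast+
          then show ?case by (simp only: scaleR_diff_right scaleR_scaleR mult.commute)
        qed
        ultimately have "(\<lambda>j. ?q j (ws[m := c *\<^sub>R a])) \<longlonglongrightarrow> c *\<^sub>R ?D (Suc n) x (vs[i := a])"
          by (rule Lim_transform_eventually)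
        with L [OF subspace_scale [OF E a]]
        show "?D (Suc n) x (vs[i := c *\<^sub>R a]) = c *\<^sub>R ?D (Suc n) x (vs[i := a])"
          by (rule LIMSEQ_unique)
      qed
    qed
  qed simp
  have near: "\<exists>d>0. \<forall>y\<in>U. dist y x < d \<longrightarrow> (\<forall>vs\<in>lists E. length vs = n \<longrightarrow>
      norm (?D n y vs - ?D n x vs) \<le> e * N vs \<and>
      norm (?D n y vs - ?D n x vs - ?D (Suc n) x ((y - x) # vs)) \<le> e * norm (y - x) * N vs)"
    if x: "x \<in> U" and e: "0 < e" for x n e
  proof -
    obtain \<delta> C where d: "\<delta> > 0" "0 \<le> C" "\<And>vs. vs \<in> lists E \<Longrightarrow> length vs = n \<Longrightarrow>
      cube_bounded E (\<lambda>y. ?D n y vs) x 2 \<delta> (C * N vs)"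
      using P' [OF x, where n = n and k = 2] by blast
    have xE: "x \<in> E" "x \<in> ball x \<delta>" using UE x d by auto
    note fd = d(3) mult_nonneg_nonneg [OF d(2) N] E xE
    show ?thesis
    proof (intro exI [of _ "min \<delta> (e / (C + 1))"] conjI ballI impI)
      show "0 < min \<delta> (e / (C + 1))" using d e by auto
      fix y vs assume y: "y \<in> U" "dist y x < min \<delta> (e / (C + 1))" and vs: "vs \<in> lists E" "length vs = n"
      have yE: "y \<in> E" "y \<in> ball x \<delta>" "y - x \<in> E" using UE y xE by (auto simp: dist_commute subspace_diff E)
      have "norm (y - x) * (C + 1) \<le> e"
        using y d(2) by (simp add: dist_norm pos_less_divide_eq)
      moreover have "C * norm (y - x) \<le> norm (y - x) * (C + 1)" by (simp add: algebra_simps)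
      ultimately have Cy: "C * norm (y - x) \<le> e" by linarith
      have "norm (?D n y vs - ?D n x vs) \<le> C * N vs * norm (y - x)"
        by (rule cube_bounded_Lipschitz [OF d(3) [OF vs] _ E xE(1) yE(1) xE(2) yE(2)]) simp
      also have "\<dots> \<le> e * N vs" using mult_right_mono [OF Cy N [of vs]] by (simp add: mult_ac)
      finally show "norm (?D n y vs - ?D n x vs) \<le> e * N vs" .
      have "norm (?D n y vs - ?D n x vs - ?D (Suc n) x ((y - x) # vs)) \<le> C * N vs * norm (y - x) ^ 2"
        using dir_deriv_LIMSEQ(2) [OF fd, OF vs yE(3)] yE(2) by simp
      also have "\<dots> \<le> e * norm (y - x) * N vs"
        using mult_right_mono [OF Cy mult_nonneg_nonneg [OF norm_ge_zero N [of vs]], of "y - x"]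
        by (simp add: mult_ac power2_eq_square)
      finally show "norm (?D n y vs - ?D n x vs - ?D (Suc n) x ((y - x) # vs)) \<le> e * norm (y - x) * N vs" .
    qed
  qed
  show ?thesis
    unfolding Ck_on_def N_def [symmetric]
  proof (intro exI [of _ ?D] conjI ballI allI impI)
    fix n x assume x: "x \<in> U"
    have "\<exists>K. \<forall>vs\<in>lists E. length vs = n \<longrightarrow> norm (?D n x vs) \<le> K * N vs"
    proof -
      obtain \<delta> C where d: "\<delta> > 0" "0 \<le> C" "\<And>vs. vs \<in> lists E \<Longrightarrow> length vs = n \<Longrightarrow>
        cube_bounded E (\<lambda>y. ?D n y vs) x 0 \<delta> (C * N vs)"
        using P' [OF x, where n = n and k = 0] by blast
      have "x \<in> E" "x \<in> ball x \<delta>" using UE x d by auto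
      then show ?thesis using cube_bounded_bound [OF d(3)] by blast
    qed
    then show "bounded_multilinear_in E n (?D n x)"
      unfolding bounded_multilinear_in_def N_def using lin [OF x] by blast
  next
    fix n x and e :: real assume "x \<in> U" "0 < e"
    then show "\<exists>d>0. \<forall>y\<in>U. dist y x < d \<longrightarrow> (\<forall>vs\<in>lists E. length vs = n \<longrightarrow>
      norm (?D n y vs - ?D n x vs) \<le> e * N vs)"
      using near [of x e n] by blast
  next
    fix n x and e :: real assume "x \<in> U" "0 < e"
    then show "\<exists>d>0. \<forall>y\<in>U. dist y x < d \<longrightarrow> (\<forall>vs\<in>lists E. length vs = n \<longrightarrow>
      norm (?D n y vs - ?D n x vs - ?D (Suc n) x ((y - x) # vs)) \<le> e * norm (y - x) * N vs)"
      using near [of x e n] by blast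
  qed simp_all
qed

lemma cube_smooth_has_deriv_in:
  fixes f :: "'a::real_normed_vector \<Rightarrow> 'b::banach"
  assumes f: "cube_smooth E U f" and E: "subspace E" and U: "openin (top_of_set E) U" and x: "x \<in> U"
  shows "has_deriv_in E U f (dir_deriv f x) x"
proof -
  have UE: "U \<subseteq> E" using U openin_imp_subset by auto
  obtain \<delta> C where d: "0 < \<delta>" "0 \<le> C" "cube_bounded E f x 2 \<delta> C" using f x unfolding cube_smooth_def by blast
  have xE: "x \<in> E" "x \<in> ball x \<delta>" using x d UE by auto
  note fd = d(3,2) E xE
  show ?thesis
    unfolding has_deriv_in_def bounded_linear_in_def
  proof (intro conjI ballI allI dir_deriv_add [OF fd] dir_deriv_scaleR [OF fd])
    show "\<exists>K. \<forall>v\<in>E. norm (dir_deriv f x v) \<le> norm v * K"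
      using norm_dir_deriv_le [OF fd] by (metis mult.commute)
    show "((\<lambda>y. (f y - f x - dir_deriv f x (y - x)) /\<^sub>R norm (y - x)) \<longlongrightarrow> 0) (at x within U)"
    proof (rule Lim_null_comparison)
      show "\<forall>\<^sub>F y in at x within U.
          norm ((f y - f x - dir_deriv f x (y - x)) /\<^sub>R norm (y - x)) \<le> C * norm (y - x)"
        using eventually_at_ball [OF d(1), of x U]
      proof eventually_elim
        case (elim y)
        have "norm (f (x + (y - x)) - f x - dir_deriv f x (y - x)) \<le> C * norm (y - x) ^ 2"
          using elim UE xE by (intro dir_deriv_LIMSEQ(2) [OF fd]) (auto intro: subspace_diff [OF E])
        then show ?case 
          by (cases "y = x") (simp_all add: divide_simps power2_eq_square mult_ac)
      qed
      have "((\<lambda>y. C * norm (y - x)) \<longlongrightarrow> C * norm (x - x)) (at x within U)"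
        by (intro tendsto_intros)
      then show "((\<lambda>y. C * norm (y - x)) \<longlongrightarrow> 0) (at x within U)" by simp
    qed
  qed
qed

section \<open>The invariant mean on a compact group\<close>

text \<open>
The complement is the projection of a closed set along a compact factor.
\<close>

lemma tube_openin:
  assumes "compact_space X" "openin (prod_topology X Y) W"
  shows "openin Y {y \<in> topspace Y. \<forall>x\<in>topspace X. (x, y) \<in> W}"
proof -
  have "closedin (prod_topology X Y) (topspace X \<times> topspace Y - W)"
    using assms(2) by (metis closedin_def double_diff openin_subset order_refl Diff_subset topspace_prod_topology openin_closedin_eq)
  then have "closedin Y (snd ` (topspace X \<times> topspace Y - W))"
    using closed_map_snd [OF assms(1), of Y] unfolding closed_map_def by blast
  moreover have "topspace Y - snd ` (topspace X \<times> topspace Y - W) = {y \<in> topspace Y. \<forall>x\<in>topspace X. (x, y) \<in> W}"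
    by force
  ultimately show ?thesis by (metis openin_diff openin_topspace)
qed

lemma continuous_map_scaleR_left:
  fixes u :: "'a \<Rightarrow> 'b::real_normed_vector"
  assumes "continuous_map X euclidean u" shows "continuous_map X euclidean (\<lambda>x. a *\<^sub>R u x)"
  using assms by (simp add: continuous_map_atin tendsto_scaleR)

lemma sum_list_scaleR:
  "(\<Sum>x\<leftarrow>xs. a *\<^sub>R (f x :: 'b::real_vector)) = a *\<^sub>R (\<Sum>x\<leftarrow>xs. f x)"
  by (induction xs) (simp_all add: scaleR_add_right)

lemma sum_list_swap:
  "(\<Sum>x\<leftarrow>xs. \<Sum>y\<leftarrow>ys. f x y) = (\<Sum>y\<leftarrow>ys. \<Sum>x\<leftarrow>xs. (f x y :: 'b::comm_monoid_add))"
  by (induction xs) (simp_all add: sum_list_addf)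

locale compact_group = group G for G :: "('g, 'm) monoid_scheme" (structure) +
  fixes X :: "'g topology"
  assumes topspace_eq: "topspace X = carrier G"
    and compact: "compact_space X"
    and Hausdorff: "Hausdorff_space X"
    and cont_mult: "continuous_map (prod_topology X X) X (\<lambda>(g, h). g \<otimes> h)"
    and cont_inv: "continuous_map X X (\<lambda>g. inv g)"
begin

lemma continuous_map_mult:
  assumes "continuous_map Y X f" "continuous_map Y X g"
  shows "continuous_map Y X (\<lambda>y. f y \<otimes> g y)"
proof -
  have "continuous_map Y (prod_topology X X) (\<lambda>y. (f y, g y))"
    using assms by (simp add: continuous_map_paired)
  from continuous_map_compose [OF this cont_mult] show ?thesis by (simp add: o_def)
qed

lemma continuous_map_inverse:
  assumes "continuous_map Y X f" shows "continuous_map Y X (\<lambda>y. inv (f y))"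
  using continuous_map_compose [OF assms cont_inv] by (simp add: o_def)

lemma continuous_map_translations:
  assumes "g \<in> carrier G"
  shows "continuous_map X X (\<lambda>h. h \<otimes> g)" "continuous_map X X (\<lambda>h. g \<otimes> h)"
  using assms continuous_map_mult [of X "\<lambda>h. h" "\<lambda>h. g"] continuous_map_mult [of X "\<lambda>h. g" "\<lambda>h. h"]
  by (simp_all add: topspace_eq)

definition right_avg :: "'g list \<Rightarrow> ('g \<Rightarrow> 'b::real_normed_vector) \<Rightarrow> 'g \<Rightarrow> 'b" where
  "right_avg gs u x = (1 / length gs) *\<^sub>R (\<Sum>g\<leftarrow>gs. u (x \<otimes> g))"

definition left_avg :: "'g list \<Rightarrow> ('g \<Rightarrow> 'b::real_normed_vector) \<Rightarrow> 'g \<Rightarrow> 'b" where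
  "left_avg gs u x = (1 / length gs) *\<^sub>R (\<Sum>g\<leftarrow>gs. u (g \<otimes> x))"

definition right_approx :: "('g \<Rightarrow> 'b::real_normed_vector) \<Rightarrow> 'b \<Rightarrow> real \<Rightarrow> 'g list \<Rightarrow> bool" where
  "right_approx u c \<epsilon> gs \<longleftrightarrow> gs \<noteq> [] \<and> set gs \<subseteq> carrier G \<and> (\<forall>x\<in>carrier G. norm (right_avg gs u x - c) \<le> \<epsilon>)"

definition left_approx :: "('g \<Rightarrow> 'b::real_normed_vector) \<Rightarrow> 'b \<Rightarrow> real \<Rightarrow> 'g list \<Rightarrow> bool" where
  "left_approx u c \<epsilon> gs \<longleftrightarrow> gs \<noteq> [] \<and> set gs \<subseteq> carrier G \<and> (\<forall>x\<in>carrier G. norm (left_avg gs u x - c) \<le> \<epsilon>)"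

lemma norm_average_diff_le:
  fixes v :: "'c \<Rightarrow> 'b::real_normed_vector"
  assumes "gs \<noteq> []" "\<And>g. g \<in> set gs \<Longrightarrow> norm (v g - c) \<le> \<epsilon>"
  shows "norm ((1 / length gs) *\<^sub>R (\<Sum>g\<leftarrow>gs. v g) - c) \<le> \<epsilon>"
proof -
  have "(\<Sum>g\<leftarrow>gs. v g - c) = (\<Sum>g\<leftarrow>gs. v g) - real (length gs) *\<^sub>R c"
    by (induction gs) (simp_all add: algebra_simps)
  then have "(1 / length gs) *\<^sub>R (\<Sum>g\<leftarrow>gs. v g) - c = (1 / length gs) *\<^sub>R (\<Sum>g\<leftarrow>gs. v g - c)"
    using assms(1) by (simp add: scaleR_diff_right)
  also have "norm \<dots> = (1 / length gs) * norm (\<Sum>g\<leftarrow>gs. v g - c)" by simp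
  also have "\<dots> \<le> (1 / length gs) * (length gs * \<epsilon>)"
  proof (intro mult_left_mono)
    show "norm (\<Sum>g\<leftarrow>gs. v g - c) \<le> length gs * \<epsilon>"
      using assms(2)
    proof (induction gs)
      case (Cons a gs)
      then show ?case using norm_triangle_ineq [of "v a - c" "\<Sum>g\<leftarrow>gs. v g - c"] by (auto simp: algebra_simps) (smt (verit))
    qed simp
  qed simp
  finally show ?thesis using assms(1) by simp
qed

text \<open>
Left and right translations commute.
\<close>

lemma avg_swap:
  assumes "set gs \<subseteq> carrier G" "set hs \<subseteq> carrier G" "x \<in> carrier G"
  shows "left_avg hs (right_avg gs u) x = right_avg gs (left_avg hs u) x"
proof -
  have "(\<Sum>h\<leftarrow>hs. \<Sum>g\<leftarrow>gs. u ((h \<otimes> x) \<otimes> g)) = (\<Sum>h\<leftarrow>hs. \<Sum>g\<leftarrow>gs. u (h \<otimes> (x \<otimes> g)))"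
    using assms by (intro arg_cong [where f = sum_list] map_cong refl) (auto simp: m_assoc subset_eq)
  then show ?thesis
    unfolding left_avg_def right_avg_def sum_list_scaleR by (subst sum_list_swap) (simp add: mult.commute)
qed

text \<open>
Both constants are close to the average of \<open>u\<close> over all products \<open>h \<otimes> g\<close>.
\<close>

lemma approx_close:
  assumes "right_approx u c \<epsilon> gs" "left_approx u d \<delta> hs"
  shows "norm (c - d) \<le> \<epsilon> + \<delta>"
proof -
  have gs: "gs \<noteq> []" "set gs \<subseteq> carrier G" and hs: "hs \<noteq> []" "set hs \<subseteq> carrier G"
    using assms by (auto simp: right_approx_def left_approx_def)
  have "norm (left_avg hs (right_avg gs u) \<one> - c) \<le> \<epsilon>"
    unfolding left_avg_def using assms(1) hs by (intro norm_average_diff_le) (auto simp: right_approx_def subset_eq)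
  moreover have "norm (right_avg gs (left_avg hs u) \<one> - d) \<le> \<delta>"
    unfolding right_avg_def using assms(2) gs by (intro norm_average_diff_le) (auto simp: left_approx_def subset_eq)
  ultimately show ?thesis
    using avg_swap [OF gs(2) hs(2) one_closed, of u]
      norm_triangle_ineq4 [of "right_avg gs (left_avg hs u) \<one> - d" "right_avg gs (left_avg hs u) \<one> - c"] by simp
qed

lemma right_avg_product:
  assumes "set fs \<subseteq> carrier G" "set gs \<subseteq> carrier G" "x \<in> carrier G" 
  shows "right_avg (map (\<lambda>(f, g). f \<otimes> g) (List.product fs gs)) u x = right_avg fs (right_avg gs u) x"
proof -
  have "(\<Sum>g\<leftarrow>map (\<lambda>(f, g). f \<otimes> g) (List.product fs gs). u (x \<otimes> g)) = (\<Sum>f\<leftarrow>fs. \<Sum>g\<leftarrow>gs. u ((x \<otimes> f) \<otimes> g))"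
    using assms(1)
  proof (induction fs)
    case (Cons f fs)
    have "(\<Sum>g\<leftarrow>gs. u (x \<otimes> (f \<otimes> g))) = (\<Sum>g\<leftarrow>gs. u ((x \<otimes> f) \<otimes> g))"
      using assms Cons.prems by (intro arg_cong [where f = sum_list] map_cong refl) (auto simp: m_assoc subset_eq)
    then show ?case using Cons by (simp add: comp_def)
  qed simp
  then show ?thesis
    unfolding right_avg_def sum_list_scaleR by (simp add: mult.commute)
qed

text \<open>
Averaging over a fine finite net contracts the diameter of the range of a function by a fixed factor, up to a
small error; iterating this yields averages that are nearly constant.
\<close>

lemma exists_right_approx:
  fixes u :: "'g \<Rightarrow> 'b::real_normed_vector"
  assumes u: "continuous_map X euclidean u" and \<epsilon>: "0 < \<epsilon>"
  shows "\<exists>c gs. right_approx u c \<epsilon> gs"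
proof -
  define e where "e = \<epsilon> / 2"
  have e: "0 < e" using \<epsilon> by (simp add: e_def)
  (* Left translations by elements of V change u by at most e. Averages of right translates of u inherit
     this property, so that one net fs serves in all steps of the iteration. *)
  define V where "V = {v \<in> carrier G. \<forall>z\<in>carrier G. norm (u (v \<otimes> z) - u z) < e}"
  have V: "openin X V"
  proof -
    have "continuous_map (prod_topology X X) euclidean (\<lambda>p. norm (u (snd p \<otimes> fst p) - u (fst p)))"
      by (intro continuous_intros continuous_map_compose [OF _ u, unfolded o_def] continuous_map_mult
          continuous_map_fst continuous_map_snd)
    from openin_continuous_map_preimage [OF this, of "{..<e}"]
    have "openin (prod_topology X X) {p \<in> carrier G \<times> carrier G. norm (u (snd p \<otimes> fst p) - u (fst p)) < e}"
      by (simp add: topspace_eq)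
    from tube_openin [OF compact this]
    have "openin X {v \<in> carrier G. \<forall>z\<in>carrier G. (z, v) \<in> {p \<in> carrier G \<times> carrier G. norm (u (snd p \<otimes> fst p) - u (fst p)) < e}}"
      by (simp only: topspace_eq)
    also have "{v \<in> carrier G. \<forall>z\<in>carrier G. (z, v) \<in> {p \<in> carrier G \<times> carrier G. norm (u (snd p \<otimes> fst p) - u (fst p)) < e}} = V"
      by (auto simp: V_def)
    finally show ?thesis .
  qed
  have "\<one> \<in> V" using e by (simp add: V_def)
  have "\<exists>F. finite F \<and> F \<subseteq> carrier G \<and> (\<forall>y\<in>carrier G. \<forall>z\<in>carrier G. \<exists>g\<in>F. y \<otimes> g \<otimes> inv z \<in> V)"
  proof -
    define W where "W g = {p \<in> carrier G \<times> carrier G. fst p \<otimes> g \<otimes> inv (snd p) \<in> V}" for g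
    have "openin (prod_topology X X) (W g)" if "g \<in> carrier G" for g
    proof -
      have "continuous_map (prod_topology X X) X (\<lambda>p. fst p \<otimes> g \<otimes> inv (snd p))"
        using that by (intro continuous_map_mult continuous_map_inverse continuous_map_fst continuous_map_snd) (simp add: topspace_eq)
      from openin_continuous_map_preimage [OF this V] show ?thesis by (simp add: W_def topspace_eq)
    qed
    then have W_open: "openin (prod_topology X X) U" if "U \<in> W ` carrier G" for U using that by blast
    have W_cover: "carrier G \<times> carrier G \<subseteq> \<Union>(W ` carrier G)"
    proof
      fix p assume p: "p \<in> carrier G \<times> carrier G"
      then have "p \<in> W (inv (fst p) \<otimes> snd p)" using \<open>\<one> \<in> V\<close> by (auto simp: W_def m_assoc [symmetric])
      moreover have "inv (fst p) \<otimes> snd p \<in> carrier G" using p by auto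
      ultimately show "p \<in> \<Union>(W ` carrier G)" by blast
    qed
    have "compactin (prod_topology X X) (carrier G \<times> carrier G)"
      using compact by (metis compact_space_def compact_space_prod_topology topspace_eq topspace_prod_topology)
    then obtain \<F> where \<F>: "finite \<F>" "\<F> \<subseteq> W ` carrier G" "carrier G \<times> carrier G \<subseteq> \<Union>\<F>"
      using compactinD [OF _ W_open W_cover] by blast
    then obtain F where F: "F \<subseteq> carrier G" "finite F" "\<F> = W ` F"
      by (meson finite_subset_image)
    then show ?thesis using \<F>(3) by (intro exI [of _ F]) (fastforce simp: W_def subset_eq)
  qed
  then obtain fs where fs: "set fs \<subseteq> carrier G"
    "\<And>y z. y \<in> carrier G \<Longrightarrow> z \<in> carrier G \<Longrightarrow> \<exists>g\<in>set fs. y \<otimes> g \<otimes> inv z \<in> V" by (metis finite_list)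
  have fs_ne: "fs \<noteq> []" using fs(2) [OF one_closed one_closed] by auto
  define n where "n = length fs"
  have n: "0 < n" using fs_ne by (simp add: n_def)
  (* The first summand at x is matched with a summand at y from which it differs by at most e; the other
     n - 1 summands are matched in any way and differ by at most d. *)
  have step: "norm (right_avg fs w x - right_avg fs w y) \<le> (1 - 1 / n) * d + e / n"
    if w: "\<And>v z. v \<in> V \<Longrightarrow> z \<in> carrier G \<Longrightarrow> norm (w (v \<otimes> z) - w z) \<le> e"
      and d: "\<And>x y. x \<in> carrier G \<Longrightarrow> y \<in> carrier G \<Longrightarrow> norm (w x - w y) \<le> d"
      and xy: "x \<in> carrier G" "y \<in> carrier G" for w :: "'g \<Rightarrow> 'b" and d x y
  proof -
    obtain f fs1 where f: "fs = f # fs1" using fs_ne by (cases fs) auto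
    have fc: "f \<in> carrier G" using f fs by auto
    obtain g where g: "g \<in> set fs" "y \<otimes> g \<otimes> inv (x \<otimes> f) \<in> V" using fs(2) [of y "x \<otimes> f"] xy fc by auto
    have gc: "g \<in> carrier G" using g fs by auto
    define gs where "gs = remove1 g fs"
    have len: "length gs = length fs1" using length_remove1 [of g fs] g(1) f unfolding gs_def by simp
    have sub: "set gs \<subseteq> carrier G" "set fs1 \<subseteq> carrier G" using fs f set_remove1_subset [of g fs] by (auto simp: gs_def)
    have sum_y: "(\<Sum>g\<leftarrow>fs. w (y \<otimes> g)) = w (y \<otimes> g) + (\<Sum>g\<leftarrow>gs. w (y \<otimes> g))"
      unfolding gs_def using g(1) by (rule sum_list_map_remove1)
    have "norm (w (y \<otimes> g) - w (x \<otimes> f)) \<le> e"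
      using w [OF g(2), of "x \<otimes> f"] xy fc gc by (simp add: m_assoc)
    then have 1: "norm (w (x \<otimes> f) - w (y \<otimes> g)) \<le> e" by (simp add: norm_minus_commute)
    have 2: "norm ((\<Sum>g\<leftarrow>fs1. w (x \<otimes> g)) - (\<Sum>g\<leftarrow>gs. w (y \<otimes> g))) \<le> length fs1 * d"
      using len sub
    proof (induction gs fs1 rule: list_induct2)
      case (Cons a as b bs)
      have "norm (w (x \<otimes> b) - w (y \<otimes> a)) \<le> d" using Cons.prems xy by (intro d) auto
      moreover have "norm ((\<Sum>g\<leftarrow>bs. w (x \<otimes> g)) - (\<Sum>g\<leftarrow>as. w (y \<otimes> g))) \<le> length bs * d"
        using Cons by auto
      ultimately show ?case
        using norm_triangle_ineq [of "w (x \<otimes> b) - w (y \<otimes> a)" "(\<Sum>g\<leftarrow>bs. w (x \<otimes> g)) - (\<Sum>g\<leftarrow>as. w (y \<otimes> g))"]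
        by (simp add: algebra_simps)
    qed simp
    have "right_avg fs w x - right_avg fs w y = (1 / n) *\<^sub>R ((w (x \<otimes> f) - w (y \<otimes> g)) + ((\<Sum>g\<leftarrow>fs1. w (x \<otimes> g)) - (\<Sum>g\<leftarrow>gs. w (y \<otimes> g))))"
      unfolding right_avg_def sum_y n_def by (simp add: f algebra_simps)
    also have "norm \<dots> \<le> (1 / n) * (e + length fs1 * d)"
      unfolding norm_scaleR using norm_triangle_mono [OF 1 2] n by (simp add: divide_right_mono)
    also have "\<dots> = (1 - 1 / n) * d + e / n"
    proof -
      have l: "real (length fs1) = real n - 1" by (simp add: n_def f)
      show ?thesis unfolding l using n by (simp add: field_simps)
    qed
    finally show ?thesis .
  qed
  have "compactin euclidean (u ` topspace X)"
    using compact u unfolding compact_space_def by (rule image_compactin)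
  then have "bounded (u ` carrier G)" by (simp add: topspace_eq compact_imp_bounded)
  then obtain B where B: "\<And>x. x \<in> carrier G \<Longrightarrow> norm (u x) \<le> B" unfolding bounded_iff by auto
  have iter: "\<exists>gs. gs \<noteq> [] \<and> set gs \<subseteq> carrier G \<and>
      (\<forall>v\<in>V. \<forall>z\<in>carrier G. norm (right_avg gs u (v \<otimes> z) - right_avg gs u z) \<le> e) \<and>
      (\<forall>x\<in>carrier G. \<forall>y\<in>carrier G. norm (right_avg gs u x - right_avg gs u y) \<le> (1 - 1 / n) ^ m * (2 * B) + e)" for m
  proof (induction m)
    case 0
    have "norm (u x - u y) \<le> 2 * B + e" if "x \<in> carrier G" "y \<in> carrier G" for x y
      using norm_triangle_ineq4 [of "u x" "u y"] B [OF that(1)] B [OF that(2)] e by linarith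
    moreover have "norm (u (v \<otimes> z) - u z) \<le> e" if "v \<in> V" "z \<in> carrier G" for v z
      using that by (auto simp: V_def)
    moreover have "right_avg [\<one>] u x = u x" if "x \<in> carrier G" for x using that by (simp add: right_avg_def)
    ultimately show ?case by (intro exI [of _ "[\<one>]"]) (auto simp: V_def)
  next
    case (Suc m)
    then obtain gs where gs: "gs \<noteq> []" "set gs \<subseteq> carrier G"
      "\<And>v z. v \<in> V \<Longrightarrow> z \<in> carrier G \<Longrightarrow> norm (right_avg gs u (v \<otimes> z) - right_avg gs u z) \<le> e"
      "\<And>x y. x \<in> carrier G \<Longrightarrow> y \<in> carrier G \<Longrightarrow> norm (right_avg gs u x - right_avg gs u y) \<le> (1 - 1 / n) ^ m * (2 * B) + e"
      by blast
    let ?hs = "map (\<lambda>(f, g). f \<otimes> g) (List.product fs gs)"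
    have VG: "v \<in> carrier G" if "v \<in> V" for v using that by (simp add: V_def)
    have eq: "right_avg ?hs u x = right_avg fs (right_avg gs u) x" if "x \<in> carrier G" for x
      using that by (intro right_avg_product fs gs)
    have "?hs \<noteq> []" using gs(1) fs_ne by (metis length_0_conv length_map length_product mult_is_0)
    moreover have "set ?hs \<subseteq> carrier G" using fs gs by auto
    moreover have "norm (right_avg ?hs u (v \<otimes> z) - right_avg ?hs u z) \<le> e" if "v \<in> V" "z \<in> carrier G" for v z
    proof -
      have "right_avg fs (right_avg gs u) (v \<otimes> z) - right_avg fs (right_avg gs u) z
          = (1 / length fs) *\<^sub>R (\<Sum>f\<leftarrow>fs. right_avg gs u (v \<otimes> z \<otimes> f) - right_avg gs u (z \<otimes> f)) - 0"
        unfolding right_avg_def [of fs] by (simp add: sum_list_subtractf scaleR_diff_right)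
      also have "norm \<dots> \<le> e"
        using that VG fs(1) gs(3) by (intro norm_average_diff_le fs_ne) (auto simp: m_assoc subset_eq)
      finally show ?thesis using that VG by (simp add: eq)
    qed
    moreover have "norm (right_avg ?hs u x - right_avg ?hs u y) \<le> (1 - 1 / n) ^ Suc m * (2 * B) + e"
      if "x \<in> carrier G" "y \<in> carrier G" for x y
    proof -
      have "norm (right_avg fs (right_avg gs u) x - right_avg fs (right_avg gs u) y)
          \<le> (1 - 1 / n) * ((1 - 1 / n) ^ m * (2 * B) + e) + e / n"
        using gs(3,4) that by (intro step) auto
      also have "\<dots> = (1 - 1 / n) ^ Suc m * (2 * B) + e" by (simp add: algebra_simps)
      finally show ?thesis using that by (simp add: eq)
    qed
    ultimately show ?case by blast
  qed
  have "(\<lambda>m. (1 - 1 / n) ^ m * (2 * B)) \<longlonglongrightarrow> 0 * (2 * B)"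
    using n by (intro tendsto_mult LIMSEQ_power_zero tendsto_const) auto
  then have "\<forall>\<^sub>F m in sequentially. (1 - 1 / n) ^ m * (2 * B) < e" using e by (intro order_tendstoD) auto
  then obtain m where m: "(1 - 1 / n) ^ m * (2 * B) < e" by (auto simp: eventually_sequentially)
  obtain gs where gs: "gs \<noteq> []" "set gs \<subseteq> carrier G"
      "\<And>x y. x \<in> carrier G \<Longrightarrow> y \<in> carrier G \<Longrightarrow> norm (right_avg gs u x - right_avg gs u y) \<le> (1 - 1 / n) ^ m * (2 * B) + e"
    using iter [of m] by blast
  have "right_approx u (right_avg gs u \<one>) \<epsilon> gs"
    unfolding right_approx_def
  proof (intro conjI ballI gs(1,2))
    show "norm (right_avg gs u x - right_avg gs u \<one>) \<le> \<epsilon>" if "x \<in> carrier G" for x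
      using gs(3) [OF that one_closed] m unfolding e_def by linarith
  qed
  then show ?thesis by blast
qed

lemma exists_left_approx:
  fixes u :: "'g \<Rightarrow> 'b::real_normed_vector"
  assumes u: "continuous_map X euclidean u" and \<epsilon>: "0 < \<epsilon>"
  shows "\<exists>c gs. left_approx u c \<epsilon> gs"
proof -
  have "continuous_map X euclidean (\<lambda>g. u (inv g))"
    using continuous_map_compose [OF cont_inv u] by (simp add: o_def)
  then obtain c gs where gs: "right_approx (\<lambda>g. u (inv g)) c \<epsilon> gs" using exists_right_approx \<epsilon> by blast
  have "left_avg (map (\<lambda>g. inv g) gs) u x = right_avg gs (\<lambda>g. u (inv g)) (inv x)" if "x \<in> carrier G" for x
  proof -
    have "(\<Sum>g\<leftarrow>gs. u (inv g \<otimes> x)) = (\<Sum>g\<leftarrow>gs. u (inv (inv x \<otimes> g)))"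
      using gs that by (intro arg_cong [where f = sum_list] map_cong refl) (auto simp: right_approx_def subset_eq inv_mult_group)
    then show ?thesis by (simp add: left_avg_def right_avg_def comp_def)
  qed
  then have "left_approx u c \<epsilon> (map (\<lambda>g. inv g) gs)"
    using gs by (auto simp: left_approx_def right_approx_def)
  then show ?thesis by blast
qed

text \<open>
The integral with respect to the normalised Haar measure: the constant to which averages of right translates of
\<open>u\<close> come uniformly close.
\<close>

definition mean :: "('g \<Rightarrow> 'b::real_normed_vector) \<Rightarrow> 'b" where
  "mean u = (THE c. \<forall>\<epsilon>>0. \<exists>gs. right_approx u c \<epsilon> gs)"

text \<open>
Any two constants that are approximated by right averages are close to one and the same left average. This
gives uniqueness, and also that the approximate constants form a Cauchy sequence.
\<close>

lemma mean_approx_unique: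
  fixes u :: "'g \<Rightarrow> 'b::banach"
  assumes u: "continuous_map X euclidean u"
  shows "\<exists>!c. \<forall>\<epsilon>>0. \<exists>gs. right_approx u c \<epsilon> gs"
proof -
  have close: "norm (c - c') \<le> \<epsilon> + \<epsilon>'" if "right_approx u c \<epsilon> gs" "right_approx u c' \<epsilon>' gs'" for c c' \<epsilon> \<epsilon>' gs gs'
  proof (rule field_le_epsilon)
    fix e :: real assume "0 < e"
    then obtain d hs where "left_approx u d (e / 2) hs" using exists_left_approx [OF u, of "e / 2"] by auto
    from approx_close [OF that(1) this] approx_close [OF that(2) this]
    show "norm (c - c') \<le> \<epsilon> + \<epsilon>' + e" using norm_triangle_ineq4 [of "c - d" "c' - d"] by simp
  qed
  have "\<forall>j. \<exists>c gs. right_approx u c (inverse (real (Suc j))) gs"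
    using exists_right_approx [OF u] by simp
  then obtain c gs where cg: "\<And>j. right_approx u (c j) (inverse (real (Suc j))) (gs j)" by metis
  have lim0: "(\<lambda>j. inverse (real (Suc j))) \<longlonglongrightarrow> 0" by (rule LIMSEQ_inverse_real_of_nat)
  have "Cauchy c"
  proof (rule CauchyI)
    fix e :: real assume "0 < e"
    then obtain N where N: "inverse (real (Suc N)) < e / 2" using reals_Archimedean [of "e / 2"] by auto
    have "norm (c i - c j) < e" if "N \<le> i" "N \<le> j" for i j
    proof -
      have "inverse (real (Suc i)) \<le> inverse (real (Suc N))" "inverse (real (Suc j)) \<le> inverse (real (Suc N))"
        using that by (auto intro!: le_imp_inverse_le)
      then show ?thesis using close [OF cg [of i] cg [of j]] N by linarith
    qed
    then show "\<exists>M. \<forall>m\<ge>M. \<forall>n\<ge>M. norm (c m - c n) < e" by blast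
  qed
  then obtain c0 where c0: "c \<longlonglongrightarrow> c0" using Cauchy_convergent convergent_def by blast
  show ?thesis
  proof (rule ex1I [of _ c0])
    show "\<forall>\<epsilon>>0. \<exists>gs. right_approx u c0 \<epsilon> gs"
    proof (intro allI impI)
      fix \<epsilon> :: real assume \<epsilon>: "0 < \<epsilon>"
      have "\<forall>\<^sub>F j in sequentially. norm (c j - c0) < \<epsilon> / 2"
        using c0 half_gt_zero [OF \<epsilon>] unfolding tendsto_iff dist_norm by blast
      moreover have "\<forall>\<^sub>F j in sequentially. inverse (real (Suc j)) < \<epsilon> / 2"
        using lim0 \<epsilon> by (intro order_tendstoD) auto
      ultimately obtain j where j: "norm (c j - c0) < \<epsilon> / 2" "inverse (real (Suc j)) < \<epsilon> / 2"
        using eventually_conj eventually_happens trivial_limit_sequentially by blast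
      have "norm (right_avg (gs j) u x - c0) \<le> \<epsilon>" if "x \<in> carrier G" for x
      proof -
        have "norm (right_avg (gs j) u x - c j) \<le> inverse (real (Suc j))" using cg [of j] that by (simp add: right_approx_def)
        then show ?thesis using j norm_triangle_ineq [of "right_avg (gs j) u x - c j" "c j - c0"] by simp
      qed
      then show "\<exists>gs. right_approx u c0 \<epsilon> gs" using cg [of j] by (auto simp: right_approx_def)
    qed
    fix d assume d: "\<forall>\<epsilon>>0. \<exists>gs. right_approx u d \<epsilon> gs"
    have "norm (d - c j) \<le> 2 * inverse (real (Suc j))" for j
      using d close [OF _ cg [of j], of d "inverse (real (Suc j))"] by fastforce
    moreover have "(\<lambda>j. norm (d - c j)) \<longlonglongrightarrow> norm (d - c0)" by (intro tendsto_norm tendsto_diff tendsto_const c0)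
    moreover have "(\<lambda>j. 2 * inverse (real (Suc j))) \<longlonglongrightarrow> 2 * 0" by (intro tendsto_mult tendsto_const lim0)
    ultimately have "norm (d - c0) \<le> 2 * 0" using LIMSEQ_le by blast
    then show "d = c0" by simp
  qed
qed

lemma mean_approx:
  fixes u :: "'g \<Rightarrow> 'b::banach"
  assumes "continuous_map X euclidean u" "0 < \<epsilon>"
  shows "\<exists>gs. right_approx u (mean u) \<epsilon> gs"
  using theI' [OF mean_approx_unique [OF assms(1)]] assms(2) unfolding mean_def by blast

lemma mean_eqI:
  fixes u :: "'g \<Rightarrow> 'b::banach"
  assumes "continuous_map X euclidean u" "\<And>\<epsilon>. 0 < \<epsilon> \<Longrightarrow> \<exists>gs. right_approx u c \<epsilon> gs"
  shows "mean u = c"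
  unfolding mean_def using mean_approx_unique [OF assms(1)] assms(2) by (intro the1_equality) auto

lemma mean_cong:
  "(\<And>g. g \<in> carrier G \<Longrightarrow> u g = v g) \<Longrightarrow> mean u = mean v"
proof -
  assume uv: "\<And>g. g \<in> carrier G \<Longrightarrow> u g = v g"
  have "right_avg gs u x = right_avg gs v x" if "set gs \<subseteq> carrier G" "x \<in> carrier G" for gs x
    unfolding right_avg_def using uv that
    by (intro arg_cong [where f = "scaleR _"] arg_cong [where f = sum_list] map_cong refl) (auto simp: subset_eq)
  then have "right_approx u c \<epsilon> gs \<longleftrightarrow> right_approx v c \<epsilon> gs" for c \<epsilon> gs
    unfolding right_approx_def by auto
  then show ?thesis by (simp add: mean_def)
qed

lemma mean_const [simp]: "mean (\<lambda>g. c :: 'b::banach) = c"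
proof (rule mean_eqI)
  show "\<exists>gs. right_approx (\<lambda>g. c) c \<epsilon> gs" if "0 < \<epsilon>" for \<epsilon>
    using that by (intro exI [of _ "[\<one>]"]) (simp add: right_approx_def right_avg_def)
qed simp

lemma mean_left_invariant:
  fixes u :: "'g \<Rightarrow> 'b::banach"
  assumes u: "continuous_map X euclidean u" and g: "g \<in> carrier G"
  shows "mean (\<lambda>h. u (g \<otimes> h)) = mean u"
proof (rule mean_eqI)
  show "continuous_map X euclidean (\<lambda>h. u (g \<otimes> h))"
    using continuous_map_compose [OF continuous_map_translations(2) [OF g] u] by (simp add: o_def)
  fix \<epsilon> :: real assume "0 < \<epsilon>"
  then obtain gs where gs: "right_approx u (mean u) \<epsilon> gs" using mean_approx [OF u] by blast
  have "right_avg gs (\<lambda>h. u (g \<otimes> h)) x = right_avg gs u (g \<otimes> x)" if "x \<in> carrier G" for x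
    unfolding right_avg_def using gs g that
    by (intro arg_cong [where f = "scaleR _"] arg_cong [where f = sum_list] map_cong refl)
      (auto simp: right_approx_def subset_eq m_assoc)
  then show "\<exists>gs. right_approx (\<lambda>h. u (g \<otimes> h)) (mean u) \<epsilon> gs"
    using gs g by (intro exI [of _ gs]) (auto simp: right_approx_def)
qed

lemma mean_right_invariant:
  fixes u :: "'g \<Rightarrow> 'b::banach"
  assumes u: "continuous_map X euclidean u" and g: "g \<in> carrier G"
  shows "mean (\<lambda>h. u (h \<otimes> g)) = mean u"
proof (rule mean_eqI)
  show "continuous_map X euclidean (\<lambda>h. u (h \<otimes> g))"
    using continuous_map_compose [OF continuous_map_translations(1) [OF g] u] by (simp add: o_def)
  fix \<epsilon> :: real assume "0 < \<epsilon>"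
  then obtain gs where gs: "right_approx u (mean u) \<epsilon> gs" using mean_approx [OF u] by blast
  have "right_avg (map (\<lambda>k. k \<otimes> inv g) gs) (\<lambda>h. u (h \<otimes> g)) x = right_avg gs u x" if "x \<in> carrier G" for x
    unfolding right_avg_def map_map comp_def length_map using gs g that
    by (intro arg_cong [where f = "scaleR _"] arg_cong [where f = sum_list] map_cong refl)
      (auto simp: right_approx_def subset_eq m_assoc)
  then show "\<exists>gs. right_approx (\<lambda>h. u (h \<otimes> g)) (mean u) \<epsilon> gs"
    using gs g by (intro exI [of _ "map (\<lambda>k. k \<otimes> inv g) gs"]) (auto simp: right_approx_def)
qed

lemma norm_mean_le:
  fixes u :: "'g \<Rightarrow> 'b::banach"
  assumes u: "continuous_map X euclidean u" and B: "\<And>g. g \<in> carrier G \<Longrightarrow> norm (u g - c) \<le> B"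
  shows "norm (mean u - c) \<le> B"
proof (rule field_le_epsilon)
  fix e :: real assume "0 < e"
  then obtain gs where gs: "right_approx u (mean u) e gs" using mean_approx [OF u] by blast
  have "norm (right_avg gs u \<one> - c) \<le> B"
    unfolding right_avg_def using gs B by (intro norm_average_diff_le) (auto simp: right_approx_def subset_eq)
  moreover have "norm (right_avg gs u \<one> - mean u) \<le> e" using gs by (simp add: right_approx_def)
  ultimately show "norm (mean u - c) \<le> B + e"
    using norm_triangle_ineq4 [of "right_avg gs u \<one> - c" "right_avg gs u \<one> - mean u"] by simp
qed

lemma right_avg_mem:
  assumes "subspace E" "\<And>g. g \<in> carrier G \<Longrightarrow> u g \<in> E" "set gs \<subseteq> carrier G" "x \<in> carrier G"
  shows "right_avg gs u x \<in> E"
proof -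
  have "(\<Sum>g\<leftarrow>gs. u (x \<otimes> g)) \<in> E"
    using assms(3) by (induction gs) (auto intro!: subspace_add assms simp: subspace_0 assms(1))
  then show ?thesis unfolding right_avg_def by (intro subspace_scale assms)
qed

lemma mean_mem:
  fixes u :: "'g \<Rightarrow> 'b::banach"
  assumes u: "continuous_map X euclidean u" and E: "subspace E" "closed E" and uE: "\<And>g. g \<in> carrier G \<Longrightarrow> u g \<in> E"
  shows "mean u \<in> E"
proof -
  have "\<exists>y\<in>E. dist y (mean u) < e" if e: "0 < e" for e
  proof -
    obtain gs where gs: "right_approx u (mean u) (e / 2) gs" using mean_approx [OF u, of "e / 2"] e by auto
    then have "right_avg gs u \<one> \<in> E" using uE by (intro right_avg_mem E) (auto simp: right_approx_def)
    moreover have "norm (right_avg gs u \<one> - mean u) \<le> e / 2" using gs by (simp add: right_approx_def)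
    ultimately show ?thesis using e by (intro bexI [of _ "right_avg gs u \<one>"]) (auto simp: dist_norm)
  qed
  then show ?thesis using closed_approachable [OF E(2)] by blast
qed

text \<open>
Averages are finite sums, so a continuous linear map may be applied before or after averaging.
\<close>

lemma mean_bounded_linear_in:
  fixes u :: "'g \<Rightarrow> 'b::banach" and A :: "'b \<Rightarrow> 'c::banach"
  assumes u: "continuous_map X euclidean u" and E: "subspace E" "closed E" and uE: "\<And>g. g \<in> carrier G \<Longrightarrow> u g \<in> E"
    and A: "bounded_linear_in E A"
  shows "continuous_map X euclidean (\<lambda>g. A (u g))" "mean (\<lambda>g. A (u g)) = A (mean u)"
proof -
  have add: "A (x + y) = A x + A y" if "x \<in> E" "y \<in> E" for x y using A that by (simp add: bounded_linear_in_def)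
  have sc: "A (a *\<^sub>R x) = a *\<^sub>R A x" if "x \<in> E" for a x using A that by (simp add: bounded_linear_in_def)
  have diff: "A (x - y) = A x - A y" if "x \<in> E" "y \<in> E" for x y
    using add [of x "- y"] sc [of y "-1"] that by (simp add: subspace_neg E)
  obtain K0 where K0: "\<And>x. x \<in> E \<Longrightarrow> norm (A x) \<le> norm x * K0" using A unfolding bounded_linear_in_def by blast
  define K where "K = max 1 K0"
  have K: "0 < K" "norm (A x) \<le> K * norm x" if "x \<in> E" for x
    using K0 [OF that] mult_left_mono [of K0 K "norm x"] by (auto simp: K_def mult.commute)
  have "continuous_on E A"
    unfolding continuous_on_iff
  proof (intro ballI allI impI)
    fix x and e :: real assume x: "x \<in> E" and e: "0 < e"
    have "dist (A y) (A x) < e" if "y \<in> E" "dist y x < e / K" for y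
    proof -
      have "norm (A (y - x)) \<le> K * norm (y - x)" using that x by (intro K subspace_diff E)
      also have "\<dots> < e" using that K(1) [OF x] by (simp add: dist_norm pos_less_divide_eq mult.commute)
      finally show ?thesis using diff that x by (simp add: dist_norm)
    qed
    then show "\<exists>d>0. \<forall>y\<in>E. dist y x < d \<longrightarrow> dist (A y) (A x) < e"
      using e K(1) [OF x] by (intro exI [of _ "e / K"]) auto
  qed
  then have cA: "continuous_map (top_of_set E) euclidean A" by simp
  have "continuous_map X (top_of_set E) u"
    using u uE by (auto simp: continuous_map_in_subtopology topspace_eq)
  from continuous_map_compose [OF this cA] show Au: "continuous_map X euclidean (\<lambda>g. A (u g))" by (simp add: o_def)
  show "mean (\<lambda>g. A (u g)) = A (mean u)"
  proof (rule mean_eqI [OF Au])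
    fix \<epsilon> :: real assume \<epsilon>: "0 < \<epsilon>"
    have "0 \<in> E" by (rule subspace_0 [OF E(1)])
    note K = K(1) [OF this] K(2)
    obtain gs where gs: "right_approx u (mean u) (\<epsilon> / K) gs" using mean_approx [OF u, of "\<epsilon> / K"] \<epsilon> K by auto
    have "norm (right_avg gs (\<lambda>g. A (u g)) x - A (mean u)) \<le> \<epsilon>" if x: "x \<in> carrier G" for x
    proof -
      have "set gs' \<subseteq> carrier G \<Longrightarrow> (\<Sum>g\<leftarrow>gs'. A (u (x \<otimes> g))) = A (\<Sum>g\<leftarrow>gs'. u (x \<otimes> g)) \<and> (\<Sum>g\<leftarrow>gs'. u (x \<otimes> g)) \<in> E" for gs'
      proof (induction gs')
        case Nil
        then show ?case using sc [OF \<open>0 \<in> E\<close>, of 0] \<open>0 \<in> E\<close> by simp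
      next
        case (Cons g gs')
        then show ?case using x uE by (auto simp: add subspace_add E)
      qed
      then have "right_avg gs (\<lambda>g. A (u g)) x = A (right_avg gs u x)"
        using gs unfolding right_avg_def right_approx_def by (simp add: sc)
      moreover have m: "right_avg gs u x \<in> E" "mean u \<in> E"
        using gs uE x u E by (auto intro!: right_avg_mem mean_mem simp: right_approx_def)
      ultimately have "norm (right_avg gs (\<lambda>g. A (u g)) x - A (mean u)) \<le> K * norm (right_avg gs u x - mean u)"
        using K(2) [OF subspace_diff [OF E(1) m]] by (simp add: diff)
      also have "\<dots> \<le> K * (\<epsilon> / K)" using gs x K(1) by (intro mult_left_mono) (auto simp: right_approx_def)
      finally show ?thesis using K(1) by simp
    qed
    then show "\<exists>gs. right_approx (\<lambda>g. A (u g)) (A (mean u)) \<epsilon> gs"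
      using gs by (auto simp: right_approx_def)
  qed
qed

lemma mean_bounded_linear:
  fixes u :: "'g \<Rightarrow> 'b::banach" and A :: "'b \<Rightarrow> 'c::banach"
  assumes u: "continuous_map X euclidean u" and A: "bounded_linear A"
  shows "mean (\<lambda>g. A (u g)) = A (mean u)"
proof (rule mean_bounded_linear_in(2) [OF u subspace_UNIV closed_UNIV])
  show "bounded_linear_in UNIV A"
    using A by (auto simp: bounded_linear_in_def linear_simps intro: bounded_linear.bounded)
qed auto

lemma mean_scaleR:
  fixes u :: "'g \<Rightarrow> 'b::banach"
  assumes "continuous_map X euclidean u"
  shows "mean (\<lambda>g. a *\<^sub>R u g) = a *\<^sub>R mean u"
  using mean_bounded_linear [OF assms bounded_linear_scaleR_right] .

text \<open>
The mean of the pair \<open>(u, v)\<close> has the components \<open>mean u\<close> and \<open>mean v\<close>, because the projections are linear.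
Addition is a linear map on pairs.
\<close>

lemma mean_add:
  fixes u v :: "'g \<Rightarrow> 'b::banach"
  assumes u: "continuous_map X euclidean u" and v: "continuous_map X euclidean v"
  shows "mean (\<lambda>g. u g + v g) = mean u + mean v"
proof -
  have w: "continuous_map X euclidean (\<lambda>g. (u g, v g))"
    using u v by (simp add: continuous_map_atin tendsto_Pair)
  have "mean (\<lambda>g. (u g, v g)) = (mean u, mean v)"
    using mean_bounded_linear [OF w bounded_linear_fst] mean_bounded_linear [OF w bounded_linear_snd] by (simp add: prod_eq_iff)
  then show ?thesis
    using mean_bounded_linear [OF w bounded_linear_add [OF bounded_linear_fst bounded_linear_snd]] by simp
qed

lemma mean_sum:
  fixes u :: "'i \<Rightarrow> 'g \<Rightarrow> 'b::banach"
  assumes "\<And>i. i \<in> A \<Longrightarrow> continuous_map X euclidean (u i)"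
  shows "mean (\<lambda>g. \<Sum>i\<in>A. u i g) = (\<Sum>i\<in>A. mean (u i))"
proof (cases "finite A")
  case True
  then show ?thesis using assms
  proof (induction A rule: finite_induct)
    case (insert i A)
    then show ?case by (simp add: mean_add continuous_map_sum)
  qed simp
qed simp

lemma continuous_map_cube_diff:
  fixes u :: "'i set \<Rightarrow> 'g \<Rightarrow> 'b::real_normed_vector"
  assumes "finite I" "\<And>S. S \<subseteq> I \<Longrightarrow> continuous_map X euclidean (u S)"
  shows "continuous_map X euclidean (\<lambda>g. cube_diff I (\<lambda>S. u S g))"
  unfolding cube_diff_def using assms by (intro continuous_map_sum continuous_map_scaleR_left) auto

lemma mean_cube_diff:
  fixes u :: "'i set \<Rightarrow> 'g \<Rightarrow> 'b::banach"
  assumes "finite I" "\<And>S. S \<subseteq> I \<Longrightarrow> continuous_map X euclidean (u S)"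
  shows "mean (\<lambda>g. cube_diff I (\<lambda>S. u S g)) = cube_diff I (\<lambda>S. mean (u S))"
proof -
  have "mean (\<lambda>g. cube_diff I (\<lambda>S. u S g)) = (\<Sum>S\<in>Pow I. mean (\<lambda>g. (-1) ^ card (I - S) *\<^sub>R u S g))"
    unfolding cube_diff_def using assms by (intro mean_sum continuous_map_scaleR_left) auto
  then show ?thesis unfolding cube_diff_def using assms by (simp add: mean_scaleR)
qed

end

section \<open>First derivatives and perturbations of the identity\<close>

lemma has_deriv_in_alt:
  "has_deriv_in E U f A x \<longleftrightarrow> bounded_linear_in E A \<and>
    (\<forall>e>0. \<exists>d>0. \<forall>y\<in>U. norm (y - x) < d \<longrightarrow> norm (f y - f x - A (y - x)) \<le> e * norm (y - x))"
  if E: "x \<in> E" "subspace E"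
proof (cases "bounded_linear_in E A")
  case True
  then have A0: "A 0 = 0" using subspace_0 [OF E(2)] unfolding bounded_linear_in_def
    by (metis scale_zero_left)
  have quot: "norm (w /\<^sub>R norm v) \<le> e \<longleftrightarrow> norm w \<le> e * norm v" if "v \<noteq> 0"
    for v :: 'a and w :: 'b and e
    using that by (simp add: divide_simps mult.commute)
  have "((\<lambda>y. (f y - f x - A (y - x)) /\<^sub>R norm (y - x)) \<longlongrightarrow> 0) (at x within U) \<longleftrightarrow>
    (\<forall>e>0. \<exists>d>0. \<forall>y\<in>U. norm (y - x) < d \<longrightarrow> norm (f y - f x - A (y - x)) \<le> e * norm (y - x))"
    (is "?L \<longleftrightarrow> ?R")
  proof
    assume L: ?L
    show ?R
    proof (intro allI impI)
      fix e :: real assume "0 < e"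
      then have "\<forall>\<^sub>F y in at x within U. norm ((f y - f x - A (y - x)) /\<^sub>R norm (y - x)) < e"
        using L by (simp add: tendsto_iff)
      then obtain d where d: "d > 0" "\<And>y. y \<in> U \<Longrightarrow> y \<noteq> x \<Longrightarrow> dist y x < d \<Longrightarrow>
          norm ((f y - f x - A (y - x)) /\<^sub>R norm (y - x)) < e"
        unfolding eventually_at by auto
      have "norm (f y - f x - A (y - x)) \<le> e * norm (y - x)" if "y \<in> U" "norm (y - x) < d" for y
      proof (cases "y = x")
        case True
        then show ?thesis by (simp add: A0)
      next
        case False
        then show ?thesis using d(2) [of y] that quot [of "y - x" "f y - f x - A (y - x)" e] by (simp add: dist_norm)
      qed
      then show "\<exists>d>0. \<forall>y\<in>U. norm (y - x) < d \<longrightarrow> norm (f y - f x - A (y - x)) \<le> e * norm (y - x)"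
        using d(1) by blast
    qed
  next
    assume R: ?R
    show ?L
    proof (rule tendstoI)
      fix e :: real assume "0 < e"
      then obtain d where d: "d > 0" "\<And>y. y \<in> U \<Longrightarrow> norm (y - x) < d \<Longrightarrow> norm (f y - f x - A (y - x)) \<le> e / 2 * norm (y - x)"
        using R half_gt_zero by metis
      have "norm ((f y - f x - A (y - x)) /\<^sub>R norm (y - x)) < e" if "y \<in> U" "y \<noteq> x" "dist y x < d" for y
        using d(2) [of y] that quot [of "y - x" "f y - f x - A (y - x)" "e / 2"] \<open>0 < e\<close> by (simp add: dist_norm)
      then show "\<forall>\<^sub>F y in at x within U. dist ((f y - f x - A (y - x)) /\<^sub>R norm (y - x)) 0 < e"
        unfolding eventually_at using d(1) by (auto simp: dist_norm)
    qed
  qed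
  then show ?thesis using True by (simp add: has_deriv_in_def)
qed (simp add: has_deriv_in_def)

lemma has_deriv_in_cong:
  assumes "has_deriv_in E U f A x" "\<And>y. y \<in> U \<Longrightarrow> g y = f y" "x \<in> U"
  shows "has_deriv_in E U g A x"
proof -
  have "((\<lambda>y. (g y - g x - A (y - x)) /\<^sub>R norm (y - x)) \<longlongrightarrow> 0) (at x within U) \<longleftrightarrow>
    ((\<lambda>y. (f y - f x - A (y - x)) /\<^sub>R norm (y - x)) \<longlongrightarrow> 0) (at x within U)"
    using assms by (intro filterlim_cong refl) (auto simp: eventually_at_filter)
  then show ?thesis using assms by (simp add: has_deriv_in_def)
qed

lemma has_deriv_in_mono:
  assumes "has_deriv_in E U f A x" "E' \<subseteq> E" "U' \<subseteq> U"
  shows "has_deriv_in E' U' f A x"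
proof -
  have "bounded_linear_in E' A"
    using assms unfolding has_deriv_in_def bounded_linear_in_def by blast
  then show ?thesis
    using assms unfolding has_deriv_in_def by (blast intro: tendsto_within_subset)
qed

lemma has_deriv_in_linear:
  assumes "has_deriv_in E U f A x"
  shows "bounded_linear_in E A" "\<And>u v. u \<in> E \<Longrightarrow> v \<in> E \<Longrightarrow> A (u + v) = A u + A v"
    "\<And>a v. v \<in> E \<Longrightarrow> A (a *\<^sub>R v) = a *\<^sub>R A v"
  using assms unfolding has_deriv_in_def bounded_linear_in_def by auto

lemma has_deriv_in_LIMSEQ:
  assumes f: "has_deriv_in E U f A x" and E: "subspace E" and U: "openin (top_of_set E) U" "x \<in> U"
    and v: "v \<in> E"
  shows "\<forall>\<^sub>F j in sequentially. x + (1 / 2 ^ j) *\<^sub>R v \<in> U"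
    "(\<lambda>j. 2 ^ j *\<^sub>R (f (x + (1 / 2 ^ j) *\<^sub>R v) - f x)) \<longlonglongrightarrow> A v"
proof -
  have x: "x \<in> E" using U openin_imp_subset by blast
  obtain \<epsilon> where e: "0 < \<epsilon>" "E \<inter> ball x \<epsilon> \<subseteq> U" using openin_subspace_ball [OF U] by blast
  have mem: "x + (1 / 2 ^ j) *\<^sub>R v \<in> E" for j by (intro subspace_add subspace_scale E x v)
  have "\<forall>\<^sub>F j in sequentially. x + (1 / 2 ^ j) *\<^sub>R v \<in> ball x \<epsilon>"
    using e by (intro eventually_dyadic_step) simp
  then show evU: "\<forall>\<^sub>F j in sequentially. x + (1 / 2 ^ j) *\<^sub>R v \<in> U"
    by (rule eventually_mono) (use mem e(2) in blast)
  show "(\<lambda>j. 2 ^ j *\<^sub>R (f (x + (1 / 2 ^ j) *\<^sub>R v) - f x)) \<longlonglongrightarrow> A v"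
  proof (rule tendstoI)
    fix e :: real assume e: "0 < e"
    define e' where "e' = e / (norm v + 1)"
    have e': "0 < e'" "e' * norm v < e"
    proof -
      have p: "0 < norm v + 1" by (simp add: add_nonneg_pos)
      then show "0 < e'" using e by (simp add: e'_def)
      have "e' * norm v < e' * (norm v + 1)" using \<open>0 < e'\<close> by (intro mult_strict_left_mono) auto
      also have "\<dots> = e" using p by (simp add: e'_def)
      finally show "e' * norm v < e" .
    qed
    obtain d where d: "d > 0" "\<And>y. y \<in> U \<Longrightarrow> norm (y - x) < d \<Longrightarrow> norm (f y - f x - A (y - x)) \<le> e' * norm (y - x)"
      using f e'(1) unfolding has_deriv_in_alt [OF x E] by blast
    have "\<forall>\<^sub>F j in sequentially. x + (1 / 2 ^ j) *\<^sub>R v \<in> ball x d"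
      using d by (intro eventually_dyadic_step) simp
    with evU show "\<forall>\<^sub>F j in sequentially. dist (2 ^ j *\<^sub>R (f (x + (1 / 2 ^ j) *\<^sub>R v) - f x)) (A v) < e"
    proof eventually_elim
      case (elim j)
      let ?y = "x + (1 / 2 ^ j) *\<^sub>R v"
      have A: "2 ^ j *\<^sub>R A ((1 / 2 ^ j) *\<^sub>R v) = A v" using has_deriv_in_linear(3) [OF f v] by simp
      have "norm (f ?y - f x - A (?y - x)) \<le> e' * norm (?y - x)"
        using elim by (intro d(2)) (auto simp: dist_norm)
      then have "2 ^ j * norm (f ?y - f x - A ((1 / 2 ^ j) *\<^sub>R v)) \<le> 2 ^ j * (e' * norm ((1 / 2 ^ j) *\<^sub>R v))"
        by (intro mult_left_mono) auto
      moreover have "2 ^ j * (e' * norm ((1 / 2 ^ j) *\<^sub>R v)) = e' * norm v" by simp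
      moreover have "2 ^ j *\<^sub>R (f ?y - f x) - A v = 2 ^ j *\<^sub>R (f ?y - f x - A ((1 / 2 ^ j) *\<^sub>R v))"
        using A by (simp add: scaleR_diff_right)
      ultimately show ?case using e'(2) by (simp add: dist_norm)
    qed
  qed
qed

lemma has_deriv_in_unique:
  assumes "has_deriv_in E U f A x" "has_deriv_in E U f B x" "subspace E" "openin (top_of_set E) U" "x \<in> U" "v \<in> E"
  shows "A v = B v"
  using LIMSEQ_unique [OF has_deriv_in_LIMSEQ(2) [OF assms(1,3-6)] has_deriv_in_LIMSEQ(2) [OF assms(2,3-6)]] .

lemma deriv_in_eq:
  assumes "has_deriv_in E U f A x" "subspace E" "openin (top_of_set E) U" "x \<in> U" "v \<in> E"
  shows "deriv_in E U f x v = A v"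
  unfolding deriv_in_def
proof (rule the_equality)
  show "\<exists>B. has_deriv_in E U f B x \<and> A v = B v" using assms(1) by blast
  fix w assume "\<exists>B. has_deriv_in E U f B x \<and> w = B v"
  then show "w = A v" using has_deriv_in_unique [OF _ assms(1-5)] by blast
qed

lemma has_deriv_in_mem:
  assumes f: "has_deriv_in E U f A x" and E: "subspace E" and U: "openin (top_of_set E) U" "x \<in> U"
    and v: "v \<in> E" and F: "subspace F" "closed F" and fU: "f ` U \<subseteq> F"
  shows "A v \<in> F"
proof (rule Lim_in_closed_set [OF F(2) _ _ has_deriv_in_LIMSEQ(2) [OF f E U v]])
  show "\<forall>\<^sub>F j in sequentially. 2 ^ j *\<^sub>R (f (x + (1 / 2 ^ j) *\<^sub>R v) - f x) \<in> F"
    using has_deriv_in_LIMSEQ(1) [OF f E U v]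
    by (rule eventually_mono) (use fU U in \<open>auto intro!: subspace_scale subspace_diff F\<close>)
qed simp

lemma has_deriv_in_continuous:
  assumes f: "has_deriv_in E U f A x" and E: "subspace E" and U: "U \<subseteq> E" "x \<in> U"
  shows "\<exists>K>0. \<exists>d>0. \<forall>y\<in>U. norm (y - x) < d \<longrightarrow> norm (f y - f x) \<le> K * norm (y - x)"
proof -
  have x: "x \<in> E" using U by blast
  obtain K0 where K0: "\<And>v. v \<in> E \<Longrightarrow> norm (A v) \<le> norm v * K0"
    using has_deriv_in_linear(1) [OF f] unfolding bounded_linear_in_def by blast
  obtain d where d: "d > 0" "\<And>y. y \<in> U \<Longrightarrow> norm (y - x) < d \<Longrightarrow> norm (f y - f x - A (y - x)) \<le> 1 * norm (y - x)"
    using f zero_less_one unfolding has_deriv_in_alt [OF x E] by blast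
  have "norm (f y - f x) \<le> (max 0 K0 + 1) * norm (y - x)" if "y \<in> U" "norm (y - x) < d" for y
  proof -
    have yx: "y - x \<in> E" using that U by (intro subspace_diff E) auto
    have "norm (f y - f x) \<le> norm (f y - f x - A (y - x)) + norm (A (y - x))"
      using norm_triangle_ineq [of "f y - f x - A (y - x)" "A (y - x)"] by simp
    also have "\<dots> \<le> norm (y - x) + norm (y - x) * max 0 K0"
      using d(2) [OF that] K0 [OF yx] mult_left_mono [of K0 "max 0 K0" "norm (y - x)"] by simp
    finally show ?thesis by (simp add: algebra_simps)
  qed
  then show ?thesis using d(1) by (intro exI [of _ "max 0 K0 + 1"]) auto
qed

lemma has_deriv_in_compose:
  assumes f: "has_deriv_in E U f A x" and g: "has_deriv_in F W g B (f x)"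
    and E: "subspace E" and U: "openin (top_of_set E) U" "x \<in> U"
    and F: "subspace F" "closed F" and W: "W \<subseteq> F" and fU: "f ` U \<subseteq> W"
  shows "has_deriv_in E U (\<lambda>y. g (f y)) (\<lambda>v. B (A v)) x"
proof -
  have UE: "U \<subseteq> E" using U openin_imp_subset by blast
  have x: "x \<in> E" using UE U by blast
  have fx: "f x \<in> F" using fU W U by blast
  have AF: "A v \<in> F" if "v \<in> E" for v
    using has_deriv_in_mem [OF f E U that F] fU W by blast
  obtain KA where KA: "\<And>v. v \<in> E \<Longrightarrow> norm (A v) \<le> norm v * KA"
    using has_deriv_in_linear(1) [OF f] unfolding bounded_linear_in_def by blast
  obtain KB where KB: "\<And>v. v \<in> F \<Longrightarrow> norm (B v) \<le> norm v * KB"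
    using has_deriv_in_linear(1) [OF g] unfolding bounded_linear_in_def by blast
  define K where "K = max 1 KB"
  have KBK: "KB \<le> K" by (simp add: K_def)
  have K: "norm (B v) \<le> norm v * K" if "v \<in> F" for v
    using order_trans [OF KB [OF that] mult_left_mono [OF KBK norm_ge_zero]] .
  have K1: "1 \<le> K" by (simp add: K_def)
  have Bdiff: "B (u - v) = B u - B v" if "u \<in> F" "v \<in> F" for u v
    using has_deriv_in_linear(2) [OF g that(1) subspace_neg [OF F(1) that(2)]] has_deriv_in_linear(3) [OF g that(2), of "-1"] by simp
  have bl: "bounded_linear_in E (\<lambda>v. B (A v))"
    unfolding bounded_linear_in_def
  proof (intro conjI ballI allI exI)
    show "norm (B (A v)) \<le> norm v * (max 0 KA * K)" if "v \<in> E" for v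
    proof -
      have "norm (B (A v)) \<le> norm (A v) * K" using K AF that by blast
      also have "\<dots> \<le> (norm v * max 0 KA) * K"
        using KA [OF that] mult_left_mono [of KA "max 0 KA" "norm v"] K1 by (intro mult_right_mono) auto
      finally show ?thesis by (simp add: mult.assoc)
    qed
  next
    fix u v assume uv: "u \<in> E" "v \<in> E"
    show "B (A (u + v)) = B (A u) + B (A v)"
      unfolding has_deriv_in_linear(2) [OF f uv] by (intro has_deriv_in_linear(2) [OF g] AF uv)
  next
    fix a v assume v: "v \<in> E"
    show "B (A (a *\<^sub>R v)) = a *\<^sub>R B (A v)"
      unfolding has_deriv_in_linear(3) [OF f v] by (intro has_deriv_in_linear(3) [OF g] AF v)
  qed
  obtain L dL where L: "L > 0" "dL > 0" "\<And>y. y \<in> U \<Longrightarrow> norm (y - x) < dL \<Longrightarrow> norm (f y - f x) \<le> L * norm (y - x)"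
    using has_deriv_in_continuous [OF f E UE U(2)] by blast
  show ?thesis
    unfolding has_deriv_in_alt [OF x E]
  proof (intro conjI bl allI impI)
    fix e :: real assume e: "0 < e"
    have pos: "0 < e / (2 * K)" "0 < e / (2 * L)" using e K1 L by auto
    obtain d1 where d1: "d1 > 0" "\<And>y. y \<in> U \<Longrightarrow> norm (y - x) < d1 \<Longrightarrow> norm (f y - f x - A (y - x)) \<le> (e / (2 * K)) * norm (y - x)"
      using f pos(1) unfolding has_deriv_in_alt [OF x E] by blast
    obtain d2 where d2: "d2 > 0" "\<And>z. z \<in> W \<Longrightarrow> norm (z - f x) < d2 \<Longrightarrow> norm (g z - g (f x) - B (z - f x)) \<le> (e / (2 * L)) * norm (z - f x)"
      using g pos(2) unfolding has_deriv_in_alt [OF fx F(1)] by blast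
    show "\<exists>d>0. \<forall>y\<in>U. norm (y - x) < d \<longrightarrow> norm (g (f y) - g (f x) - B (A (y - x))) \<le> e * norm (y - x)"
    proof (intro exI [of _ "min (min d1 dL) (d2 / L)"] conjI ballI impI)
      show "0 < min (min d1 dL) (d2 / L)" using d1 d2 L by simp
      fix y assume y: "y \<in> U" "norm (y - x) < min (min d1 dL) (d2 / L)"
      have yx: "y - x \<in> E" using UE y x by (intro subspace_diff E) auto
      have fy: "f y \<in> W" "f y - f x \<in> F" using fU W y fx by (auto intro!: subspace_diff F)
      have fL: "norm (f y - f x) \<le> L * norm (y - x)" using L(3) y by simp
      also have "\<dots> < d2" using y L by (simp add: pos_less_divide_eq mult.commute)
      finally have "norm (g (f y) - g (f x) - B (f y - f x)) \<le> (e / (2 * L)) * norm (f y - f x)"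
        using d2(2) fy by blast
      also have "\<dots> \<le> (e / (2 * L)) * (L * norm (y - x))" using e L fL by (intro mult_left_mono) auto
      also have "\<dots> = e / 2 * norm (y - x)" using L by simp
      finally have 1: "norm (g (f y) - g (f x) - B (f y - f x)) \<le> e / 2 * norm (y - x)" .
      have "norm (B (f y - f x - A (y - x))) \<le> norm (f y - f x - A (y - x)) * K"
        by (rule K [OF subspace_diff [OF F(1) fy(2) AF [OF yx]]])
      also have "\<dots> \<le> (e / (2 * K)) * norm (y - x) * K" using d1(2) y K1 by (intro mult_right_mono) auto
      also have "\<dots> = e / 2 * norm (y - x)" using K1 by simp
      finally have 2: "norm (B (f y - f x - A (y - x))) \<le> e / 2 * norm (y - x)" .
      have "g (f y) - g (f x) - B (A (y - x)) = (g (f y) - g (f x) - B (f y - f x)) + B (f y - f x - A (y - x))"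
        using Bdiff [OF fy(2) AF [OF yx]] by simp
      also have "norm \<dots> \<le> e / 2 * norm (y - x) + e / 2 * norm (y - x)" by (rule norm_triangle_mono [OF 1 2])
      finally show "norm (g (f y) - g (f x) - B (A (y - x))) \<le> e * norm (y - x)" by simp
    qed
  qed
qed

text \<open>
The inverse function theorem for a map that differs from the identity by a contraction: \<open>\<psi> x = y\<close> means that \<open>x\<close> is a
fixed point of the contraction \<open>x \<mapsto> x - (\<psi> x - y)\<close>.
\<close>

lemma perturbed_identity:
  fixes \<psi> :: "'a::banach \<Rightarrow> 'a"
  assumes E: "subspace E" "closed E" and r: "r \<le> \<rho>"
    and \<psi>: "\<And>x. x \<in> E \<inter> ball x0 \<rho> \<Longrightarrow> \<psi> x \<in> E"
    and near: "\<And>x y. x \<in> E \<inter> ball x0 \<rho> \<Longrightarrow> y \<in> E \<inter> ball x0 \<rho> \<Longrightarrow> norm (\<psi> x - \<psi> y - (x - y)) \<le> 1 / 2 * norm (x - y)"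
  shows "openin (top_of_set E) (\<psi> ` (E \<inter> ball x0 r))"
    and "\<And>x y. x \<in> E \<inter> ball x0 \<rho> \<Longrightarrow> y \<in> E \<inter> ball x0 \<rho> \<Longrightarrow> norm (x - y) \<le> 2 * norm (\<psi> x - \<psi> y)"
proof -
  have sub: "E \<inter> ball x0 r \<subseteq> E \<inter> ball x0 \<rho>" using subset_ball [OF r] by auto
  show "norm (x - y) \<le> 2 * norm (\<psi> x - \<psi> y)" if "x \<in> E \<inter> ball x0 \<rho>" "y \<in> E \<inter> ball x0 \<rho>" for x y
  proof -
    have "norm (x - y) \<le> norm (\<psi> x - \<psi> y) + norm (\<psi> x - \<psi> y - (x - y))"
      using norm_triangle_ineq4 [of "\<psi> x - \<psi> y" "\<psi> x - \<psi> y - (x - y)"] by simp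
    then show ?thesis using near [OF that] by simp
  qed
  show "openin (top_of_set E) (\<psi> ` (E \<inter> ball x0 r))"
    unfolding openin_contains_ball
  proof (intro conjI ballI)
    show "\<psi> ` (E \<inter> ball x0 r) \<subseteq> E" using \<psi> sub by auto
    fix y1 assume "y1 \<in> \<psi> ` (E \<inter> ball x0 r)"
    then obtain x1 where x1: "y1 = \<psi> x1" "x1 \<in> E" "x1 \<in> ball x0 r" by auto
    obtain \<eta> where \<eta>: "0 < \<eta>" "cball x1 \<eta> \<subseteq> ball x0 r"
      using x1(3) open_ball open_contains_cball by blast
    show "\<exists>e>0. ball y1 e \<inter> E \<subseteq> \<psi> ` (E \<inter> ball x0 r)"
    proof (intro exI [of _ "\<eta> / 2"] conjI subsetI)
      fix y assume y: "y \<in> ball y1 (\<eta> / 2) \<inter> E"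
      define T where "T x = x - (\<psi> x - y)" for x
      let ?S = "E \<inter> cball x1 \<eta>"
      have Ssub: "?S \<subseteq> E \<inter> ball x0 r" using \<eta> by auto
      have "\<exists>!x\<in>?S. T x = x"
      proof (rule Banach_fix [where c = "1 / 2"])
        show "complete ?S" using E(2) by (simp add: complete_eq_closed closed_Int)
        show "?S \<noteq> {}" using x1 \<eta> by auto
        show "dist (T x) (T x') \<le> 1 / 2 * dist x x'" if "x \<in> ?S" "x' \<in> ?S" for x x'
        proof -
          have "norm (\<psi> x - \<psi> x' - (x - x')) \<le> 1 / 2 * norm (x - x')"
            using that Ssub sub by (intro near) blast+
          moreover have "T x - T x' = - (\<psi> x - \<psi> x' - (x - x'))" by (simp add: T_def)
          ultimately show ?thesis by (metis dist_norm norm_minus_cancel)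
        qed
        show "T ` ?S \<subseteq> ?S"
        proof
          fix z assume "z \<in> T ` ?S"
          then obtain x where x: "x \<in> ?S" "z = T x" by auto
          have xs: "x \<in> E \<inter> ball x0 \<rho>" "x1 \<in> E \<inter> ball x0 \<rho>" using x(1) Ssub sub x1(2,3) by blast+
          have "z \<in> E" using x xs y \<psi> by (auto simp: T_def intro!: subspace_diff E)
          have "norm (\<psi> x - \<psi> x1 - (x - x1)) \<le> 1 / 2 * norm (x - x1)" by (intro near xs)
          also have "\<dots> \<le> \<eta> / 2" using x by (simp add: dist_norm norm_minus_commute)
          finally have "norm (\<psi> x - \<psi> x1 - (x - x1)) \<le> \<eta> / 2" .
          moreover have "norm (y - y1) \<le> \<eta> / 2" using y by (simp add: dist_norm norm_minus_commute)
          moreover have "z - x1 = (y - y1) - (\<psi> x - \<psi> x1 - (x - x1))" by (simp add: x T_def x1)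
          ultimately have "norm (z - x1) \<le> \<eta>"
            using norm_triangle_ineq4 [of "y - y1" "\<psi> x - \<psi> x1 - (x - x1)"] by (metis add_mono field_sum_of_halves order_trans)
          then show "z \<in> ?S" using \<open>z \<in> E\<close> by (simp add: dist_norm norm_minus_commute)
        qed
      qed auto
      then obtain x where "x \<in> ?S" "\<psi> x = y" by (auto simp: T_def)
      then show "y \<in> \<psi> ` (E \<inter> ball x0 r)" using Ssub by blast
    qed (use \<eta> in auto)
  qed
qed

section \<open>Compact groups of smooth maps near a fixed point\<close>

lemma continuous_map_euclidean_iff:
  fixes f :: "'a \<Rightarrow> 'b::metric_space"
  shows "continuous_map X euclidean f \<longleftrightarrow>
    (\<forall>x\<in>topspace X. \<forall>e>0. \<exists>U. openin X U \<and> x \<in> U \<and> (\<forall>y\<in>U. dist (f y) (f x) < e))"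
  using Met_TC.continuous_map_to_metric [of X f] by (simp add: dist_commute)

lemma continuous_map_euclideanE:
  fixes f :: "'a \<Rightarrow> 'b::metric_space"
  assumes "continuous_map X euclidean f" "x \<in> topspace X" "0 < e"
  obtains U where "openin X U" "x \<in> U" "\<And>y. y \<in> U \<Longrightarrow> dist (f y) (f x) < e"
proof -
  obtain U where "openin X U \<and> x \<in> U \<and> (\<forall>y\<in>U. dist (f y) (f x) < e)"
    using assms(1) [unfolded continuous_map_euclidean_iff, rule_format, OF assms(2,3)] ..
  then show thesis by (intro that [of U]) auto
qed

lemma continuous_map_uniform_approx:
  fixes f :: "'a \<Rightarrow> 'b::metric_space"
  assumes "\<And>e. 0 < e \<Longrightarrow> \<exists>g. continuous_map X euclidean g \<and> (\<forall>x\<in>topspace X. dist (g x) (f x) < e)"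
  shows "continuous_map X euclidean f"
  unfolding continuous_map_euclidean_iff
proof (intro ballI allI impI)
  fix x and e :: real assume x: "x \<in> topspace X" and e: "0 < e"
  obtain g where g: "continuous_map X euclidean g" "\<And>x. x \<in> topspace X \<Longrightarrow> dist (g x) (f x) < e / 3"
    using assms [of "e / 3"] e by auto
  obtain U where U: "openin X U" "x \<in> U" "\<And>y. y \<in> U \<Longrightarrow> dist (g y) (g x) < e / 3"
    using continuous_map_euclideanE [OF g(1) x, of "e / 3"] e by auto
  have "dist (f y) (f x) < e" if "y \<in> U" for y
  proof -
    have y: "y \<in> topspace X" using U(1) that openin_subset by blast
    have "dist (f y) (f x) \<le> dist (g y) (f y) + dist (g y) (g x) + dist (g x) (f x)"
      using dist_triangle [of "f y" "f x" "g y"] dist_triangle [of "g y" "f x" "g x"] by (simp add: dist_commute)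
    then show ?thesis using g(2) [OF x] g(2) [OF y] U(3) [OF that] by linarith
  qed
  then show "\<exists>U. openin X U \<and> x \<in> U \<and> (\<forall>y\<in>U. dist (f y) (f x) < e)" using U by blast
qed

text \<open>
By compactness finitely many local parameters suffice, and these have a common weaker one. In the application the
parameters are the radius and the constant of a bound on differences.
\<close>

lemma compact_space_uniform:
  assumes "compact_space X"
    and "\<And>x. x \<in> topspace X \<Longrightarrow> \<exists>U. openin X U \<and> x \<in> U \<and> (\<exists>p. \<forall>y\<in>U. P p y)"
    and "\<And>p q. \<exists>r. \<forall>y\<in>topspace X. P p y \<or> P q y \<longrightarrow> P r y"
  shows "\<exists>p. \<forall>y\<in>topspace X. P p y"
proof -
  define \<U> where "\<U> = {U. openin X U \<and> (\<exists>p. \<forall>y\<in>U. P p y)}"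
  have op: "openin X U" if "U \<in> \<U>" for U using that by (simp add: \<U>_def)
  have "topspace X \<subseteq> \<Union>\<U>" using assms(2) by (force simp: \<U>_def)
  then obtain \<F> where \<F>: "finite \<F>" "\<F> \<subseteq> \<U>" "topspace X \<subseteq> \<Union>\<F>"
    using compactinD [OF _ op] assms(1) unfolding compact_space_def by meson
  have "\<exists>p. \<forall>y\<in>\<Union>\<F>. P p y"
    using \<F>(1,2)
  proof (induction \<F> rule: finite_induct)
    case (insert U \<F>)
    then obtain p q where "\<forall>y\<in>\<Union>\<F>. P p y" "\<forall>y\<in>U. P q y" by (auto simp: \<U>_def)
    moreover obtain r where "\<forall>y\<in>topspace X. P p y \<or> P q y \<longrightarrow> P r y" using assms(3) by blast
    moreover have "\<Union>(insert U \<F>) \<subseteq> topspace X"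
      using insert.prems op openin_subset by blast
    ultimately show ?case by (intro exI [of _ r]) blast
  qed simp
  then show ?thesis using \<F>(3) by blast
qed

lemma cube_bounded_const: "cube_bounded E (\<lambda>y. c) x k \<delta> (norm c)"
  unfolding cube_bounded_def
proof (intro allI impI)
  fix I :: "nat set" and h :: "nat \<Rightarrow> 'a"
  assume I: "finite I"
  show "norm (cube_diff I (\<lambda>S. c)) \<le> norm c * (\<Prod>i\<in>I. norm (h i))"
    by (cases "I = {}") (auto simp: cube_diff_const [OF I] intro!: mult_nonneg_nonneg prod_nonneg)
qed

lemma cube_bounded_diff:
  assumes "cube_bounded E f x k \<delta> C" "cube_bounded E g x k \<delta> D"
  shows "cube_bounded E (\<lambda>y. f y - g y) x k \<delta> (C + D)"
  unfolding cube_bounded_def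
proof (intro allI impI)
  fix I :: "nat set" and h y
  assume A: "finite I" "card I \<le> k" "y \<in> E" "h ` I \<subseteq> E" "\<forall>S\<subseteq>I. y + sum h S \<in> ball x \<delta>"
  have "norm (cube_diff I (\<lambda>S. f (y + sum h S))) \<le> C * (\<Prod>i\<in>I. norm (h i))"
       "norm (cube_diff I (\<lambda>S. g (y + sum h S))) \<le> D * (\<Prod>i\<in>I. norm (h i))"
    using A by (intro cube_boundedD [OF assms(1)] cube_boundedD [OF assms(2)]; simp)+
  then show "norm (cube_diff I (\<lambda>S. f (y + sum h S) - g (y + sum h S))) \<le> (C + D) * (\<Prod>i\<in>I. norm (h i))"
    unfolding cube_diff_diff distrib_right
    by (meson add_mono norm_triangle_ineq4 order_trans)
qed

lemma cube_diff_bounded_linear_in: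
  assumes A: "bounded_linear_in E A" and E: "subspace E" and y: "\<And>S. S \<subseteq> I \<Longrightarrow> y S \<in> E" and I: "finite I"
  shows "cube_diff I (\<lambda>S. A (y S)) = A (cube_diff I y)"
proof -
  have add: "A (u + v) = A u + A v" if "u \<in> E" "v \<in> E" for u v using A that by (simp add: bounded_linear_in_def)
  have sc: "A (a *\<^sub>R u) = a *\<^sub>R A u" if "u \<in> E" for a u using A that by (simp add: bounded_linear_in_def)
  have "(\<Sum>S\<in>\<A>. (-1) ^ card (I - S) *\<^sub>R A (y S)) = A (\<Sum>S\<in>\<A>. (-1) ^ card (I - S) *\<^sub>R y S)"
    if "finite \<A>" "\<A> \<subseteq> Pow I" for \<A>
    using that
  proof (induction \<A> rule: finite_induct)
    case empty
    then show ?case using sc [of 0 0] subspace_0 [OF E] by simp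
  next
    case (insert S \<A>)
    have "(\<Sum>S\<in>\<A>. (-1) ^ card (I - S) *\<^sub>R y S) \<in> E"
      using insert.prems y by (intro subspace_sum subspace_scale E) auto
    then show ?case using insert y by (simp add: add sc subspace_scale E)
  qed
  from this [of "Pow I"] show ?thesis using I by (simp add: cube_diff_def)
qed

lemma cube_bounded_bounded_linear_in:
  assumes f: "cube_bounded E f x k \<delta> C" and F: "subspace F" and A: "bounded_linear_in F A"
    and K: "0 \<le> K" "\<And>v. v \<in> F \<Longrightarrow> norm (A v) \<le> K * norm v" and E: "subspace E"
    and fF: "\<And>y. y \<in> E \<Longrightarrow> y \<in> ball x \<delta> \<Longrightarrow> f y \<in> F"
  shows "cube_bounded E (\<lambda>y. A (f y)) x k \<delta> (K * C)"
  unfolding cube_bounded_def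
proof (intro allI impI)
  fix I :: "nat set" and h y
  assume H: "finite I" "card I \<le> k" "y \<in> E" "h ` I \<subseteq> E" "\<forall>S\<subseteq>I. y + sum h S \<in> ball x \<delta>"
  have mem: "f (y + sum h S) \<in> F" if "S \<subseteq> I" for S
    using fF subspace_base_sum [OF E H(3,4) that] H(5) that by blast
  have "norm (cube_diff I (\<lambda>S. A (f (y + sum h S)))) = norm (A (cube_diff I (\<lambda>S. f (y + sum h S))))"
    using mem by (simp add: cube_diff_bounded_linear_in [OF A F _ H(1)])
  also have "\<dots> \<le> K * norm (cube_diff I (\<lambda>S. f (y + sum h S)))"
    using mem by (intro K(2) cube_diff_mem F)
  also have "\<dots> \<le> K * (C * (\<Prod>i\<in>I. norm (h i)))"
    using H by (intro mult_left_mono K(1) cube_boundedD [OF f]) auto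
  finally show "norm (cube_diff I (\<lambda>S. A (f (y + sum h S)))) \<le> K * C * (\<Prod>i\<in>I. norm (h i))" by (simp add: mult.assoc)
qed

text \<open>
A compact group that acts on an open subset \<open>V\<close> of the Banach space \<open>E\<close> by smooth maps and fixes \<open>x0\<close>. Continuity in
the group variable is required for each point separately.
\<close>

locale compact_smooth_action = compact_group G X
  for G :: "('g, 'm) monoid_scheme" (structure) and X :: "'g topology" +
  fixes E V :: "'e::banach set" and F :: "'g \<Rightarrow> 'e \<Rightarrow> 'e" and x0 :: 'e
  assumes E: "subspace E" "closed E"
    and V: "openin (top_of_set E) V"
    and F_mem: "\<And>g x. g \<in> carrier G \<Longrightarrow> x \<in> V \<Longrightarrow> F g x \<in> V"
    and F_one: "\<And>x. x \<in> V \<Longrightarrow> F \<one> x = x"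
    and F_mult: "\<And>g h x. g \<in> carrier G \<Longrightarrow> h \<in> carrier G \<Longrightarrow> x \<in> V \<Longrightarrow> F (g \<otimes> h) x = F g (F h x)"
    and F_cont: "\<And>x. x \<in> V \<Longrightarrow> continuous_map X euclidean (\<lambda>g. F g x)"
    and F_smooth: "\<And>g. g \<in> carrier G \<Longrightarrow> cube_smooth E V (F g)"
    and x0: "x0 \<in> V" and F_x0: "\<And>g. g \<in> carrier G \<Longrightarrow> F g x0 = x0"
begin

lemma VE: "V \<subseteq> E"
  using V openin_imp_subset by auto

lemma x0E: "x0 \<in> E"
  using x0 VE by auto

text \<open>
For each parallelepiped the inequality is a closed condition on \<open>g\<close>, since \<open>F g x\<close> depends continuously on \<open>g\<close>.
\<close>

lemma closedin_cube_bounded: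
  assumes \<delta>: "E \<inter> ball x \<delta> \<subseteq> V"
  shows "closedin X {g \<in> carrier G. cube_bounded E (F g) x k \<delta> C}"
proof -
  define Adm where "Adm = {(I :: nat set, h, y). finite I \<and> card I \<le> k \<and> y \<in> E \<and> h ` I \<subseteq> E \<and>
    (\<forall>S\<subseteq>I. y + sum h S \<in> ball x \<delta>)}"
  define P where "P = (\<lambda>(I :: nat set, h, y). {g \<in> topspace X. cube_diff I (\<lambda>S. F g (y + sum h S)) \<in> cball 0 (C * (\<Prod>i\<in>I. norm (h i)))})"
  have "closedin X (\<Inter> (insert (topspace X) (P ` Adm)))"
  proof (rule closedin_Inter)
    fix S assume "S \<in> insert (topspace X) (P ` Adm)"
    moreover have "closedin X (P p)" if p: "p \<in> Adm" for p
    proof -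
      obtain I h y where ihy: "p = (I, h, y)" by (cases p)
      have A: "finite I" "y \<in> E" "h ` I \<subseteq> E" "\<And>S. S \<subseteq> I \<Longrightarrow> y + sum h S \<in> ball x \<delta>" using p by (auto simp: ihy Adm_def)
      have "y + sum h S \<in> V" if "S \<subseteq> I" for S
        using subspace_base_sum [OF E(1) A(2,3) that] A(4) [OF that] \<delta> by blast
      then have "continuous_map X euclidean (\<lambda>g. cube_diff I (\<lambda>S. F g (y + sum h S)))"
        by (intro continuous_map_cube_diff A F_cont)
      from closedin_continuous_map_preimage [OF this, of "cball 0 (C * (\<Prod>i\<in>I. norm (h i)))"]
      show ?thesis by (simp add: P_def ihy)
    qed
    ultimately show "closedin X S" by auto
  qed simp
  moreover have "\<Inter> (insert (topspace X) (P ` Adm)) = {g \<in> carrier G. cube_bounded E (F g) x k \<delta> C}"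
  proof -
    have 1: "g \<in> \<Inter> (insert (topspace X) (P ` Adm)) \<longleftrightarrow> g \<in> carrier G \<and> (\<forall>p\<in>Adm. g \<in> P p)" for g
      by (simp add: topspace_eq)
    have 2: "(\<forall>p\<in>Adm. g \<in> P p) \<longleftrightarrow> cube_bounded E (F g) x k \<delta> C" if "g \<in> carrier G" for g
    proof
      assume L: "\<forall>p\<in>Adm. g \<in> P p"
      show "cube_bounded E (F g) x k \<delta> C"
        unfolding cube_bounded_def
      proof (intro allI impI)
        fix I :: "nat set" and h y
        assume A: "finite I" "card I \<le> k" "y \<in> E" "h ` I \<subseteq> E" "\<forall>S\<subseteq>I. y + sum h S \<in> ball x \<delta>"
        have "(I, h, y) \<in> Adm" using A by (simp only: Adm_def mem_Collect_eq split_conv)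
        then have "g \<in> P (I, h, y)" using L by blast
        then show "norm (cube_diff I (\<lambda>S. F g (y + sum h S))) \<le> C * (\<Prod>i\<in>I. norm (h i))"
          by (simp add: P_def)
      qed
    next
      assume f: "cube_bounded E (F g) x k \<delta> C"
      show "\<forall>p\<in>Adm. g \<in> P p"
      proof
        fix p assume p: "p \<in> Adm"
        obtain I h y where ihy: "p = (I, h, y)" by (cases p)
        have A: "finite I" "card I \<le> k" "y \<in> E" "h ` I \<subseteq> E" "\<And>S. S \<subseteq> I \<Longrightarrow> y + sum h S \<in> ball x \<delta>"
          using p by (auto simp: ihy Adm_def)
        show "g \<in> P p" using cube_boundedD [OF f A] that by (simp add: P_def ihy topspace_eq)
      qed
    qed
    show ?thesis
    proof (rule Set.set_eqI)
      fix g
      show "g \<in> \<Inter> (insert (topspace X) (P ` Adm)) \<longleftrightarrow> g \<in> {g \<in> carrier G. cube_bounded E (F g) x k \<delta> C}"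
        unfolding 1 mem_Collect_eq using 2 [of g] by (rule conj_cong [OF refl])
    qed
  qed
  ultimately show ?thesis by simp
qed

text \<open>
The group is the union of closed sets \<open>K N\<close> on which a bound holds uniformly. By the category theorem some \<open>K N\<close>
contains a neighbourhood of some \<open>o0\<close>. Near \<open>g1\<close> every \<open>h\<close> is the product of the fixed element \<open>g = g1 \<otimes> inv o0\<close>
and an element near \<open>o0\<close>, so \<open>F h\<close> is the composite of a map with uniform bounds and one fixed smooth map.
\<close>

lemma locally_uniform_cube_bounded:
  assumes x: "x \<in> V" and k: "1 \<le> k" and g1: "g1 \<in> carrier G"
  shows "\<exists>U. openin X U \<and> g1 \<in> U \<and> (\<exists>\<delta>>0. \<exists>C\<ge>0. \<forall>g\<in>U. cube_bounded E (F g) x k \<delta> C)"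
proof -
  obtain \<delta>0 where \<delta>0: "0 < \<delta>0" "E \<inter> ball x \<delta>0 \<subseteq> V" using openin_subspace_ball [OF V x] by blast
  define d where "d N = \<delta>0 / real (Suc N)" for N
  have d: "0 < d N" "d N \<le> \<delta>0" for N using \<delta>0 by (auto simp: d_def divide_simps)
  have dV: "E \<inter> ball x (d N) \<subseteq> V" for N using \<delta>0(2) subset_ball [OF d(2), of x N] by blast
  define K where "K N = {g \<in> carrier G. cube_bounded E (F g) x k (d N) (real N)}" for N
  have "\<exists>N. g \<in> K N" if g: "g \<in> carrier G" for g
  proof -
    obtain \<delta> C where dc: "0 < \<delta>" "0 \<le> C" "cube_bounded E (F g) x k \<delta> C" using F_smooth [OF g] x unfolding cube_smooth_def by blast
    obtain N1 where N1: "C \<le> real N1" using real_arch_simple by blast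
    obtain N2 where N2: "\<delta>0 / \<delta> \<le> real N2" using real_arch_simple by blast
    define N where "N = max N1 N2"
    have "\<delta>0 \<le> \<delta> * real (Suc N)"
    proof -
      have "\<delta>0 \<le> \<delta> * real N2" using N2 dc(1) by (simp add: divide_le_eq mult.commute)
      also have "\<dots> \<le> \<delta> * real (Suc N)" using dc(1) by (intro mult_left_mono) (auto simp: N_def)
      finally show ?thesis .
    qed
    then have "d N \<le> \<delta>" by (simp add: d_def divide_le_eq mult.commute)
    then have "cube_bounded E (F g) x k (d N) (real N)"
      using N1 by (intro cube_bounded_mono [OF dc(3)] subset_ball) (auto simp: N_def)
    then show ?thesis using g by (auto simp: K_def)
  qed
  then have cover: "\<Union>(range K) = topspace X" by (auto simp: K_def topspace_eq)
  have "\<exists>N. X interior_of (K N) \<noteq> {}"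
  proof (rule ccontr)
    assume "\<nexists>N. X interior_of (K N) \<noteq> {}"
    then have "X interior_of \<Union>(range K) = {}"
      using compact Hausdorff closedin_cube_bounded [OF dV]
      by (intro Baire_category_alt disjI2 conjI compact_imp_locally_compact_space compact_Hausdorff_imp_regular_space)
        (auto simp: K_def)
    then have "topspace X = {}" unfolding cover by (simp only: interior_of_topspace)
    then show False using one_closed by (simp add: topspace_eq)
  qed
  then obtain N O' o0 where O': "openin X O'" "o0 \<in> O'" "O' \<subseteq> K N"
    by (metis all_not_in_conv interior_of_subset openin_interior_of)
  have o0: "o0 \<in> carrier G" using O' by (auto simp: K_def)
  define g where "g = g1 \<otimes> inv o0"
  have g: "g \<in> carrier G" using g1 o0 by (simp add: g_def)
  have go: "inv g \<otimes> g1 = o0" using g1 o0 by (simp add: g_def inv_mult_group m_assoc)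
  define p where "p = F o0 x"
  have p: "p \<in> V" using F_mem o0 x by (simp add: p_def)
  obtain \<epsilon> D where e: "0 < \<epsilon>" "0 \<le> D" "cube_bounded E (F g) p (2 ^ k) \<epsilon> D"
    using F_smooth [OF g] p unfolding cube_smooth_def by metis
  obtain \<delta>' C' where c: "0 < \<delta>'" "\<delta>' \<le> d N" "0 \<le> C'"
    "\<And>f h. cube_bounded E f x k (d N) (real N) \<Longrightarrow> cube_bounded E h p (2 ^ k) \<epsilon> D \<Longrightarrow> dist p (f x) \<le> \<epsilon> / 2 \<Longrightarrow> x \<in> E \<Longrightarrow>
       (\<And>y. y \<in> E \<Longrightarrow> y \<in> ball x (d N) \<Longrightarrow> f y \<in> E) \<Longrightarrow> cube_bounded E (\<lambda>y. (h :: 'e \<Rightarrow> 'e) (f y)) x k \<delta>' C'"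
    using cube_bounded_compose [OF k _ e(2) d(1) [of N] e(1) E(1) E(1), of "real N"] by (metis of_nat_0_le_iff)
  (* For h in U the factor inv g * h of h satisfies the uniform bound, and it moves x into the region around p
     where F g is controlled. *)
  define U where "U = {h \<in> topspace X. inv g \<otimes> h \<in> O'} \<inter> {h \<in> topspace X. F (inv g \<otimes> h) x \<in> ball p (\<epsilon> / 2)}"
  have tr: "continuous_map X X (\<lambda>h. inv g \<otimes> h)" using g by (intro continuous_map_translations) simp
  have "openin X U"
    unfolding U_def
    using openin_continuous_map_preimage [OF tr O'(1)]
      openin_continuous_map_preimage [OF continuous_map_compose [OF tr F_cont [OF x], unfolded o_def], of "ball p (\<epsilon> / 2)"]
    by (intro openin_Int) auto
  moreover have "g1 \<in> U" using g1 go O' e by (auto simp: U_def topspace_eq p_def)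
  moreover have "cube_bounded E (F h) x k \<delta>' C'" if "h \<in> U" for h
  proof -
    have h: "h \<in> carrier G" "inv g \<otimes> h \<in> K N" "dist p (F (inv g \<otimes> h) x) \<le> \<epsilon> / 2"
      using that O'(3) by (auto simp: U_def topspace_eq)
    have ih: "inv g \<otimes> h \<in> carrier G" using g h by simp
    have "cube_bounded E (\<lambda>y. F g (F (inv g \<otimes> h) y)) x k \<delta>' C'"
    proof (rule c(4) [of "F (inv g \<otimes> h)" "F g", OF _ e(3) h(3)])
      show "cube_bounded E (F (inv g \<otimes> h)) x k (d N) (real N)" using h(2) by (simp add: K_def)
      show "F (inv g \<otimes> h) y \<in> E" if "y \<in> E" "y \<in> ball x (d N)" for y
        using F_mem [OF ih] dV that VE by blast
    qed (use x VE in blast)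
    then show ?thesis
    proof (rule cube_bounded_cong [OF _ E(1)])
      fix y assume "y \<in> E" "y \<in> ball x \<delta>'"
      then have y: "y \<in> V" using dV subset_ball [OF c(2), of x] by blast
      have "g \<otimes> (inv g \<otimes> h) = h" using g h by (simp add: m_assoc [symmetric])
      then show "F h y = F g (F (inv g \<otimes> h) y)" using F_mult [OF g ih y] by simp
    qed
  qed
  ultimately show ?thesis using c(1,3) by blast
qed

lemma uniform_cube_bounded:
  assumes x: "x \<in> V"
  shows "\<exists>\<delta>>0. \<exists>C\<ge>0. E \<inter> ball x \<delta> \<subseteq> V \<and> (\<forall>g\<in>carrier G. cube_bounded E (F g) x k \<delta> C)"
proof -
  define P where "P = (\<lambda>(\<delta>, C) g. 0 < \<delta> \<and> 0 \<le> C \<and> cube_bounded E (F g) x (max 1 k) \<delta> C)"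
  have "\<exists>p. \<forall>g\<in>topspace X. P p g"
  proof (rule compact_space_uniform [OF compact])
    show "\<exists>U. openin X U \<and> g \<in> U \<and> (\<exists>p. \<forall>y\<in>U. P p y)" if "g \<in> topspace X" for g
      using locally_uniform_cube_bounded [OF x, of "max 1 k" g] that by (fastforce simp: P_def topspace_eq)
    show "\<exists>r. \<forall>g\<in>topspace X. P p g \<or> P q g \<longrightarrow> P r g" for p q
    proof (cases "0 < fst p \<and> 0 \<le> snd p")
      case False
      then show ?thesis by (intro exI [of _ q]) (auto simp: P_def split: prod.splits)
    next
      case p: True
      show ?thesis
      proof (cases "0 < fst q \<and> 0 \<le> snd q")
        case False
        then show ?thesis by (intro exI [of _ p]) (auto simp: P_def split: prod.splits)
      next
        case True
        let ?r = "(min (fst p) (fst q), max (snd p) (snd q))"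
        have "cube_bounded E (F g) x (max 1 k) (fst ?r) (snd ?r)"
          if "cube_bounded E (F g) x (max 1 k) (fst p) (snd p) \<or> cube_bounded E (F g) x (max 1 k) (fst q) (snd q)" for g
          using that by (auto elim!: cube_bounded_mono)
        then show ?thesis using p True by (intro exI [of _ ?r]) (auto simp: P_def split: prod.splits)
      qed
    qed
  qed
  then obtain \<delta> C where dc: "\<And>g. g \<in> carrier G \<Longrightarrow> 0 < \<delta> \<and> 0 \<le> C \<and> cube_bounded E (F g) x (max 1 k) \<delta> C"
    by (auto simp: P_def topspace_eq)
  obtain \<delta>0 where \<delta>0: "0 < \<delta>0" "E \<inter> ball x \<delta>0 \<subseteq> V" using openin_subspace_ball [OF V x] by blast
  have "cube_bounded E (F g) x k (min \<delta> \<delta>0) C" if "g \<in> carrier G" for g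
    using dc [OF that] by (auto elim!: cube_bounded_mono)
  moreover have "E \<inter> ball x (min \<delta> \<delta>0) \<subseteq> V" using \<delta>0(2) by auto
  ultimately show ?thesis using dc [OF one_closed] \<delta>0(1) by (intro exI [of _ "min \<delta> \<delta>0"] conjI exI [of _ C]) auto
qed

text \<open>
The derivative of the action at the fixed point; it is a linear representation on \<open>E\<close>.
\<close>

definition A :: "'g \<Rightarrow> 'e \<Rightarrow> 'e" where
  "A g = dir_deriv (F g) x0"

lemma A_deriv: "g \<in> carrier G \<Longrightarrow> has_deriv_in E V (F g) (A g) x0"
  unfolding A_def by (intro cube_smooth_has_deriv_in F_smooth E V x0)

lemma A_mem: "g \<in> carrier G \<Longrightarrow> v \<in> E \<Longrightarrow> A g v \<in> E"
  using has_deriv_in_mem [OF A_deriv E(1) V x0 _ E] F_mem VE by blast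

lemma A_linear: "g \<in> carrier G \<Longrightarrow> bounded_linear_in E (A g)"
  using A_deriv by (rule has_deriv_in_linear(1))

lemma A_diff: "g \<in> carrier G \<Longrightarrow> u \<in> E \<Longrightarrow> v \<in> E \<Longrightarrow> A g (u - v) = A g u - A g v"
  using has_deriv_in_linear(2) [OF A_deriv, of g u "-v"] has_deriv_in_linear(3) [OF A_deriv, of g v "-1"]
  by (simp add: subspace_neg E)

lemma A_one: "v \<in> E \<Longrightarrow> A \<one> v = v"
proof (rule has_deriv_in_unique [OF A_deriv _ E(1) V x0])
  have "has_deriv_in E V (\<lambda>y. y) (\<lambda>v. v) x0"
    unfolding has_deriv_in_alt [OF x0E E(1)] by (auto simp: bounded_linear_in_def intro!: exI [of _ 1])
  then show "has_deriv_in E V (F \<one>) (\<lambda>v. v) x0" by (rule has_deriv_in_cong) (auto simp: F_one x0)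
qed auto

lemma A_mult:
  assumes g: "g \<in> carrier G" and h: "h \<in> carrier G" and v: "v \<in> E"
  shows "A (g \<otimes> h) v = A g (A h v)"
proof (rule has_deriv_in_unique [OF A_deriv _ E(1) V x0 v])
  have "has_deriv_in E V (\<lambda>y. F g (F h y)) (\<lambda>v. A g (A h v)) x0"
    using g h F_mem by (intro has_deriv_in_compose [OF A_deriv [OF h] _ E(1) V x0 E VE]) (auto simp: F_x0 A_deriv)
  then show "has_deriv_in E V (F (g \<otimes> h)) (\<lambda>v. A g (A h v)) x0"
    by (rule has_deriv_in_cong) (auto simp: F_mult g h x0)
qed (use g h in simp)

lemma A_bounds:
  obtains \<delta> K where "0 < \<delta>" "0 \<le> K" "E \<inter> ball x0 \<delta> \<subseteq> V"
    "\<And>g. g \<in> carrier G \<Longrightarrow> cube_bounded E (F g) x0 2 \<delta> K"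
    "\<And>g v. g \<in> carrier G \<Longrightarrow> v \<in> E \<Longrightarrow> norm (A g v) \<le> K * norm v"
    "\<And>g v. g \<in> carrier G \<Longrightarrow> v \<in> E \<Longrightarrow> norm v < \<delta> \<Longrightarrow> norm (F g (x0 + v) - x0 - A g v) \<le> K * norm v ^ 2"
proof -
  obtain \<delta> K where d: "0 < \<delta>" "0 \<le> K" "E \<inter> ball x0 \<delta> \<subseteq> V" "\<And>g. g \<in> carrier G \<Longrightarrow> cube_bounded E (F g) x0 2 \<delta> K"
    using uniform_cube_bounded [OF x0, of 2] by blast
  have b: "x0 \<in> ball x0 \<delta>" using d by simp
  show thesis
  proof (rule that [OF d])
    fix g v assume g: "g \<in> carrier G" and v: "v \<in> E"
    show "norm (A g v) \<le> K * norm v"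
      unfolding A_def by (rule norm_dir_deriv_le [OF d(4) [OF g] d(2) E(1) x0E b v])
    assume "norm v < \<delta>"
    then show "norm (F g (x0 + v) - x0 - A g v) \<le> K * norm v ^ 2"
      using dir_deriv_LIMSEQ(2) [OF d(4) [OF g] d(2) E(1) x0E b v] by (simp add: A_def F_x0 g dist_norm)
  qed
qed

text \<open>
By the uniform bound on second differences, the difference quotients of \<open>F g\<close> converge to \<open>A g v\<close> uniformly in \<open>g\<close>.
\<close>

lemma A_cont:
  assumes v: "v \<in> E"
  shows "continuous_map X euclidean (\<lambda>g. A g v)"
proof (rule continuous_map_uniform_approx)
  fix e :: real assume e: "0 < e"
  obtain \<delta> K where d: "0 < \<delta>" "0 \<le> K" "E \<inter> ball x0 \<delta> \<subseteq> V"
    "\<And>g v. g \<in> carrier G \<Longrightarrow> v \<in> E \<Longrightarrow> norm v < \<delta> \<Longrightarrow> norm (F g (x0 + v) - x0 - A g v) \<le> K * norm v ^ 2"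
    using A_bounds by metis
  have "(\<lambda>j. (1 / 2) ^ j * norm v) \<longlonglongrightarrow> 0 * norm v"
    by (intro tendsto_mult LIMSEQ_power_zero tendsto_const) auto
  then have "\<forall>\<^sub>F j in sequentially. (1 / 2) ^ j * norm v < \<delta>" using d by (intro order_tendstoD) auto
  moreover have "(\<lambda>j. K * norm v ^ 2 * (1 / 2) ^ j) \<longlonglongrightarrow> K * norm v ^ 2 * 0"
    by (intro tendsto_mult LIMSEQ_power_zero tendsto_const) auto
  then have "\<forall>\<^sub>F j in sequentially. K * norm v ^ 2 * (1 / 2) ^ j < e" using e by (intro order_tendstoD) auto
  ultimately obtain j where j: "(1 / 2) ^ j * norm v < \<delta>" "K * norm v ^ 2 * (1 / 2) ^ j < e"
    using eventually_conj eventually_happens trivial_limit_sequentially by blast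
  define w where "w = (1 / 2) ^ j *\<^sub>R v"
  have w: "w \<in> E" "norm w < \<delta>" using v j by (auto simp: w_def intro: subspace_scale E)
  then have "x0 + w \<in> E \<inter> ball x0 \<delta>" using x0E by (auto simp: dist_norm intro: subspace_add E)
  then have xw: "x0 + w \<in> V" using d(3) by blast
  define q where "q g = 2 ^ j *\<^sub>R (F g (x0 + w) - x0)" for g
  have "continuous_map X euclidean q"
    unfolding q_def by (intro continuous_map_scaleR_left continuous_map_diff F_cont xw) simp
  moreover have "dist (q g) (A g v) < e" if g: "g \<in> topspace X" for g
  proof -
    have g: "g \<in> carrier G" using g by (simp add: topspace_eq)
    have "v = 2 ^ j *\<^sub>R w" by (simp add: w_def power_divide)
    then have "A g v = 2 ^ j *\<^sub>R A g w" using has_deriv_in_linear(3) [OF A_deriv [OF g] w(1)] by simp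
    then have "dist (q g) (A g v) = 2 ^ j * norm (F g (x0 + w) - x0 - A g w)"
      by (simp add: q_def dist_norm flip: scaleR_diff_right)
    also have "\<dots> \<le> 2 ^ j * (K * norm w ^ 2)" using d(4) [OF g w] by (intro mult_left_mono) auto
    also have "\<dots> = K * norm v ^ 2 * (1 / 2) ^ j"
      by (simp add: w_def power_mult_distrib power2_eq_square power_divide)
    finally show ?thesis using j by simp
  qed
  ultimately show "\<exists>q. continuous_map X euclidean q \<and> (\<forall>g\<in>topspace X. dist (q g) (A g v) < e)" by blast
qed

text \<open>
The map \<open>F g\<close>, moved to the origin and corrected such that its derivative at \<open>x0\<close> becomes the identity.
\<close>

definition R :: "'g \<Rightarrow> 'e \<Rightarrow> 'e" where
  "R g x = A (inv g) (F g x - x0)"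

definition linearization :: "'e \<Rightarrow> 'e" where
  "linearization x = mean (\<lambda>g. R g x)"

lemma R_mem: "g \<in> carrier G \<Longrightarrow> x \<in> V \<Longrightarrow> R g x \<in> E"
  unfolding R_def using F_mem [of g x] VE x0E by (intro A_mem subspace_diff E) auto

lemma R_cont:
  assumes x: "x \<in> V"
  shows "continuous_map X euclidean (\<lambda>g. R g x)"
  unfolding continuous_map_euclidean_iff
proof (intro ballI allI impI)
  fix g1 and e :: real assume "g1 \<in> topspace X" and e: "0 < e"
  then have g1: "g1 \<in> carrier G" by (simp add: topspace_eq)
  obtain \<delta> K where K: "0 \<le> K" "\<And>g v. g \<in> carrier G \<Longrightarrow> v \<in> E \<Longrightarrow> norm (A g v) \<le> K * norm v"
    using A_bounds by metis
  have Fx: "F g x - x0 \<in> E" if "g \<in> carrier G" for g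
    using F_mem [OF that x] VE x0E by (intro subspace_diff E) auto
  define e1 where "e1 = e / (2 * (K + 1))"
  have e1: "0 < e1" using e K by (simp add: e1_def)
  obtain U1 where U1: "openin X U1" "g1 \<in> U1" "\<And>g. g \<in> U1 \<Longrightarrow> dist (F g x) (F g1 x) < e1"
    using continuous_map_euclideanE [OF F_cont [OF x] _ e1, of g1] g1 topspace_eq by blast
  have "continuous_map X euclidean (\<lambda>g. A (inv g) (F g1 x - x0))"
    using continuous_map_compose [OF cont_inv A_cont [OF Fx [OF g1]]] by (simp add: o_def)
  from continuous_map_euclideanE [OF this _ half_gt_zero [OF e], of g1]
  obtain U2 where U2: "openin X U2" "g1 \<in> U2"
    "\<And>g. g \<in> U2 \<Longrightarrow> dist (A (inv g) (F g1 x - x0)) (A (inv g1) (F g1 x - x0)) < e / 2"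
    using g1 topspace_eq by blast
  have "dist (R g x) (R g1 x) < e" if g: "g \<in> U1 \<inter> U2" for g
  proof -
    have gc: "g \<in> carrier G" using g U1(1) openin_subset topspace_eq by blast
    have "norm (A (inv g) (F g x - F g1 x)) \<le> K * norm (F g x - F g1 x)"
      using gc F_mem [OF gc x] F_mem [OF g1 x] VE by (intro K subspace_diff E) auto
    also have "\<dots> \<le> K * e1" using U1(3) [of g] g K by (intro mult_left_mono) (auto simp: dist_norm)
    also have "\<dots> \<le> (K + 1) * e1" using e1 by (intro mult_right_mono) auto
    also have "\<dots> = e / 2" 
    proof -
      have "K + 1 \<noteq> 0" using K(1) by simp
      then show ?thesis by (simp add: e1_def del: distrib_right_numeral distrib_left_numeral)
    qed
    finally have "norm (A (inv g) (F g x - F g1 x)) \<le> e / 2" .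
    moreover have "A (inv g) (F g x - F g1 x) = R g x - A (inv g) (F g1 x - x0)"
      using A_diff [of "inv g" "F g x - x0" "F g1 x - x0"] gc Fx [OF gc] Fx [OF g1] by (simp add: R_def)
    ultimately have "dist (R g x) (A (inv g) (F g1 x - x0)) \<le> e / 2" by (simp add: dist_norm)
    moreover have "dist (A (inv g) (F g1 x - x0)) (R g1 x) < e / 2" using U2(3) [of g] g by (simp add: R_def)
    ultimately show ?thesis using dist_triangle [of "R g x" "R g1 x" "A (inv g) (F g1 x - x0)"] by simp
  qed
  then show "\<exists>U. openin X U \<and> g1 \<in> U \<and> (\<forall>g\<in>U. dist (R g x) (R g1 x) < e)"
    using U1 U2 by (intro exI [of _ "U1 \<inter> U2"]) auto
qed

lemma linearization_mem: "x \<in> V \<Longrightarrow> linearization x \<in> E"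
  unfolding linearization_def by (intro mean_mem R_cont E R_mem)

text \<open>
Substitution of \<open>g \<otimes> h\<close> for \<open>g\<close> in the mean.
\<close>

lemma linearization_equivariant:
  assumes h: "h \<in> carrier G" and x: "x \<in> V"
  shows "linearization (F h x) = A h (linearization x)"
proof -
  have eq: "R g (F h x) = A h (R (g \<otimes> h) x)" if g: "g \<in> carrier G" for g
  proof -
    have gh: "g \<otimes> h \<in> carrier G" using g h by simp
    have m: "F (g \<otimes> h) x - x0 \<in> E" using F_mem [OF gh x] VE x0E by (intro subspace_diff E) auto
    have "h \<otimes> inv (g \<otimes> h) = inv g" using g h by (simp add: inv_mult_group m_assoc [symmetric])
    then have "A h (A (inv (g \<otimes> h)) (F (g \<otimes> h) x - x0)) = A (inv g) (F (g \<otimes> h) x - x0)"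
      using A_mult [OF h _ m, of "inv (g \<otimes> h)"] gh by simp
    then show ?thesis using F_mult [OF g h x] by (simp add: R_def)
  qed
  have u: "continuous_map X euclidean (\<lambda>g. A h (R g x))"
    by (rule mean_bounded_linear_in(1) [OF R_cont [OF x] E R_mem [OF _ x] A_linear [OF h]])
  have "linearization (F h x) = mean (\<lambda>g. A h (R (g \<otimes> h) x))"
    unfolding linearization_def by (rule mean_cong) (rule eq)
  also have "\<dots> = mean (\<lambda>g. A h (R g x))" by (rule mean_right_invariant [OF u h])
  also have "\<dots> = A h (linearization x)"
    unfolding linearization_def by (rule mean_bounded_linear_in(2) [OF R_cont [OF x] E R_mem [OF _ x] A_linear [OF h]])
  finally show ?thesis .
qed

lemma R_cube_bounded:
  assumes x: "x \<in> V"
  shows "\<exists>\<delta>>0. \<exists>C\<ge>0. E \<inter> ball x \<delta> \<subseteq> V \<and> (\<forall>g\<in>carrier G. cube_bounded E (R g) x k \<delta> C)"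
proof -
  obtain \<delta> C where d: "0 < \<delta>" "0 \<le> C" "E \<inter> ball x \<delta> \<subseteq> V" "\<And>g. g \<in> carrier G \<Longrightarrow> cube_bounded E (F g) x k \<delta> C"
    using uniform_cube_bounded [OF x, of k] by blast
  obtain K where K: "0 \<le> K" "\<And>g v. g \<in> carrier G \<Longrightarrow> v \<in> E \<Longrightarrow> norm (A g v) \<le> K * norm v"
    using A_bounds by metis
  have "cube_bounded E (R g) x k \<delta> (K * (C + norm x0))" if g: "g \<in> carrier G" for g
    unfolding R_def
  proof (rule cube_bounded_bounded_linear_in [OF cube_bounded_diff [OF d(4) [OF g] cube_bounded_const] E(1) A_linear K(1) _ E(1)])
    show "F g y - x0 \<in> E" if "y \<in> E" "y \<in> ball x \<delta>" for y
    proof -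
      have "y \<in> V" using that d(3) by blast
      then show ?thesis using F_mem [OF g, of y] VE x0E by (intro subspace_diff E) auto
    qed
  qed (use g K in auto)
  then show ?thesis using d K by (intro exI [of _ \<delta>] conjI exI [of _ "K * (C + norm x0)"]) auto
qed

lemma linearization_smooth: "cube_smooth E V linearization"
proof (rule cube_smoothI)
  fix x and k :: nat assume x: "x \<in> V"
  obtain \<delta> C where d: "0 < \<delta>" "0 \<le> C" "E \<inter> ball x \<delta> \<subseteq> V" "\<And>g. g \<in> carrier G \<Longrightarrow> cube_bounded E (R g) x k \<delta> C"
    using R_cube_bounded [OF x, of k] by blast
  have "cube_bounded E linearization x k \<delta> C"
    unfolding cube_bounded_def
  proof (intro allI impI)
    fix I :: "nat set" and h y
    assume H: "finite I" "card I \<le> k" "y \<in> E" "h ` I \<subseteq> E" "\<forall>S\<subseteq>I. y + sum h S \<in> ball x \<delta>"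
    have mem: "y + sum h S \<in> V" if "S \<subseteq> I" for S
      using subspace_base_sum [OF E(1) H(3,4) that] H(5) that d(3) by blast
    have c: "continuous_map X euclidean (\<lambda>g. R g (y + sum h S))" if "S \<subseteq> I" for S
      by (rule R_cont [OF mem [OF that]])
    have "cube_diff I (\<lambda>S. linearization (y + sum h S)) = mean (\<lambda>g. cube_diff I (\<lambda>S. R g (y + sum h S)))"
      unfolding linearization_def by (rule mean_cube_diff [OF H(1) c, symmetric])
    moreover have "norm (mean (\<lambda>g. cube_diff I (\<lambda>S. R g (y + sum h S))) - 0) \<le> C * (\<Prod>i\<in>I. norm (h i))"
    proof (rule norm_mean_le [OF continuous_map_cube_diff [OF H(1) c]])
      show "norm (cube_diff I (\<lambda>S. R g (y + sum h S)) - 0) \<le> C * (\<Prod>i\<in>I. norm (h i))" if "g \<in> carrier G" for g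
        using H cube_boundedD [OF d(4) [OF that], of I y h] by simp
    qed
    ultimately show "norm (cube_diff I (\<lambda>S. linearization (y + sum h S))) \<le> C * (\<Prod>i\<in>I. norm (h i))" by simp
  qed
  then show "\<exists>\<delta>>0. \<exists>C\<ge>0. cube_bounded E linearization x k \<delta> C" using d by blast
qed

text \<open>
Each \<open>R g\<close> has the identity as its derivative at \<open>x0\<close>, with second differences that are bounded uniformly in \<open>g\<close>. Therefore
the estimate holds for every \<open>R g\<close> with the same constant, and it is inherited by the mean.
\<close>

lemma linearization_near_identity:
  obtains \<rho> C where "0 < \<rho>" "0 \<le> C" "E \<inter> ball x0 \<rho> \<subseteq> V"
    "\<And>x y. x \<in> E \<inter> ball x0 \<rho> \<Longrightarrow> y \<in> E \<inter> ball x0 \<rho> \<Longrightarrow>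
      norm (linearization x - linearization y - (x - y)) \<le> C * (norm (y - x0) + norm (x - y)) * norm (x - y)"
proof -
  obtain \<delta>1 C where d: "0 < \<delta>1" "0 \<le> C" "E \<inter> ball x0 \<delta>1 \<subseteq> V" "\<And>g. g \<in> carrier G \<Longrightarrow> cube_bounded E (R g) x0 2 \<delta>1 C"
    using R_cube_bounded [OF x0, of 2] by blast
  obtain \<delta>2 K where K: "0 < \<delta>2" "0 \<le> K" "\<And>g v. g \<in> carrier G \<Longrightarrow> v \<in> E \<Longrightarrow> norm (A g v) \<le> K * norm v"
    "\<And>g v. g \<in> carrier G \<Longrightarrow> v \<in> E \<Longrightarrow> norm v < \<delta>2 \<Longrightarrow> norm (F g (x0 + v) - x0 - A g v) \<le> K * norm v ^ 2"
    using A_bounds by metis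
  define \<rho> where "\<rho> = min \<delta>1 \<delta>2 / 2"
  have \<rho>: "0 < \<rho>" "2 * \<rho> \<le> \<delta>1" "2 * \<rho> \<le> \<delta>2" using d K by (auto simp: \<rho>_def)
  have sub: "E \<inter> ball x0 \<rho> \<subseteq> V"
    using d(3) subset_ball [of \<rho> \<delta>1 x0] \<rho> by force
  define C' where "C' = max C (K * K)"
  show thesis
  proof (rule that [OF \<rho>(1) _ sub])
    show "0 \<le> C'" using d by (simp add: C'_def)
    fix x y assume x: "x \<in> E \<inter> ball x0 \<rho>" and y: "y \<in> E \<inter> ball x0 \<rho>"
    have xV: "x \<in> V" and yV: "y \<in> V" using x y sub by auto
    define u where "u = y - x0"
    define v where "v = x - y"
    have uv: "u \<in> E" "v \<in> E" using x y x0E by (auto simp: u_def v_def intro!: subspace_diff E)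
    have nu: "norm u < \<rho>" using y by (simp add: u_def dist_norm norm_minus_commute)
    have nx: "norm (x - x0) < \<rho>" using x by (simp add: dist_norm norm_minus_commute)
    have nv: "norm v < 2 * \<rho>"
      using norm_triangle_ineq4 [of "x - x0" "y - x0"] nx nu by (simp add: u_def v_def)
    have step: "norm ((R g x - R g y) - v) \<le> C' * (norm u + norm v) * norm v" if g: "g \<in> carrier G" for g
    proof -
      have v2: "norm v < \<delta>2" using nv \<rho> by simp
      have "x0 + v \<in> E \<inter> ball x0 \<delta>1" using nv \<rho> uv x0E by (auto simp: dist_norm intro: subspace_add E)
      then have xv: "x0 + v \<in> V" using d(3) by blast
      have Fm: "F g (x0 + v) - x0 \<in> E" using F_mem [OF g xv] VE x0E by (intro subspace_diff E) auto
      (* R g x - R g y is compared with its value R g (x0 + v) for y = x0 by a second difference, and the latter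
         with v by the remainder of the first derivative. *)
      have "norm (R g (x0 + u + v) - R g (x0 + u) - R g (x0 + v) + R g x0) \<le> C * norm u * norm v"
        using uv x0E nu nv nx \<rho> d(1) by (intro cube_bounded_second [OF d(4) [OF g]]) (auto simp: dist_norm u_def v_def norm_minus_commute)
      moreover have "x0 + u + v = x" "x0 + u = y" by (simp_all add: u_def v_def)
      moreover have "R g x0 = 0"
        using has_deriv_in_linear(3) [OF A_deriv [of "inv g"] subspace_0 [OF E(1)], of 0] g by (simp add: R_def F_x0)
      ultimately have 1: "norm (R g x - R g y - R g (x0 + v)) \<le> C' * norm u * norm v"
        using mult_right_mono [of C C' "norm u * norm v"] by (simp add: C'_def mult.assoc)
      have "A (inv g) (A g v) = v" using A_mult [of "inv g" g v] g uv A_one by simp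
      then have "R g (x0 + v) - v = A (inv g) (F g (x0 + v) - x0 - A g v)"
        using A_diff [OF inv_closed [OF g] Fm A_mem [OF g uv(2)]] by (simp add: R_def)
      also have "norm \<dots> \<le> K * norm (F g (x0 + v) - x0 - A g v)"
        by (rule K(3) [OF inv_closed [OF g] subspace_diff [OF E(1) Fm A_mem [OF g uv(2)]]])
      also have "\<dots> \<le> K * (K * norm v ^ 2)" by (intro mult_left_mono K g uv v2)
      also have "\<dots> \<le> C' * norm v * norm v"
        using mult_right_mono [of "K * K" C' "norm v * norm v"] by (simp add: C'_def power2_eq_square mult.assoc)
      finally have 2: "norm (R g (x0 + v) - v) \<le> C' * norm v * norm v" .
      have "(R g x - R g y) - v = (R g x - R g y - R g (x0 + v)) + (R g (x0 + v) - v)" by simp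
      then show ?thesis using norm_triangle_mono [OF 1 2] by (simp add: algebra_simps)
    qed
    have cx: "continuous_map X euclidean (\<lambda>g. R g x)" and cy: "continuous_map X euclidean (\<lambda>g. R g y)"
      by (intro R_cont xV yV)+
    have "mean (\<lambda>g. R g x + (-1) *\<^sub>R R g y) = linearization x + (-1) *\<^sub>R linearization y"
      unfolding linearization_def using cx cy by (subst mean_add) (auto simp only: mean_scaleR continuous_map_scaleR_left)
    then have "mean (\<lambda>g. R g x - R g y) = linearization x - linearization y" by simp
    moreover have "norm (mean (\<lambda>g. R g x - R g y) - v) \<le> C' * (norm u + norm v) * norm v"
      by (rule norm_mean_le [OF continuous_map_diff [OF cx cy] step])
    ultimately show "norm (linearization x - linearization y - (x - y)) \<le> C' * (norm (y - x0) + norm (x - y)) * norm (x - y)"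
      by (simp add: u_def v_def)
  qed
qed

lemma linearization_deriv: "has_deriv_in E V linearization (\<lambda>v. v) x0"
  unfolding has_deriv_in_alt [OF x0E E(1)]
proof (intro conjI allI impI)
  show "bounded_linear_in E (\<lambda>v. v)" by (auto simp: bounded_linear_in_def intro!: exI [of _ 1])
  fix e :: real assume e: "0 < e"
  obtain \<rho> C where r: "0 < \<rho>" "0 \<le> C" "\<And>x y. x \<in> E \<inter> ball x0 \<rho> \<Longrightarrow> y \<in> E \<inter> ball x0 \<rho> \<Longrightarrow>
      norm (linearization x - linearization y - (x - y)) \<le> C * (norm (y - x0) + norm (x - y)) * norm (x - y)"
    using linearization_near_identity by metis
  show "\<exists>d>0. \<forall>y\<in>V. norm (y - x0) < d \<longrightarrow> norm (linearization y - linearization x0 - (y - x0)) \<le> e * norm (y - x0)"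
  proof (intro exI [of _ "min \<rho> (e / (C + 1))"] conjI ballI impI)
    show "0 < min \<rho> (e / (C + 1))" using r e by auto
    fix y assume y: "y \<in> V" "norm (y - x0) < min \<rho> (e / (C + 1))"
    have "norm (linearization y - linearization x0 - (y - x0)) \<le> C * (norm (x0 - x0) + norm (y - x0)) * norm (y - x0)"
      using y VE x0E r by (intro r(3)) (auto simp: dist_norm norm_minus_commute)
    also have "\<dots> \<le> e * norm (y - x0)"
    proof (intro mult_right_mono)
      have "norm (y - x0) * (C + 1) < e" using y r(2) by (simp add: pos_less_divide_eq)
      then show "C * (norm (x0 - x0) + norm (y - x0)) \<le> e" by (simp add: algebra_simps) (smt (verit) norm_ge_zero)
    qed simp
    finally show "norm (linearization y - linearization x0 - (y - x0)) \<le> e * norm (y - x0)" .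
  qed
qed

definition fixed_space :: "'e set" where
  "fixed_space = {v \<in> E. \<forall>g\<in>carrier G. A g v = v}"

text \<open>
The mean of \<open>A g v\<close> over all \<open>g\<close> is a continuous projection onto the fixed vectors; its kernel is a complement.
\<close>

lemma complemented_fixed_space: "complemented_in E fixed_space"
proof -
  define P where "P v = mean (\<lambda>g. A g v)" for v
  obtain K where K: "0 \<le> K" "\<And>g v. g \<in> carrier G \<Longrightarrow> v \<in> E \<Longrightarrow> norm (A g v) \<le> K * norm v"
    using A_bounds by metis
  have PE: "P v \<in> E" if "v \<in> E" for v unfolding P_def using that by (intro mean_mem A_cont E A_mem)
  have add: "P (u + v) = P u + P v" if "u \<in> E" "v \<in> E" for u v
  proof -
    have "P (u + v) = mean (\<lambda>g. A g u + A g v)"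
      unfolding P_def using that has_deriv_in_linear(2) [OF A_deriv] by (intro mean_cong) blast
    also have "\<dots> = P u + P v" unfolding P_def using that by (intro mean_add A_cont)
    finally show ?thesis .
  qed
  have scale: "P (a *\<^sub>R v) = a *\<^sub>R P v" if "v \<in> E" for a v
  proof -
    have "P (a *\<^sub>R v) = mean (\<lambda>g. a *\<^sub>R A g v)"
      unfolding P_def using that has_deriv_in_linear(3) [OF A_deriv] by (intro mean_cong) blast
    also have "\<dots> = a *\<^sub>R P v" unfolding P_def using that by (intro mean_scaleR A_cont)
    finally show ?thesis .
  qed
  have bd: "norm (P v) \<le> K * norm v" if "v \<in> E" for v
    using norm_mean_le [OF A_cont [OF that], of 0 "K * norm v"] K that by (simp add: P_def)
  have diff: "P (u - v) = P u - P v" if "u \<in> E" "v \<in> E" for u v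
    using add [OF that(1) subspace_neg [OF E(1) that(2)]] scale [OF that(2), of "-1"] by simp
  have fixed: "P v \<in> fixed_space" if v: "v \<in> E" for v
    unfolding fixed_space_def
  proof (intro CollectI conjI ballI PE v)
    fix h assume h: "h \<in> carrier G"
    have "A h (P v) = mean (\<lambda>g. A h (A g v))"
      unfolding P_def by (rule mean_bounded_linear_in(2) [OF A_cont [OF v] E A_mem [OF _ v] A_linear [OF h], symmetric])
    also have "\<dots> = mean (\<lambda>g. A (h \<otimes> g) v)" by (intro mean_cong) (simp add: A_mult h v)
    also have "\<dots> = P v" unfolding P_def by (rule mean_left_invariant [OF A_cont [OF v] h])
    finally show "A h (P v) = P v" .
  qed
  have id: "P v = v" if "v \<in> fixed_space" for v
  proof -
    have "P v = mean (\<lambda>g. v)" unfolding P_def using that by (intro mean_cong) (auto simp: fixed_space_def)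
    then show ?thesis by simp
  qed
  have fsE: "fixed_space \<subseteq> E" by (auto simp: fixed_space_def)
  have P_cont: "continuous_on E P"
    unfolding continuous_on_iff
  proof (intro ballI allI impI)
    fix x and e :: real assume x: "x \<in> E" and e: "0 < e"
    have "dist (P y) (P x) < e" if "y \<in> E" "dist y x < e / (K + 1)" for y
    proof -
      have "norm (P (y - x)) \<le> K * norm (y - x)" using that x by (intro bd subspace_diff E)
      moreover have "norm (y - x) * (K + 1) < e" using that K(1) by (simp add: dist_norm pos_less_divide_eq)
      ultimately show ?thesis using diff that x by (simp add: dist_norm algebra_simps) (smt (verit) norm_ge_zero)
    qed
    then show "\<exists>d>0. \<forall>y\<in>E. dist y x < d \<longrightarrow> dist (P y) (P x) < e"
      using e K(1) by (intro exI [of _ "e / (K + 1)"]) auto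
  qed
  have eq_fix: "fixed_space = {v \<in> E. P v - v = 0}" using id fixed fsE by force
  have sub1: "subspace fixed_space"
    unfolding eq_fix subspace_def using add scale scale [OF subspace_0 [OF E(1)], of 0]
    by (auto simp: subspace_0 subspace_add subspace_scale E)
  have sub2: "subspace {v \<in> E. P v = 0}"
    unfolding subspace_def using add scale scale [OF subspace_0 [OF E(1)], of 0]
    by (auto simp: subspace_0 subspace_add subspace_scale E)
  have cl1: "closed fixed_space"
    unfolding eq_fix using E(2) P_cont by (intro continuous_closed_preimage_constant continuous_on_diff continuous_on_id)
  have cl2: "closed {v \<in> E. P v = 0}"
    using E(2) P_cont by (intro continuous_closed_preimage_constant)
  have int: "fixed_space \<inter> {v \<in> E. P v = 0} = {0}"
    using id subspace_0 [OF sub1] subspace_0 [OF sub2] by force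
  have "{x + y |x y. x \<in> fixed_space \<and> y \<in> {v \<in> E. P v = 0}} = E" (is "?L = E")
  proof
    show "?L \<subseteq> E" using fsE by (auto intro: subspace_add E)
    show "E \<subseteq> ?L"
    proof
      fix v assume v: "v \<in> E"
      have "v - P v \<in> {v \<in> E. P v = 0}" using v PE diff id [OF fixed [OF v]] by (auto intro: subspace_diff E)
      then show "v \<in> ?L" using fixed [OF v] by (intro CollectI exI [of _ "P v"] exI [of _ "v - P v"]) auto
    qed
  qed
  then show ?thesis
    unfolding complemented_in_def using sub1 sub2 cl1 cl2 int fsE by (intro conjI exI [of _ "{v \<in> E. P v = 0}"]) auto
qed

text \<open>
If \<open>linearization x\<close> is a fixed vector then, by equivariance, \<open>F g x\<close> and \<open>x\<close> have the same image. Injectivity yields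
\<open>F g x = x\<close> as soon as \<open>F g x\<close> lies in the ball of injectivity of radius \<open>\<rho>\<close>, and the radius \<open>r\<close> is so small
that this is the case for all \<open>g\<close>.
\<close>

lemma linearization_chart:
  obtains r where "0 < r" "E \<inter> ball x0 r \<subseteq> V"
    "openin (top_of_set E) (linearization ` (E \<inter> ball x0 r))"
    "\<And>x y. x \<in> E \<inter> ball x0 r \<Longrightarrow> y \<in> E \<inter> ball x0 r \<Longrightarrow> norm (x - y) \<le> 2 * norm (linearization x - linearization y)"
    "\<And>x. x \<in> E \<inter> ball x0 r \<Longrightarrow> (\<forall>g\<in>carrier G. F g x = x) \<longleftrightarrow> linearization x \<in> fixed_space"
proof -
  obtain \<rho>0 C where r0: "0 < \<rho>0" "0 \<le> C" "E \<inter> ball x0 \<rho>0 \<subseteq> V" "\<And>x y. x \<in> E \<inter> ball x0 \<rho>0 \<Longrightarrow> y \<in> E \<inter> ball x0 \<rho>0 \<Longrightarrow>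
      norm (linearization x - linearization y - (x - y)) \<le> C * (norm (y - x0) + norm (x - y)) * norm (x - y)"
    using linearization_near_identity by metis
  define \<rho> where "\<rho> = min \<rho>0 (1 / (6 * (C + 1)))"
  have \<rho>: "0 < \<rho>" "\<rho> \<le> \<rho>0" using r0 by (auto simp: \<rho>_def)
  have "\<rho> \<le> 1 / (6 * (C + 1))" by (simp add: \<rho>_def)
  then have "\<rho> * (6 * (C + 1)) \<le> 1" using r0(2) by (simp add: pos_le_divide_eq)
  then have C\<rho>: "C * (3 * \<rho>) \<le> 1 / 2" using \<rho>(1) by (simp add: algebra_simps)
  have sub: "E \<inter> ball x0 \<rho> \<subseteq> E \<inter> ball x0 \<rho>0" using subset_ball [OF \<rho>(2)] by auto
  have near: "norm (linearization x - linearization y - (x - y)) \<le> 1 / 2 * norm (x - y)"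
    if xy: "x \<in> E \<inter> ball x0 \<rho>" "y \<in> E \<inter> ball x0 \<rho>" for x y
  proof -
    have "norm (y - x0) < \<rho>" "norm (x - x0) < \<rho>" using xy by (auto simp: dist_norm norm_minus_commute)
    then have "norm (y - x0) + norm (x - y) \<le> 3 * \<rho>"
      using norm_triangle_ineq4 [of "x - x0" "y - x0"] by simp
    then have "C * (norm (y - x0) + norm (x - y)) \<le> 1 / 2" using mult_left_mono [OF _ r0(2)] C\<rho> order_trans by blast
    then have "C * (norm (y - x0) + norm (x - y)) * norm (x - y) \<le> 1 / 2 * norm (x - y)" by (intro mult_right_mono) auto
    then show ?thesis using r0(4) [of x y] xy sub by (meson in_mono order_trans)
  qed
  have lE: "linearization x \<in> E" if "x \<in> E \<inter> ball x0 \<rho>" for x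
    using that sub r0(3) by (intro linearization_mem) blast
  obtain \<delta> K where K: "0 < \<delta>" "0 \<le> K" "\<And>g. g \<in> carrier G \<Longrightarrow> cube_bounded E (F g) x0 2 \<delta> K"
    using A_bounds by metis
  define r where "r = min (min \<rho> \<delta>) (\<rho> / (K + 1))"
  have r: "0 < r" "r \<le> \<rho>" "r \<le> \<delta>" using \<rho> K by (auto simp: r_def)
  have "r \<le> \<rho> / (K + 1)" by (simp add: r_def)
  then have rK: "r * (K + 1) \<le> \<rho>" using K(2) by (simp add: pos_le_divide_eq)
  have subr: "E \<inter> ball x0 r \<subseteq> E \<inter> ball x0 \<rho>" using subset_ball [OF r(2)] by auto
  have rV: "E \<inter> ball x0 r \<subseteq> V" using subr sub r0(3) by blast
  have ni1: "openin (top_of_set E) (linearization ` (E \<inter> ball x0 r))"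
    by (rule perturbed_identity(1) [OF E r(2)]) (blast intro: lE near)+
  have ni2: "norm (x - y) \<le> 2 * norm (linearization x - linearization y)"
    if "x \<in> E \<inter> ball x0 \<rho>" "y \<in> E \<inter> ball x0 \<rho>" for x y
    by (rule perturbed_identity(2) [OF E r(2) _ _ that]) (blast intro: lE near)+
  show thesis
  proof (rule that [OF r(1) rV ni1])
    show "norm (x - y) \<le> 2 * norm (linearization x - linearization y)" if "x \<in> E \<inter> ball x0 r" "y \<in> E \<inter> ball x0 r" for x y
      using that subr by (intro ni2) auto
    fix x assume x: "x \<in> E \<inter> ball x0 r"
    have xV: "x \<in> V" using x rV by blast
    show "(\<forall>g\<in>carrier G. F g x = x) \<longleftrightarrow> linearization x \<in> fixed_space"
    proof
      assume "\<forall>g\<in>carrier G. F g x = x"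
      then show "linearization x \<in> fixed_space"
        unfolding fixed_space_def using linearization_mem [OF xV] linearization_equivariant [OF _ xV] by auto
    next
      assume l: "linearization x \<in> fixed_space"
      show "\<forall>g\<in>carrier G. F g x = x"
      proof
        fix g assume g: "g \<in> carrier G"
        have eq: "linearization (F g x) = linearization x"
          using l g linearization_equivariant [OF g xV] by (auto simp: fixed_space_def)
        have mem: "F g x \<in> E \<inter> ball x0 \<rho>"
        proof -
          have "norm (F g x - F g x0) \<le> K * norm (x - x0)"
            using x r x0E K(1) by (intro cube_bounded_Lipschitz [OF K(3) [OF g] _ E(1)]) auto
          also have "\<dots> \<le> (K + 1) * norm (x - x0)" by (intro mult_right_mono) auto
          also have "\<dots> < (K + 1) * r" using x K by (intro mult_strict_left_mono) (auto simp: dist_norm norm_minus_commute)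
          finally have "norm (F g x - x0) < \<rho>" using rK F_x0 [OF g] by (simp add: mult.commute)
          then show ?thesis using F_mem [OF g xV] VE by (auto simp: dist_norm norm_minus_commute)
        qed
        have "norm (F g x - x) \<le> 2 * norm (linearization (F g x) - linearization x)"
          by (rule ni2 [OF mem subsetD [OF subr x]])
        then show "F g x = x" by (simp add: eq)
      qed
    qed
  qed
qed

end

section \<open>Charts, transition derivatives and tangent spaces\<close>

lemma banach_chartD:
  assumes "banach_chart X c"
  shows "openin X (chart_dom c)" "subspace (chart_space c)" "closed (chart_space c)"
    "openin (top_of_set (chart_space c)) (chart_map c ` chart_dom c)"
    "homeomorphic_map (subtopology X (chart_dom c)) (top_of_set (chart_map c ` chart_dom c)) (chart_map c)"
  using assms unfolding banach_chart_def by auto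

lemma chart_dom_subset: "banach_chart X c \<Longrightarrow> chart_dom c \<subseteq> topspace X"
  using banach_chartD(1) openin_subset by blast

lemma chart_inj: "banach_chart X c \<Longrightarrow> inj_on (chart_map c) (chart_dom c)"
  using homeomorphic_imp_injective_map [OF banach_chartD(5), of X c] chart_dom_subset [of X c] by (simp add: Int_absorb1)

lemma chart_map_mem: "banach_chart X c \<Longrightarrow> p \<in> chart_dom c \<Longrightarrow> chart_map c p \<in> chart_space c"
  using banach_chartD(4) openin_imp_subset by blast

lemma chart_inv_map: "inj_on (chart_map c) (chart_dom c) \<Longrightarrow> p \<in> chart_dom c \<Longrightarrow> chart_inv c (chart_map c p) = p"
  by (simp add: chart_inv_def)

lemma chart_openin_image:
  assumes c: "banach_chart X c" and W: "openin X W" "W \<subseteq> chart_dom c"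
  shows "openin (top_of_set (chart_space c)) (chart_map c ` W)"
proof -
  have "openin (subtopology X (chart_dom c)) W"
    using W by (simp add: openin_open_subtopology [OF banach_chartD(1) [OF c]])
  then have "openin (top_of_set (chart_map c ` chart_dom c)) (chart_map c ` W)"
    using homeomorphic_imp_open_map [OF banach_chartD(5) [OF c]] by (simp add: open_map_def)
  then show ?thesis using banach_chartD(4) [OF c] by (rule openin_trans)
qed

lemma chart_continuous:
  assumes c: "banach_chart X c"
  shows "continuous_map (subtopology X (chart_dom c)) euclidean (chart_map c)"
  using homeomorphic_imp_continuous_map [OF banach_chartD(5) [OF c]] by (simp add: continuous_map_in_subtopology)

lemma chart_openin_preimage:
  assumes c: "banach_chart X c" and U: "openin (top_of_set (chart_space c)) U"
  shows "openin X {p \<in> chart_dom c. chart_map c p \<in> U}"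
proof -
  obtain T where T: "open T" "U = chart_space c \<inter> T" using U openin_open by metis
  have "openin (subtopology X (chart_dom c)) {p \<in> topspace (subtopology X (chart_dom c)). chart_map c p \<in> T}"
    using openin_continuous_map_preimage [OF chart_continuous [OF c]] T by simp
  also have "{p \<in> topspace (subtopology X (chart_dom c)). chart_map c p \<in> T} = {p \<in> chart_dom c. chart_map c p \<in> U}"
    using chart_dom_subset [OF c] chart_map_mem [OF c] T by auto
  finally show ?thesis by (simp add: openin_open_subtopology [OF banach_chartD(1) [OF c]])
qed

lemma local_dom_openin:
  assumes c: "banach_chart X c" and d: "banach_chart Y d" and f: "continuous_map X Y f"
  shows "openin (top_of_set (chart_space c)) (local_dom c d f)"
  unfolding local_dom_def
  using openin_continuous_map_preimage_gen [OF f banach_chartD(1) [OF c] banach_chartD(1) [OF d]]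
  by (rule chart_openin_image [OF c]) auto

lemma local_rep_apply:
  assumes "inj_on (chart_map c) (chart_dom c)" "p \<in> chart_dom c"
  shows "local_rep c d f (chart_map c p) = chart_map d (f p)"
  using assms by (simp add: local_rep_def chart_inv_map)

definition deriv_at ::
  "('q, 'e::real_normed_vector) chart \<Rightarrow> ('p, 'f::real_normed_vector) chart \<Rightarrow> ('q \<Rightarrow> 'p) \<Rightarrow> 'q \<Rightarrow> ('e \<Rightarrow> 'f) \<Rightarrow> bool" where
  "deriv_at c d f q A \<longleftrightarrow> has_deriv_in (chart_space c) (local_dom c d f) (local_rep c d f) A (chart_map c q)"

lemma has_deriv_in_local:
  assumes f: "has_deriv_in E U f A x" and E: "subspace E" and U: "openin (top_of_set E) U" "x \<in> U"
    and U': "U' \<subseteq> E"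
  shows "has_deriv_in E U' f A x"
proof -
  have x: "x \<in> E" using U openin_imp_subset by blast
  obtain r where r: "0 < r" "E \<inter> ball x r \<subseteq> U" using openin_subspace_ball [OF U] by blast
  show ?thesis
    unfolding has_deriv_in_alt [OF x E]
  proof (intro conjI allI impI)
    show "bounded_linear_in E A" by (rule has_deriv_in_linear(1) [OF f])
    fix e :: real assume "0 < e"
    then obtain d where d: "d > 0" "\<And>y. y \<in> U \<Longrightarrow> norm (y - x) < d \<Longrightarrow> norm (f y - f x - A (y - x)) \<le> e * norm (y - x)"
      using f unfolding has_deriv_in_alt [OF x E] by blast
    have "norm (f y - f x - A (y - x)) \<le> e * norm (y - x)" if "y \<in> U'" "norm (y - x) < min d r" for y
    proof -
      have "y \<in> E \<inter> ball x r" using that U' by (auto simp: dist_norm norm_minus_commute)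
      then show ?thesis using d(2) [of y] r that by auto
    qed
    then show "\<exists>d>0. \<forall>y\<in>U'. norm (y - x) < d \<longrightarrow> norm (f y - f x - A (y - x)) \<le> e * norm (y - x)"
      using d r by (intro exI [of _ "min d r"]) auto
  qed
qed

lemma deriv_at_compose:
  assumes c: "banach_chart X c" and d: "banach_chart Y d" and e: "banach_chart Z e"
    and f: "continuous_map X Y f" and g: "continuous_map Y Z g"
    and q: "q \<in> chart_dom c" "f q \<in> chart_dom d" "g (f q) \<in> chart_dom e"
    and A: "deriv_at c d f q A" and B: "deriv_at d e g (f q) B"
  shows "deriv_at c e (\<lambda>p. g (f p)) q (\<lambda>v. B (A v))"
proof -
  define W where "W = {p \<in> {p \<in> chart_dom c. f p \<in> chart_dom d}. g (f p) \<in> chart_dom e}"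
  have gf: "continuous_map X Z (\<lambda>p. g (f p))" using continuous_map_compose [OF f g] by (simp add: o_def)
  have "openin X W"
    unfolding W_def
    by (intro openin_continuous_map_preimage_gen [OF gf] openin_continuous_map_preimage_gen [OF f] banach_chartD(1) [OF c] banach_chartD(1) [OF d] banach_chartD(1) [OF e])
  then have U: "openin (top_of_set (chart_space c)) (chart_map c ` W)"
    by (rule chart_openin_image [OF c]) (auto simp: W_def)
  have qW: "chart_map c q \<in> chart_map c ` W" using q by (auto simp: W_def)
  have sub: "chart_map c ` W \<subseteq> local_dom c d f" by (auto simp: W_def local_dom_def)
  have fq: "local_rep c d f (chart_map c q) = chart_map d (f q)" by (rule local_rep_apply [OF chart_inj [OF c] q(1)])
  have "has_deriv_in (chart_space c) (chart_map c ` W) (\<lambda>y. local_rep d e g (local_rep c d f y)) (\<lambda>v. B (A v)) (chart_map c q)"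
  proof (rule has_deriv_in_compose [where f = "local_rep c d f" and g = "local_rep d e g" and F = "chart_space d"])
    show "has_deriv_in (chart_space c) (chart_map c ` W) (local_rep c d f) A (chart_map c q)"
      by (rule has_deriv_in_mono [OF A [unfolded deriv_at_def] subset_refl sub])
    show "has_deriv_in (chart_space d) (local_dom d e g) (local_rep d e g) B (local_rep c d f (chart_map c q))"
      using B unfolding deriv_at_def fq .
    show "local_dom d e g \<subseteq> chart_space d" using chart_map_mem [OF d] by (auto simp: local_dom_def)
    show "local_rep c d f ` chart_map c ` W \<subseteq> local_dom d e g"
      by (auto simp: W_def local_dom_def local_rep_apply [OF chart_inj [OF c]])
  qed (use banach_chartD [OF c] banach_chartD [OF d] U qW in auto)
  then have "has_deriv_in (chart_space c) (chart_map c ` W) (local_rep c e (\<lambda>p. g (f p))) (\<lambda>v. B (A v)) (chart_map c q)"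
  proof (rule has_deriv_in_cong [OF _ _ qW])
    fix y assume "y \<in> chart_map c ` W"
    then obtain p where p: "p \<in> W" "y = chart_map c p" by auto
    then show "local_rep c e (\<lambda>p. g (f p)) y = local_rep d e g (local_rep c d f y)"
      by (auto simp: W_def local_rep_apply [OF chart_inj [OF c]] local_rep_apply [OF chart_inj [OF d]])
  qed
  then show ?thesis
    unfolding deriv_at_def
    by (rule has_deriv_in_local [OF _ banach_chartD(2) [OF c] U qW])
      (use chart_map_mem [OF c] in \<open>auto simp: local_dom_def\<close>)
qed

lemma deriv_at_mem:
  assumes c: "banach_chart X c" and d: "banach_chart Y d" and f: "continuous_map X Y f"
    and q: "q \<in> chart_dom c" "f q \<in> chart_dom d"
    and A: "deriv_at c d f q A" and v: "v \<in> chart_space c"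
  shows "A v \<in> chart_space d"
  using A unfolding deriv_at_def
proof (rule has_deriv_in_mem)
  show "local_rep c d f ` local_dom c d f \<subseteq> chart_space d"
    using chart_map_mem [OF d] by (auto simp: local_dom_def local_rep_apply [OF chart_inj [OF c]])
  show "chart_map c q \<in> local_dom c d f" using q by (auto simp: local_dom_def)
qed (use banach_chartD [OF c] banach_chartD [OF d] v local_dom_openin [OF c d f] in auto)

lemma deriv_in_deriv_at:
  assumes c: "banach_chart X c" and d: "banach_chart Y d" and f: "continuous_map X Y f"
    and q: "q \<in> chart_dom c" "f q \<in> chart_dom d"
    and A: "deriv_at c d f q A" and v: "v \<in> chart_space c"
  shows "deriv_in (chart_space c) (local_dom c d f) (local_rep c d f) (chart_map c q) v = A v"
  using A unfolding deriv_at_def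
  by (rule deriv_in_eq) (use banach_chartD [OF c] v local_dom_openin [OF c d f] q in \<open>auto simp: local_dom_def\<close>)

lemma deriv_at_id:
  assumes c: "banach_chart X c" and q: "q \<in> chart_dom c"
  shows "deriv_at c c (\<lambda>x. x) q (\<lambda>v. v)"
proof -
  have x: "chart_map c q \<in> chart_space c" by (rule chart_map_mem [OF c q])
  have "has_deriv_in (chart_space c) (local_dom c c (\<lambda>x. x)) (\<lambda>y. y) (\<lambda>v. v) (chart_map c q)"
    unfolding has_deriv_in_alt [OF x banach_chartD(2) [OF c]] by (auto simp: bounded_linear_in_def intro!: exI [of _ 1])
  then show ?thesis
    unfolding deriv_at_def
    by (rule has_deriv_in_cong) (use q in \<open>auto simp: local_dom_def local_rep_apply [OF chart_inj [OF c]]\<close>)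
qed

lemma Ck_on_deriv_at:
  fixes c :: "('q, 'e::banach) chart" and d :: "('p, 'f::banach) chart"
  assumes c: "banach_chart X c" and d: "banach_chart Y d" and f: "continuous_map X Y f"
    and q: "q \<in> chart_dom c" "f q \<in> chart_dom d"
    and Ck: "Ck_on \<infinity> (chart_space c) (local_dom c d f) (local_rep c d f)"
  shows "deriv_at c d f q (dir_deriv (local_rep c d f) (chart_map c q))"
  unfolding deriv_at_def
  using q by (intro cube_smooth_has_deriv_in Ck_imp_cube_smooth Ck banach_chartD(2) [OF c] local_dom_openin [OF c d f]) (auto simp: local_dom_def)

lemma tangent_spaceD:
  assumes v: "v \<in> tangent_space N q"
  shows "c \<in> charts_at N q \<Longrightarrow> v c \<in> chart_space c"
    "c \<in> charts_at N q \<Longrightarrow> d \<in> charts_at N q \<Longrightarrow>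
       v d = deriv_in (chart_space c) (local_dom c d (\<lambda>x. x)) (local_rep c d (\<lambda>x. x)) (chart_map c q) (v c)"
    "c \<notin> charts_at N q \<Longrightarrow> v c = 0"
proof -
  note * = v [unfolded tangent_space_def mem_Collect_eq]
  show "c \<in> charts_at N q \<Longrightarrow> v c \<in> chart_space c"
    by (rule bspec [OF conjunct1 [OF *]])
  show "c \<in> charts_at N q \<Longrightarrow> d \<in> charts_at N q \<Longrightarrow>
       v d = deriv_in (chart_space c) (local_dom c d (\<lambda>x. x)) (local_rep c d (\<lambda>x. x)) (chart_map c q) (v c)"
    by (rule bspec [OF bspec [OF conjunct1 [OF conjunct2 [OF *]]]])
  show "c \<notin> charts_at N q \<Longrightarrow> v c = 0"
    using conjunct2 [OF conjunct2 [OF *]] by (elim allE impE)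
qed

locale banach_manifold =
  fixes M :: "('q, 'e::banach) manifold"
  assumes smooth: "smooth_manifold M"
begin

abbreviation "T \<equiv> mtop M"

lemma atlas_admissible: "c \<in> atlas M \<Longrightarrow> admissible_chart M c"
  using smooth by (auto simp: smooth_manifold_def admissible_chart_def)

lemma admissible_banach: "admissible_chart M c \<Longrightarrow> banach_chart T c"
  by (simp add: admissible_chart_def)

lemma atlas_banach: "c \<in> atlas M \<Longrightarrow> banach_chart T c"
  by (simp add: atlas_admissible admissible_banach)

lemma chart_at_exists: "q \<in> points M \<Longrightarrow> \<exists>c. c \<in> charts_at M q"
  using smooth by (auto simp: smooth_manifold_def charts_at_def)

lemma charts_atD:
  assumes "c \<in> charts_at M q"
  shows "c \<in> atlas M" "q \<in> chart_dom c" "admissible_chart M c" "banach_chart T c"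
  using assms by (auto simp: charts_at_def atlas_admissible atlas_banach)

lemma id_cont: "continuous_map T T (\<lambda>x. x)"
  by simp

definition trans :: "('q, 'e) chart \<Rightarrow> ('q, 'e) chart \<Rightarrow> 'q \<Rightarrow> 'e \<Rightarrow> 'e" where
  "trans c d q = deriv_in (chart_space c) (local_dom c d (\<lambda>x. x)) (local_rep c d (\<lambda>x. x)) (chart_map c q)"

text \<open>
Charts of the maximal atlas are by definition compatible with those of the given atlas only; two of them are compared
through a chart of the atlas.
\<close>

lemma transition_deriv_exists:
  assumes c: "admissible_chart M c" "q \<in> chart_dom c" and d: "admissible_chart M d" "q \<in> chart_dom d"
  shows "\<exists>A. deriv_at c d (\<lambda>x. x) q A"
proof -
  have "q \<in> points M" using chart_dom_subset [OF admissible_banach [OF c(1)]] c(2) by auto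
  then obtain a where a: "a \<in> charts_at M q" using chart_at_exists by blast
  note a' = charts_atD [OF a]
  have ca: "Ck_on \<infinity> (chart_space c) (local_dom c a (\<lambda>x. x)) (local_rep c a (\<lambda>x. x))"
    and ad: "Ck_on \<infinity> (chart_space a) (local_dom a d (\<lambda>x. x)) (local_rep a d (\<lambda>x. x))"
    using a'(1) c(1) d(1) by (auto simp: admissible_chart_def Ck_compatible_def)
  show ?thesis
    using deriv_at_compose [OF admissible_banach [OF c(1)] a'(4) admissible_banach [OF d(1)] id_cont id_cont c(2) a'(2) d(2)
      Ck_on_deriv_at [OF admissible_banach [OF c(1)] a'(4) id_cont c(2) a'(2) ca]
      Ck_on_deriv_at [OF a'(4) admissible_banach [OF d(1)] id_cont a'(2) d(2) ad]] by blast
qed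

lemma trans_eq:
  assumes "admissible_chart M c" "q \<in> chart_dom c" "admissible_chart M d" "q \<in> chart_dom d"
    "deriv_at c d (\<lambda>x. x) q A" "v \<in> chart_space c"
  shows "trans c d q v = A v"
  unfolding trans_def
  by (rule deriv_in_deriv_at [OF admissible_banach [OF assms(1)] admissible_banach [OF assms(3)] id_cont assms(2,4-6)])

lemma trans_mem:
  assumes "admissible_chart M c" "q \<in> chart_dom c" "admissible_chart M d" "q \<in> chart_dom d" "v \<in> chart_space c"
  shows "trans c d q v \<in> chart_space d"
proof -
  obtain A where A: "deriv_at c d (\<lambda>x. x) q A" using transition_deriv_exists [OF assms(1-4)] by blast
  show ?thesis
    unfolding trans_eq [OF assms(1-4) A assms(5)]
    by (rule deriv_at_mem [OF admissible_banach [OF assms(1)] admissible_banach [OF assms(3)] id_cont assms(2,4) A assms(5)])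
qed

lemma trans_trans:
  assumes c: "admissible_chart M c" "q \<in> chart_dom c" and d: "admissible_chart M d" "q \<in> chart_dom d"
    and e: "admissible_chart M e" "q \<in> chart_dom e" and v: "v \<in> chart_space c"
  shows "trans d e q (trans c d q v) = trans c e q v"
proof -
  obtain A where A: "deriv_at c d (\<lambda>x. x) q A" using transition_deriv_exists [OF c d] by blast
  obtain B where B: "deriv_at d e (\<lambda>x. x) q B" using transition_deriv_exists [OF d e] by blast
  have AB: "deriv_at c e (\<lambda>x. x) q (\<lambda>v. B (A v))"
    using deriv_at_compose [OF admissible_banach [OF c(1)] admissible_banach [OF d(1)] admissible_banach [OF e(1)] id_cont id_cont c(2) d(2) e(2) A B] .
  have "trans d e q (trans c d q v) = B (trans c d q v)"
    by (rule trans_eq [OF d e B trans_mem [OF c d v]])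
  then show ?thesis unfolding trans_eq [OF c e AB v] trans_eq [OF c d A v] .
qed

lemma trans_id:
  assumes "admissible_chart M c" "q \<in> chart_dom c" "v \<in> chart_space c"
  shows "trans c c q v = v"
  by (rule trans_eq [OF assms(1,2,1,2) deriv_at_id [OF admissible_banach [OF assms(1)] assms(2)] assms(3)])

lemma tangent_space_iff:
  "v \<in> tangent_space M q \<longleftrightarrow> (\<forall>c\<in>charts_at M q. v c \<in> chart_space c) \<and>
     (\<forall>c\<in>charts_at M q. \<forall>d\<in>charts_at M q. v d = trans c d q (v c)) \<and>
     (\<forall>c. c \<notin> charts_at M q \<longrightarrow> v c = 0)"
  by (simp add: tangent_space_def trans_def)

definition induced_chart :: "'q set \<Rightarrow> ('q, 'e) chart \<Rightarrow> 'e set \<Rightarrow> ('q, 'e) chart" where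
  "induced_chart S c F = \<lparr>chart_dom = chart_dom c \<inter> S, chart_map = chart_map c, chart_space = F\<rparr>"

lemma induced_chart_simps [simp]:
  "chart_dom (induced_chart S c F) = chart_dom c \<inter> S" "chart_map (induced_chart S c F) = chart_map c"
  "chart_space (induced_chart S c F) = F"
  by (simp_all add: induced_chart_def)

lemma atlas_induced: "atlas (induced_manifold M S) = {induced_chart S c F | c F. slice_chart M S c F}"
  by (simp add: induced_manifold_def induced_chart_def)

lemma charts_at_induced:
  "q \<in> S \<Longrightarrow> charts_at (induced_manifold M S) q = {induced_chart S c F | c F. slice_chart M S c F \<and> q \<in> chart_dom c}"
  by (auto simp: charts_at_def atlas_induced) blast

lemma slice_chartD:
  assumes "slice_chart M S c F"
  shows "admissible_chart M c" "banach_chart T c" "subspace F" "closed F" "F \<subseteq> chart_space c"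
    "\<And>p. p \<in> chart_dom c \<Longrightarrow> chart_map c p \<in> F \<longleftrightarrow> p \<in> S"
proof -
  show c: "admissible_chart M c" "banach_chart T c" and "subspace F" "closed F" "F \<subseteq> chart_space c"
    using assms by (auto simp: slice_chart_def complemented_in_def admissible_banach)
  fix p assume p: "p \<in> chart_dom c"
  have "chart_map c ` (chart_dom c \<inter> S) = chart_map c ` chart_dom c \<inter> F" using assms by (simp add: slice_chart_def)
  then show "chart_map c p \<in> F \<longleftrightarrow> p \<in> S"
    using p inj_on_image_mem_iff [OF chart_inj [OF c(2)] p, of "chart_dom c \<inter> S"] by auto
qed

text \<open>
A transition from an induced chart of \<open>S\<close> has the derivative of the ambient transition, restricted to \<open>F\<close>.
The target may be a chart of the manifold, or one of \<open>S\<close>; in the latter case the derivative takes its values in the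
model space \<open>F'\<close> of the target.
\<close>

lemma induced_chart_deriv:
  assumes c: "slice_chart M S c F" and q: "q \<in> S" "q \<in> chart_dom c" "q \<in> chart_dom d" and d: "admissible_chart M d"
    and d': "chart_dom d' \<inter> S = chart_dom d \<inter> S" "chart_map d' = chart_map d" and v: "v \<in> F"
  shows "deriv_in F (local_dom (induced_chart S c F) d' (\<lambda>x. x)) (local_rep (induced_chart S c F) d' (\<lambda>x. x)) (chart_map c q) v = trans c d q v"
    and "(\<And>p. p \<in> S \<inter> chart_dom d \<Longrightarrow> chart_map d p \<in> F') \<Longrightarrow> subspace F' \<Longrightarrow> closed F' \<Longrightarrow> trans c d q v \<in> F'"
proof -
  note c' = slice_chartD [OF c]
  let ?U = "local_dom (induced_chart S c F) d' (\<lambda>x. x)" and ?f = "local_rep (induced_chart S c F) d' (\<lambda>x. x)"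
  obtain A where A: "deriv_at c d (\<lambda>x. x) q A" using transition_deriv_exists [OF c'(1) q(2) d q(3)] by blast
  have inj: "inj_on (chart_map (induced_chart S c F)) (chart_dom (induced_chart S c F))"
    using chart_inj [OF c'(2)] by (simp add: inj_on_subset)
  have Ueq: "?U = local_dom c d (\<lambda>x. x) \<inter> F"
    using c'(6) d'(1) by (auto simp: local_dom_def)
  have "openin (top_of_set (chart_space c)) (local_dom c d (\<lambda>x. x))"
    by (rule local_dom_openin [OF c'(2) admissible_banach [OF d] id_cont])
  then obtain O' where O': "open O'" "local_dom c d (\<lambda>x. x) = chart_space c \<inter> O'" using openin_open by metis
  then have "?U = F \<inter> O'" using Ueq c'(5) by auto
  then have U: "openin (top_of_set F) ?U" using O'(1) by (auto simp: openin_open)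
  have qU: "chart_map c q \<in> ?U" using q d' by (auto simp: local_dom_def)
  have feq: "?f y = local_rep c d (\<lambda>x. x) y" if "y \<in> ?U" for y
  proof -
    obtain p where p: "y = chart_map c p" "p \<in> chart_dom c" "p \<in> S" using \<open>y \<in> ?U\<close> by (auto simp: local_dom_def)
    then show ?thesis
      using local_rep_apply [OF inj, of p d' "\<lambda>x. x"] local_rep_apply [OF chart_inj [OF c'(2)], of p d "\<lambda>x. x"] d'(2) by simp
  qed
  have "has_deriv_in F ?U (local_rep c d (\<lambda>x. x)) A (chart_map c q)"
    using A [unfolded deriv_at_def] c'(5) by (rule has_deriv_in_mono) (use Ueq in auto)
  then have der: "has_deriv_in F ?U ?f A (chart_map c q)"
    by (rule has_deriv_in_cong [OF _ feq qU])
  have Av: "trans c d q v = A v" using v c'(5) by (intro trans_eq [OF c'(1) q(2) d q(3) A]) auto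
  show "deriv_in F ?U ?f (chart_map c q) v = trans c d q v"
    unfolding Av by (rule deriv_in_eq [OF der c'(3) U qU v])
  assume F': "\<And>p. p \<in> S \<inter> chart_dom d \<Longrightarrow> chart_map d p \<in> F'" "subspace F'" "closed F'"
  have "?f ` ?U \<subseteq> F'"
  proof
    fix z assume "z \<in> ?f ` ?U"
    then obtain p where "p \<in> chart_dom c" "p \<in> S" "p \<in> chart_dom d'" "z = ?f (chart_map c p)" by (auto simp: local_dom_def)
    then show "z \<in> F'" using local_rep_apply [OF inj, of p d' "\<lambda>x. x"] F'(1) [of p] d' by auto
  qed
  then show "trans c d q v \<in> F'"
    unfolding Av by (rule has_deriv_in_mem [OF der c'(3) U qU v F'(2,3)])
qed

text \<open>
The components of a tangent vector of \<open>S\<close> in all induced charts are determined by the one in the slice chart \<open>e\<close>, which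
is an arbitrary element of \<open>F\<close>; the inclusion maps the vector to the ambient tangent vector with this component in \<open>e\<close>.
\<close>

lemma submanifold_tangent_space_slice:
  assumes e: "slice_chart M S e F" and q: "q \<in> S" "q \<in> chart_dom e"
  shows "submanifold_tangent_space M S q = {w \<in> tangent_space M q. \<forall>c\<in>charts_at M q. trans c e q (w c) \<in> F}"
    (is "?L = ?R")
proof -
  let ?N = "induced_manifold M S"
  let ?e = "induced_chart S e F"
  note e' = slice_chartD [OF e]
  have eN: "?e \<in> charts_at ?N q" using e q by (auto simp: charts_at_induced)
  have trN: "deriv_in F1 (local_dom (induced_chart S c F1) (induced_chart S d F2) (\<lambda>x. x)) (local_rep (induced_chart S c F1) (induced_chart S d F2) (\<lambda>x. x)) (chart_map c q) v = trans c d q v"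
    if "slice_chart M S c F1" "q \<in> chart_dom c" "slice_chart M S d F2" "q \<in> chart_dom d" "v \<in> F1" for c d F1 F2 v
    by (rule induced_chart_deriv(1) [OF that(1) q(1) that(2,4)]) (use that slice_chartD(1) in auto)
  have trM: "deriv_in F1 (local_dom (induced_chart S c F1) d (\<lambda>x. x)) (local_rep (induced_chart S c F1) d (\<lambda>x. x)) (chart_map c q) v = trans c d q v"
    if "slice_chart M S c F1" "q \<in> chart_dom c" "d \<in> charts_at M q" "v \<in> F1" for c d F1 v
    by (rule induced_chart_deriv(1) [OF that(1) q(1) that(2)]) (use that charts_atD in auto)
  have TN: "v c' \<in> chart_space c'" "v (induced_chart S c F1) = trans e c q (v ?e)"
    if "v \<in> tangent_space ?N q" "c' = induced_chart S c F1" "slice_chart M S c F1" "q \<in> chart_dom c" for v c' c F1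
  proof -
    have c': "induced_chart S c F1 \<in> charts_at ?N q" using that q by (auto simp: charts_at_induced)
    show "v c' \<in> chart_space c'" unfolding that(2) by (rule tangent_spaceD(1) [OF that(1) c'])
    have ve: "v ?e \<in> F" using tangent_spaceD(1) [OF that(1) eN] by simp
    have "v (induced_chart S c F1) = deriv_in (chart_space ?e) (local_dom ?e (induced_chart S c F1) (\<lambda>x. x)) (local_rep ?e (induced_chart S c F1) (\<lambda>x. x)) (chart_map ?e q) (v ?e)"
      by (rule tangent_spaceD(2) [OF that(1) eN c'])
    then show "v (induced_chart S c F1) = trans e c q (v ?e)" using trN [OF e q(2) that(3,4) ve] by simp
  qed
  have tm: "tangent_map ?N M (\<lambda>x. x) q v = (\<lambda>d. if d \<in> charts_at M q then trans e d q (v ?e) else 0)"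
    if v: "v \<in> tangent_space ?N q" for v
  proof
    fix d
    show "tangent_map ?N M (\<lambda>x. x) q v d = (if d \<in> charts_at M q then trans e d q (v ?e) else 0)"
    proof (cases "d \<in> charts_at M q")
      case False
      then show ?thesis by (simp add: tangent_map_def)
    next
      case d: True
      have val: "deriv_in (chart_space c') (local_dom c' d (\<lambda>x. x)) (local_rep c' d (\<lambda>x. x)) (chart_map c' q) (v c') = trans e d q (v ?e)"
        if "c' \<in> charts_at ?N q" for c'
      proof -
        obtain c F1 where c: "c' = induced_chart S c F1" "slice_chart M S c F1" "q \<in> chart_dom c"
          using \<open>c' \<in> charts_at ?N q\<close> q by (auto simp: charts_at_induced)
        have "v c' \<in> F1" using TN(1) [OF v c] c by simp
        then have "deriv_in (chart_space c') (local_dom c' d (\<lambda>x. x)) (local_rep c' d (\<lambda>x. x)) (chart_map c' q) (v c') = trans c d q (v c')"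
          using trM [OF c(2,3) d] c(1) by simp
        also have "\<dots> = trans c d q (trans e c q (v ?e))" using TN(2) [OF v c] c(1) by simp
        also have "\<dots> = trans e d q (v ?e)"
          using TN(1) [OF v refl e q(2)] e'(5) slice_chartD(1) [OF c(2)] c(3) charts_atD(2,3) [OF d]
          by (intro trans_trans e'(1) q(2)) auto
        finally show ?thesis .
      qed
      have "(THE w. \<forall>c'\<in>charts_at ?N q. w = deriv_in (chart_space c') (local_dom c' d (\<lambda>x. x)) (local_rep c' d (\<lambda>x. x)) (chart_map c' q) (v c'))
          = trans e d q (v ?e)"
        using val eN by (intro the_equality) auto
      then show ?thesis using d by (simp add: tangent_map_def)
    qed
  qed
  have "?L \<subseteq> ?R"
  proof
    fix w assume "w \<in> ?L"
    then obtain v where v: "v \<in> tangent_space ?N q" and w: "w = tangent_map ?N M (\<lambda>x. x) q v"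
      by (auto simp: submanifold_tangent_space_def)
    have ve: "v ?e \<in> F" using TN(1) [OF v refl e q(2)] by simp
    then have veE: "v ?e \<in> chart_space e" using e'(5) by auto
    have wd: "w d = trans e d q (v ?e)" if "d \<in> charts_at M q" for d using tm [OF v] w that by simp
    have w0: "w d = 0" if "d \<notin> charts_at M q" for d using tm [OF v] w that by simp
    have "w \<in> tangent_space M q"
      unfolding tangent_space_iff
    proof (intro conjI ballI allI impI w0)
      fix c assume c: "c \<in> charts_at M q"
      show "w c \<in> chart_space c" unfolding wd [OF c] by (rule trans_mem [OF e'(1) q(2) charts_atD(3,2) [OF c] veE])
      fix d assume d: "d \<in> charts_at M q"
      show "w d = trans c d q (w c)"
        unfolding wd [OF c] wd [OF d]
        by (rule trans_trans [OF e'(1) q(2) charts_atD(3,2) [OF c] charts_atD(3,2) [OF d] veE, symmetric])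
    qed
    moreover have "trans c e q (w c) \<in> F" if c: "c \<in> charts_at M q" for c
      unfolding wd [OF c] trans_trans [OF e'(1) q(2) charts_atD(3,2) [OF c] e'(1) q(2) veE] trans_id [OF e'(1) q(2) veE] by (rule ve)
    ultimately show "w \<in> ?R" by blast
  qed
  moreover have "?R \<subseteq> ?L"
  proof
    fix w assume w: "w \<in> ?R"
    have "q \<in> points M" using chart_dom_subset [OF e'(2)] q by auto
    then obtain a where a: "a \<in> charts_at M q" using chart_at_exists by blast
    note a' = charts_atD(3,2) [OF a]
    define u where "u = trans a e q (w a)"
    have wT: "w \<in> tangent_space M q" and uF: "u \<in> F" using w a by (auto simp: u_def)
    have uE: "u \<in> chart_space e" using uF e'(5) by auto
    have wa: "w a \<in> chart_space a" by (rule tangent_spaceD(1) [OF wT a])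
    (* Different slice charts may induce the same chart of S. The component is therefore defined through the
       induced chart alone. *)
    define v where "v c' = (if c' \<in> charts_at ?N q then deriv_in F (local_dom ?e c' (\<lambda>x. x)) (local_rep ?e c' (\<lambda>x. x)) (chart_map e q) u else 0)" for c'
    have vc: "v (induced_chart S c F1) = trans e c q u" if "slice_chart M S c F1" "q \<in> chart_dom c" for c F1
    proof -
      have "induced_chart S c F1 \<in> charts_at ?N q" using that q by (auto simp: charts_at_induced)
      then show ?thesis using trN [OF e q(2) that uF] by (simp add: v_def)
    qed
    have ve: "v ?e = u" using vc [OF e q(2)] trans_id [OF e'(1) q(2) uE] by simp
    have vF: "trans e c q u \<in> F1" if c: "slice_chart M S c F1" "q \<in> chart_dom c" for c F1
      by (rule induced_chart_deriv(2) [OF e q(1,2) c(2) slice_chartD(1) [OF c(1)], where d' = c])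
        (use slice_chartD [OF c(1)] uF in auto)
    have "v \<in> tangent_space ?N q"
      unfolding tangent_space_def
    proof (intro CollectI conjI ballI allI impI)
      fix c' assume "c' \<in> charts_at ?N q"
      then obtain c F1 where c: "c' = induced_chart S c F1" "slice_chart M S c F1" "q \<in> chart_dom c"
        using q by (auto simp: charts_at_induced)
      show "v c' \<in> chart_space c'" using vc [OF c(2,3)] vF [OF c(2,3)] c(1) by simp
      fix d' assume "d' \<in> charts_at ?N q"
      then obtain d F2 where d: "d' = induced_chart S d F2" "slice_chart M S d F2" "q \<in> chart_dom d"
        using q by (auto simp: charts_at_induced)
      have "deriv_in (chart_space c') (local_dom c' d' (\<lambda>x. x)) (local_rep c' d' (\<lambda>x. x)) (chart_map c' q) (v c') = trans c d q (trans e c q u)"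
        using trN [OF c(2,3) d(2,3) vF [OF c(2,3)]] vc [OF c(2,3)] c(1) d(1) by simp
      also have "\<dots> = trans e d q u"
        by (rule trans_trans [OF e'(1) q(2) slice_chartD(1) [OF c(2)] c(3) slice_chartD(1) [OF d(2)] d(3) uE])
      also have "\<dots> = v d'" using vc [OF d(2,3)] d(1) by simp
      finally show "v d' = deriv_in (chart_space c') (local_dom c' d' (\<lambda>x. x)) (local_rep c' d' (\<lambda>x. x)) (chart_map c' q) (v c')" ..
    qed (simp add: v_def)
    moreover have "w = tangent_map ?N M (\<lambda>x. x) q v"
    proof
      fix d
      show "w d = tangent_map ?N M (\<lambda>x. x) q v d"
        unfolding tm [OF \<open>v \<in> tangent_space ?N q\<close>] ve
      proof (cases "d \<in> charts_at M q")
        case d: True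
        have "trans e d q u = trans a d q (w a)"
          unfolding u_def by (rule trans_trans [OF a' e'(1) q(2) charts_atD(3,2) [OF d] wa])
        also have "\<dots> = w d" using tangent_spaceD(2) [OF wT a d] unfolding trans_def ..
        finally show "w d = (if d \<in> charts_at M q then trans e d q u else 0)" using d by simp
      next
        case False
        then show "w d = (if d \<in> charts_at M q then trans e d q u else 0)" using tangent_spaceD(3) [OF wT False] by simp
      qed
    qed
    ultimately show "w \<in> ?L" by (auto simp: submanifold_tangent_space_def)
  qed
  ultimately show ?thesis by (rule subset_antisym)
qed

text \<open>
The components of \<open>tangent_map M M f q v\<close> in all charts are obtained from the component \<open>A (v c)\<close> in the single chart
\<open>c\<close> by the derivatives of the transitions.
\<close>

lemma tangent_map_fixed_iff:
  assumes f: "Ck_map \<infinity> M M f" and fq: "f q = q" and c: "c \<in> charts_at M q" and v: "v \<in> tangent_space M q"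
    and A: "deriv_at c c f q A"
  shows "tangent_map M M f q v = v \<longleftrightarrow> A (v c) = v c"
proof -
  have fc: "continuous_map T T f" using f by (simp add: Ck_map_def)
  note c' = charts_atD(3,2) [OF c]
  have vc: "v d \<in> chart_space d" if "d \<in> charts_at M q" for d by (rule tangent_spaceD(1) [OF v that])
  have vt: "trans d1 d2 q (v d1) = v d2" if "d1 \<in> charts_at M q" "d2 \<in> charts_at M q" for d1 d2
    using tangent_spaceD(2) [OF v that] unfolding trans_def ..
  have fqc: "f q \<in> chart_dom c" using fq c' by simp
  have Avc: "A (v c) \<in> chart_space c"
    by (rule deriv_at_mem [OF charts_atD(4) [OF c] charts_atD(4) [OF c] fc c'(2) fqc A vc [OF c]])
  have tm: "tangent_map M M f q v d = trans c d q (A (v c))" if d: "d \<in> charts_at M q" for d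
  proof -
    have val: "deriv_in (chart_space c1) (local_dom c1 d f) (local_rep c1 d f) (chart_map c1 q) (v c1) = trans c d q (A (v c))"
      if c1: "c1 \<in> charts_at M q" for c1
    proof -
      obtain B1 where B1: "deriv_at c1 c (\<lambda>x. x) q B1"
        using transition_deriv_exists [OF charts_atD(3,2) [OF c1] c'] by blast
      obtain B2 where B2: "deriv_at c d (\<lambda>x. x) q B2"
        using transition_deriv_exists [OF c' charts_atD(3,2) [OF d]] by blast
      have "deriv_at c1 c f q (\<lambda>v. A (B1 v))"
        using deriv_at_compose [OF charts_atD(4) [OF c1] charts_atD(4) [OF c] charts_atD(4) [OF c] id_cont fc charts_atD(2) [OF c1] c'(2) fqc B1 A] .
      from deriv_at_compose [OF charts_atD(4) [OF c1] charts_atD(4) [OF c] charts_atD(4) [OF d] fc id_cont charts_atD(2) [OF c1] fqc _ this]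
      have "deriv_at c1 d f q (\<lambda>v. B2 (A (B1 v)))" using B2 fq charts_atD(2) [OF d] by simp
      from deriv_in_deriv_at [OF charts_atD(4) [OF c1] charts_atD(4) [OF d] fc charts_atD(2) [OF c1] _ this vc [OF c1]]
      have "deriv_in (chart_space c1) (local_dom c1 d f) (local_rep c1 d f) (chart_map c1 q) (v c1) = B2 (A (B1 (v c1)))"
        using fq charts_atD(2) [OF d] by simp
      also have "B1 (v c1) = v c" using trans_eq [OF charts_atD(3,2) [OF c1] c' B1 vc [OF c1]] vt [OF c1 c] by simp
      also have "B2 (A (v c)) = trans c d q (A (v c))" using trans_eq [OF c' charts_atD(3,2) [OF d] B2 Avc] by simp
      finally show ?thesis .
    qed
    have "(THE w. \<forall>c1\<in>charts_at M q. w = deriv_in (chart_space c1) (local_dom c1 d f) (local_rep c1 d f) (chart_map c1 q) (v c1))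
        = trans c d q (A (v c))"
      using val c by (intro the_equality) auto
    then show ?thesis using d fq by (simp add: tangent_map_def)
  qed
  show ?thesis
  proof
    assume "tangent_map M M f q v = v"
    then show "A (v c) = v c" using tm [OF c] trans_id [OF c' Avc] by simp
  next
    assume Av: "A (v c) = v c"
    show "tangent_map M M f q v = v"
    proof
      fix d
      show "tangent_map M M f q v d = v d"
      proof (cases "d \<in> charts_at M q")
        case True
        then show ?thesis using tm [OF True] Av vt [OF c True] by simp
      next
        case False
        then show ?thesis using tangent_spaceD(3) [OF v False] fq by (simp add: tangent_map_def)
      qed
    qed
  qed
qed

end

section \<open>Fixed points of compact group actions on Banach manifolds\<close>

text \<open>
The inverse map is Lipschitz continuous.
\<close>

lemma homeomorphic_map_expanding:
  fixes f :: "'a::metric_space \<Rightarrow> 'b::metric_space"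
  assumes f: "continuous_on W f" and exp: "\<And>x y. x \<in> W \<Longrightarrow> y \<in> W \<Longrightarrow> dist x y \<le> M * dist (f x) (f y)"
  shows "homeomorphic_map (top_of_set W) (top_of_set (f ` W)) f"
proof -
  define K where "K = max 1 M"
  have K: "0 < K" by (simp add: K_def)
  have exp': "dist x y \<le> K * dist (f x) (f y)" if "x \<in> W" "y \<in> W" for x y
    using exp [OF that] mult_right_mono [of M K "dist (f x) (f y)"] by (simp add: K_def)
  have inj: "inj_on f W" using exp by (force intro: inj_onI)
  have inv: "inv_into W f (f x) = x" if "x \<in> W" for x using inj that by simp
  have "continuous_on (f ` W) (inv_into W f)"
    unfolding continuous_on_iff
  proof (intro ballI allI impI)
    fix u and e :: real assume "u \<in> f ` W" and e: "0 < e"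
    then obtain x where x: "x \<in> W" "u = f x" by auto
    have "dist (inv_into W f w) (inv_into W f u) < e" if "w \<in> f ` W" "dist w u < e / K" for w
    proof -
      obtain y where y: "y \<in> W" "w = f y" using \<open>w \<in> f ` W\<close> by auto
      have "dist y x \<le> K * dist w u" using exp' x y by simp
      also have "\<dots> < e" using that(2) K by (simp add: pos_less_divide_eq mult.commute)
      finally show ?thesis using x y inv by simp
    qed
    then show "\<exists>d>0. \<forall>w\<in>f ` W. dist w u < d \<longrightarrow> dist (inv_into W f w) (inv_into W f u) < e"
      using e K by (intro exI [of _ "e / K"]) auto
  qed
  then have "homeomorphic_maps (top_of_set W) (top_of_set (f ` W)) f (inv_into W f)"
    using f inv by (auto simp: homeomorphic_maps_def continuous_map_in_subtopology)
  then show ?thesis by (auto simp: homeomorphic_map_maps)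
qed

lemma cube_smooth_continuous_on:
  assumes f: "cube_smooth E U f" and E: "subspace E" and U: "openin (top_of_set E) U"
  shows "continuous_on U f"
  unfolding continuous_on_iff
proof (intro ballI allI impI)
  fix x and e :: real assume x: "x \<in> U" and e: "0 < e"
  have UE: "U \<subseteq> E" using U openin_imp_subset by auto
  obtain \<delta> C where d: "0 < \<delta>" "0 \<le> C" "cube_bounded E f x 1 \<delta> C" using f x unfolding cube_smooth_def by blast
  have "dist (f y) (f x) < e" if y: "y \<in> U" "dist y x < min \<delta> (e / (C + 1))" for y
  proof -
    have "norm (f y - f x) \<le> C * norm (y - x)"
      using x y UE d(1) by (intro cube_bounded_Lipschitz [OF d(3) _ E]) (auto simp: dist_commute)
    moreover have "norm (y - x) * (C + 1) < e" using y d(2) by (simp add: dist_norm pos_less_divide_eq)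
    moreover have "C * norm (y - x) \<le> norm (y - x) * (C + 1)" by (simp add: algebra_simps)
    ultimately show ?thesis by (simp add: dist_norm)
  qed
  then show "\<exists>d>0. \<forall>y\<in>U. dist y x < d \<longrightarrow> dist (f y) (f x) < e"
    using d e by (intro exI [of _ "min \<delta> (e / (C + 1))"]) auto
qed

text \<open>
The transitions to and from a chart \<open>d\<close> of the atlas are those between \<open>c\<close> and \<open>d\<close>, composed with the inverse of \<open>\<psi>\<close>
and with \<open>\<psi>\<close>; the inverse is smooth by \<open>cube_smooth_inverse\<close>.
\<close>

lemma change_chart:
  fixes M :: "('q, 'e::banach) manifold"
  assumes M: "smooth_manifold M" and c: "c \<in> atlas M"
    and W: "openin (top_of_set (chart_space c)) W" "W \<subseteq> chart_map c ` chart_dom c"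
    and \<psi>: "cube_smooth (chart_space c) W \<psi>" "openin (top_of_set (chart_space c)) (\<psi> ` W)"
    and exp: "\<And>x y. x \<in> W \<Longrightarrow> y \<in> W \<Longrightarrow> norm (x - y) \<le> K * norm (\<psi> x - \<psi> y)" "0 \<le> K"
  shows "admissible_chart M \<lparr>chart_dom = {p \<in> chart_dom c. chart_map c p \<in> W},
    chart_map = (\<lambda>p. \<psi> (chart_map c p)), chart_space = chart_space c\<rparr>" (is "admissible_chart M ?e")
proof -
  interpret banach_manifold M by unfold_locales (rule M)
  note cb = atlas_banach [OF c]
  note c' = banach_chartD [OF cb] and cinj = chart_inj [OF cb]
  let ?E = "chart_space c"
  let ?D = "{p \<in> chart_dom c. chart_map c p \<in> W}"
  have WE: "W \<subseteq> ?E" using W(1) openin_imp_subset by auto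
  have cD: "chart_map c ` ?D = W" using W(2) by auto
  have img: "(\<lambda>p. \<psi> (chart_map c p)) ` ?D = \<psi> ` W" using cD by (metis image_image)
  have D: "openin T ?D" by (rule chart_openin_preimage [OF cb W(1)])
  have Dsub: "?D \<subseteq> topspace T" using D openin_subset by blast
  have \<psi>inj: "inj_on \<psi> W" using exp by (force intro: inj_onI)
  have einj: "inj_on (chart_map ?e) (chart_dom ?e)"
    using \<psi>inj cinj by (auto simp: inj_on_def)
  have hc: "homeomorphic_map (subtopology T ?D) (top_of_set W) (chart_map c)"
  proof -
    have "homeomorphic_map (subtopology (subtopology T (chart_dom c)) ?D) (subtopology (top_of_set (chart_map c ` chart_dom c)) W) (chart_map c)"
    proof (rule homeomorphic_map_subtopologies [OF c'(5)])
      show "chart_map c ` (topspace (subtopology T (chart_dom c)) \<inter> ?D) = topspace (top_of_set (chart_map c ` chart_dom c)) \<inter> W"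
        using cD W(2) Dsub by auto
    qed
    moreover have "chart_dom c \<inter> ?D = ?D" "chart_map c ` chart_dom c \<inter> W = W" using W(2) by auto
    ultimately show ?thesis by (simp add: subtopology_subtopology)
  qed
  have h\<psi>: "homeomorphic_map (top_of_set W) (top_of_set (\<psi> ` W)) \<psi>"
    by (rule homeomorphic_map_expanding [OF cube_smooth_continuous_on [OF \<psi>(1) c'(2) W(1)], where M = K]) (simp add: dist_norm exp)
  have eb: "banach_chart T ?e"
    unfolding banach_chart_def
    using D c'(2,3) \<psi>(2) homeomorphic_map_compose [OF hc h\<psi>] by (simp add: img o_def)
  define \<phi> where "\<phi> = inv_into W \<psi>"
  have \<phi>: "\<phi> (\<psi> x) = x" if "x \<in> W" for x using \<psi>inj that by (simp add: \<phi>_def)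
  have \<phi>s: "cube_smooth ?E (\<psi> ` W) \<phi>"
    by (rule cube_smooth_inverse [OF \<psi>(1) c'(2) W(1) \<psi>(2) _ exp]) (use \<phi> in auto)
  have "Ck_compatible ?e d" if d: "d \<in> atlas M" for d
    unfolding Ck_compatible_def
  proof
    note db = atlas_banach [OF d]
    have cd: "Ck_on \<infinity> ?E (local_dom c d (\<lambda>x. x)) (local_rep c d (\<lambda>x. x))"
      and dc: "Ck_on \<infinity> (chart_space d) (local_dom d c (\<lambda>x. x)) (local_rep d c (\<lambda>x. x))"
      using M c d unfolding smooth_manifold_def Ck_compatible_def by blast+
    have cdo: "openin (top_of_set ?E) (local_dom c d (\<lambda>x. x))" and dco: "openin (top_of_set (chart_space d)) (local_dom d c (\<lambda>x. x))"
      and edo: "openin (top_of_set ?E) (local_dom ?e d (\<lambda>x. x))" and deo: "openin (top_of_set (chart_space d)) (local_dom d ?e (\<lambda>x. x))"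
      using local_dom_openin [OF cb db id_cont] local_dom_openin [OF db cb id_cont] local_dom_openin [OF eb db id_cont] local_dom_openin [OF db eb id_cont] by auto
    have cds: "cube_smooth ?E (local_dom c d (\<lambda>x. x)) (local_rep c d (\<lambda>x. x))" by (rule Ck_imp_cube_smooth [OF cd c'(2) cdo])
    have dcs: "cube_smooth (chart_space d) (local_dom d c (\<lambda>x. x)) (local_rep d c (\<lambda>x. x))" by (rule Ck_imp_cube_smooth [OF dc banach_chartD(2) [OF db] dco])
    have ed_sub: "local_dom ?e d (\<lambda>x. x) \<subseteq> \<psi> ` W" by (auto simp: local_dom_def)
    have "cube_smooth ?E (local_dom ?e d (\<lambda>x. x)) (\<lambda>y. local_rep c d (\<lambda>x. x) (\<phi> y))"
    proof (rule cube_smooth_compose [OF cube_smooth_subset [OF \<phi>s ed_sub] cds c'(2) edo c'(2)])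
      show "local_dom c d (\<lambda>x. x) \<subseteq> ?E" using cdo openin_imp_subset by auto
      show "\<phi> ` local_dom ?e d (\<lambda>x. x) \<subseteq> local_dom c d (\<lambda>x. x)" by (auto simp: local_dom_def \<phi>)
    qed
    then have "cube_smooth ?E (local_dom ?e d (\<lambda>x. x)) (local_rep ?e d (\<lambda>x. x))"
    proof (rule cube_smooth_cong [OF _ c'(2) edo])
      fix y assume "y \<in> local_dom ?e d (\<lambda>x. x)"
      then obtain p where p: "y = \<psi> (chart_map c p)" "p \<in> ?D" by (auto simp: local_dom_def)
      show "local_rep ?e d (\<lambda>x. x) y = local_rep c d (\<lambda>x. x) (\<phi> y)"
        using local_rep_apply [OF einj, of p d "\<lambda>x. x"] local_rep_apply [OF cinj, of p d "\<lambda>x. x"] p \<phi> by simp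
    qed
    then show "Ck_on \<infinity> (chart_space ?e) (local_dom ?e d (\<lambda>x. x)) (local_rep ?e d (\<lambda>x. x))"
      using cube_smooth_imp_Ck [OF _ c'(2) edo] by simp
    have de_sub: "local_dom d ?e (\<lambda>x. x) \<subseteq> local_dom d c (\<lambda>x. x)" by (auto simp: local_dom_def)
    have rep: "local_rep d c (\<lambda>x. x) (chart_map d p) = chart_map c p" if "p \<in> chart_dom d" for p
      by (rule local_rep_apply [OF chart_inj [OF db] that])
    have "cube_smooth (chart_space d) (local_dom d ?e (\<lambda>x. x)) (\<lambda>y. \<psi> (local_rep d c (\<lambda>x. x) y))"
    proof (rule cube_smooth_compose [OF cube_smooth_subset [OF dcs de_sub] \<psi>(1) banach_chartD(2) [OF db] deo c'(2) WE])
      show "local_rep d c (\<lambda>x. x) ` local_dom d ?e (\<lambda>x. x) \<subseteq> W" using rep by (auto simp: local_dom_def)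
    qed
    then have "cube_smooth (chart_space d) (local_dom d ?e (\<lambda>x. x)) (local_rep d ?e (\<lambda>x. x))"
    proof (rule cube_smooth_cong [OF _ banach_chartD(2) [OF db] deo])
      fix y assume "y \<in> local_dom d ?e (\<lambda>x. x)"
      then obtain p where p: "y = chart_map d p" "p \<in> chart_dom d" by (auto simp: local_dom_def)
      show "local_rep d ?e (\<lambda>x. x) y = \<psi> (local_rep d c (\<lambda>x. x) y)"
        using local_rep_apply [OF chart_inj [OF db] p(2), of ?e "\<lambda>x. x"] rep [OF p(2)] p(1) by simp
    qed
    then show "Ck_on \<infinity> (chart_space d) (local_dom d ?e (\<lambda>x. x)) (local_rep d ?e (\<lambda>x. x))"
      by (rule cube_smooth_imp_Ck [OF _ banach_chartD(2) [OF db] deo])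
  qed
  then show ?thesis using eb by (simp add: admissible_chart_def)
qed

locale compact_manifold_action = compact_group G X + banach_manifold M
  for G :: "('g, 'm) monoid_scheme" (structure) and X :: "'g topology" and M :: "('q, 'e::banach) manifold" +
  fixes \<Phi> :: "'g \<Rightarrow> 'q \<Rightarrow> 'q"
  assumes act_one: "\<And>p. p \<in> points M \<Longrightarrow> \<Phi> \<one> p = p"
    and act_mult: "\<And>g h p. g \<in> carrier G \<Longrightarrow> h \<in> carrier G \<Longrightarrow> p \<in> points M \<Longrightarrow> \<Phi> (g \<otimes> h) p = \<Phi> g (\<Phi> h p)"
    and act_cont: "continuous_map (prod_topology X T) T (\<lambda>(g, p). \<Phi> g p)"
    and act_smooth: "\<And>g. g \<in> carrier G \<Longrightarrow> Ck_map \<infinity> M M (\<Phi> g)"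
begin

definition fixed_points :: "'q set" where
  "fixed_points = {p \<in> points M. \<forall>g\<in>carrier G. \<Phi> g p = p}"

lemma act_mem: "g \<in> carrier G \<Longrightarrow> p \<in> points M \<Longrightarrow> \<Phi> g p \<in> points M"
  using act_smooth continuous_map_image_subset_topspace unfolding Ck_map_def by blast

lemma orbit_map_continuous:
  assumes "p \<in> points M"
  shows "continuous_map X T (\<lambda>g. \<Phi> g p)"
proof -
  have "continuous_map X (prod_topology X T) (\<lambda>g. (g, p))"
    using assms by (simp add: continuous_map_paired)
  from continuous_map_compose [OF this act_cont] show ?thesis by (simp add: o_def)
qed

text \<open>
The action can be read in the chart on this set, which is the largest invariant one in its domain.
\<close>

definition invariant_part :: "('q, 'e) chart \<Rightarrow> 'q set" where
  "invariant_part c = {p \<in> points M. \<forall>g\<in>carrier G. \<Phi> g p \<in> chart_dom c}"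

lemma openin_invariant_part:
  assumes c: "banach_chart T c"
  shows "openin T (invariant_part c)"
proof -
  have "openin (prod_topology X T) {z \<in> topspace (prod_topology X T). (\<lambda>(g, p). \<Phi> g p) z \<in> chart_dom c}"
    by (rule openin_continuous_map_preimage [OF act_cont banach_chartD(1) [OF c]])
  from tube_openin [OF compact this]
  show ?thesis by (simp add: invariant_part_def topspace_eq cong: conj_cong)
qed

lemma invariant_part_subset: "invariant_part c \<subseteq> chart_dom c"
  using act_one one_closed by (force simp: invariant_part_def)

lemma invariant_part_act: "g \<in> carrier G \<Longrightarrow> p \<in> invariant_part c \<Longrightarrow> \<Phi> g p \<in> invariant_part c"
  by (auto simp: invariant_part_def act_mem simp flip: act_mult)

lemma local_action:
  assumes c: "c \<in> atlas M" and q: "q \<in> chart_dom c" "q \<in> fixed_points"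
  shows "compact_smooth_action G X (chart_space c) (chart_map c ` invariant_part c)
    (\<lambda>g. local_rep c c (\<Phi> g)) (chart_map c q)"
proof -
  note cb = atlas_banach [OF c]
  note c' = banach_chartD [OF cb] and cinj = chart_inj [OF cb]
  have U: "openin T (invariant_part c)" by (rule openin_invariant_part [OF cb])
  have dom: "p \<in> chart_dom c" if "p \<in> invariant_part c" for p using that invariant_part_subset by blast
  have rep: "local_rep c c (\<Phi> g) (chart_map c p) = chart_map c (\<Phi> g p)" if "p \<in> invariant_part c" for g p
    by (rule local_rep_apply [OF cinj dom [OF that]])
  have pts: "p \<in> points M" if "p \<in> invariant_part c" for p using that by (simp add: invariant_part_def)
  show ?thesis
  proof (unfold_locales)
    show "subspace (chart_space c)" "closed (chart_space c)" by (rule c')+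
    show "openin (top_of_set (chart_space c)) (chart_map c ` invariant_part c)"
      by (rule chart_openin_image [OF cb U invariant_part_subset])
    show "local_rep c c (\<Phi> g) x \<in> chart_map c ` invariant_part c"
      if "g \<in> carrier G" "x \<in> chart_map c ` invariant_part c" for g x
      using that rep invariant_part_act by auto
    show "local_rep c c (\<Phi> \<one>) x = x" if "x \<in> chart_map c ` invariant_part c" for x
      using that rep pts act_one by auto
    show "local_rep c c (\<Phi> (g \<otimes> h)) x = local_rep c c (\<Phi> g) (local_rep c c (\<Phi> h) x)"
      if "g \<in> carrier G" "h \<in> carrier G" "x \<in> chart_map c ` invariant_part c" for g h x
      using that rep pts invariant_part_act act_mult by auto
    show "continuous_map X euclidean (\<lambda>g. local_rep c c (\<Phi> g) x)" if x: "x \<in> chart_map c ` invariant_part c" for x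
    proof -
      obtain p where p: "p \<in> invariant_part c" "x = chart_map c p" using x by auto
      have "continuous_map X (subtopology T (chart_dom c)) (\<lambda>g. \<Phi> g p)"
        using orbit_map_continuous [OF pts [OF p(1)]] p(1) 
        by (auto simp: continuous_map_in_subtopology invariant_part_def topspace_eq)
      from continuous_map_compose [OF this chart_continuous [OF cb]] show ?thesis
        by (simp add: o_def p rep)
    qed
    show "cube_smooth (chart_space c) (chart_map c ` invariant_part c) (local_rep c c (\<Phi> g))" if g: "g \<in> carrier G" for g
    proof (rule cube_smooth_subset)
      have "continuous_map T T (\<Phi> g)" "Ck_on \<infinity> (chart_space c) (local_dom c c (\<Phi> g)) (local_rep c c (\<Phi> g))"
        using act_smooth [OF g] c by (auto simp: Ck_map_def)
      then show "cube_smooth (chart_space c) (local_dom c c (\<Phi> g)) (local_rep c c (\<Phi> g))"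
        by (intro Ck_imp_cube_smooth c' local_dom_openin [OF cb cb])
      show "chart_map c ` invariant_part c \<subseteq> local_dom c c (\<Phi> g)"
        using g dom by (auto simp: local_dom_def invariant_part_def)
    qed
    have "q \<in> invariant_part c" using q by (auto simp: invariant_part_def fixed_points_def)
    then show "chart_map c q \<in> chart_map c ` invariant_part c" by simp
    show "local_rep c c (\<Phi> g) (chart_map c q) = chart_map c q" if "g \<in> carrier G" for g
      using q that by (simp add: fixed_points_def local_rep_apply [OF cinj q(1)])
  qed
qed

text \<open>
The slice chart is the composite of \<open>c\<close> with the linearization of the action. The derivative of the transition from
\<open>c\<close> is recorded because it identifies \<open>F\<close>, as a space of components in \<open>c\<close>, with the fixed vectors.
\<close>

lemma slice_at_fixed_point:
  assumes c: "c \<in> atlas M" and q: "q \<in> chart_dom c" "q \<in> fixed_points"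
  shows "\<exists>e F. slice_chart M fixed_points e F \<and> q \<in> chart_dom e \<and>
    deriv_at c e (\<lambda>x. x) q (\<lambda>v. v) \<and>
    (\<forall>v\<in>chart_space c. v \<in> F \<longleftrightarrow> (\<forall>g\<in>carrier G. dir_deriv (local_rep c c (\<Phi> g)) (chart_map c q) v = v))"
proof -
  note cb = atlas_banach [OF c]
  note c' = banach_chartD [OF cb] and cinj = chart_inj [OF cb]
  let ?E = "chart_space c" and ?x0 = "chart_map c q"
  interpret loc: compact_smooth_action G X ?E "chart_map c ` invariant_part c" "\<lambda>g. local_rep c c (\<Phi> g)" ?x0
    by (rule local_action [OF assms])
  let ?V = "chart_map c ` invariant_part c"
  obtain r where r: "0 < r" "?E \<inter> ball ?x0 r \<subseteq> ?V"
    "openin (top_of_set ?E) (loc.linearization ` (?E \<inter> ball ?x0 r))"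
    "\<And>x y. x \<in> ?E \<inter> ball ?x0 r \<Longrightarrow> y \<in> ?E \<inter> ball ?x0 r \<Longrightarrow> norm (x - y) \<le> 2 * norm (loc.linearization x - loc.linearization y)"
    "\<And>x. x \<in> ?E \<inter> ball ?x0 r \<Longrightarrow> (\<forall>g\<in>carrier G. local_rep c c (\<Phi> g) x = x) \<longleftrightarrow> loc.linearization x \<in> loc.fixed_space"
    by (rule loc.linearization_chart) blast
  let ?W = "?E \<inter> ball ?x0 r"
  define e where "e = \<lparr>chart_dom = {p \<in> chart_dom c. chart_map c p \<in> ?W},
    chart_map = (\<lambda>p. loc.linearization (chart_map c p)), chart_space = ?E\<rparr>"
  have W: "openin (top_of_set ?E) ?W" by (rule openin_open_Int) simp
  have adm: "admissible_chart M e"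
    unfolding e_def
  proof (rule change_chart [OF smooth c W _ _ r(3,4)])
    show "?W \<subseteq> chart_map c ` chart_dom c" using r(2) invariant_part_subset by blast
    show "cube_smooth ?E ?W loc.linearization" by (rule cube_smooth_subset [OF loc.linearization_smooth r(2)])
  qed auto
  have qe: "q \<in> chart_dom e" using q(1) r(1) chart_map_mem [OF cb] by (simp add: e_def)
  have inU: "p \<in> invariant_part c" if p: "p \<in> chart_dom e" for p
  proof -
    have "chart_map c p \<in> ?V" "p \<in> chart_dom c" using p r(2) by (auto simp: e_def)
    then show ?thesis using inj_on_image_mem_iff [OF cinj _ invariant_part_subset] by blast
  qed
  have fix_iff: "chart_map e p \<in> loc.fixed_space \<longleftrightarrow> p \<in> fixed_points" if p: "p \<in> chart_dom e" for p
  proof -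
    have pc: "p \<in> chart_dom c" "chart_map c p \<in> ?W" using p by (auto simp: e_def)
    have pu: "p \<in> points M" "\<And>g. g \<in> carrier G \<Longrightarrow> \<Phi> g p \<in> chart_dom c" using inU [OF p] by (auto simp: invariant_part_def)
    have "chart_map e p \<in> loc.fixed_space \<longleftrightarrow> (\<forall>g\<in>carrier G. chart_map c (\<Phi> g p) = chart_map c p)"
      using r(5) [OF pc(2)] by (simp add: e_def local_rep_apply [OF cinj pc(1)])
    also have "\<dots> \<longleftrightarrow> (\<forall>g\<in>carrier G. \<Phi> g p = p)"
      using pu(2) pc(1) inj_on_eq_iff [OF cinj] by blast
    finally show ?thesis using pu(1) by (simp add: fixed_points_def)
  qed
  have "slice_chart M fixed_points e loc.fixed_space"
    unfolding slice_chart_def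
  proof (intro conjI adm)
    show "complemented_in (chart_space e) loc.fixed_space" using loc.complemented_fixed_space by (simp add: e_def)
    show "chart_map e ` (chart_dom e \<inter> fixed_points) = chart_map e ` chart_dom e \<inter> loc.fixed_space"
      using fix_iff by auto
  qed
  moreover have "deriv_at c e (\<lambda>x. x) q (\<lambda>v. v)"
  proof -
    have ld: "local_dom c e (\<lambda>x. x) = ?W"
    proof
      show "local_dom c e (\<lambda>x. x) \<subseteq> ?W" by (auto simp: local_dom_def e_def)
      show "?W \<subseteq> local_dom c e (\<lambda>x. x)"
      proof
        fix y assume y: "y \<in> ?W"
        then obtain p where p: "p \<in> chart_dom c" "y = chart_map c p" using r(2) invariant_part_subset by blast
        then have "p \<in> chart_dom e" using y by (simp add: e_def)
        then show "y \<in> local_dom c e (\<lambda>x. x)" using p by (auto simp: local_dom_def)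
      qed
    qed
    have "has_deriv_in ?E ?W loc.linearization (\<lambda>v. v) ?x0"
      by (rule has_deriv_in_mono [OF loc.linearization_deriv subset_refl r(2)])
    then show ?thesis
      unfolding deriv_at_def ld
    proof (rule has_deriv_in_cong)
      show "?x0 \<in> ?W" using q r chart_map_mem [OF cb] by simp
      fix y assume "y \<in> ?W"
      then obtain p where "p \<in> chart_dom c" "y = chart_map c p" using r(2) invariant_part_subset by blast
      then show "local_rep c e (\<lambda>x. x) y = loc.linearization y"
        using local_rep_apply [OF cinj, of p e "\<lambda>x. x"] by (simp add: e_def)
    qed
  qed
  moreover have "\<forall>v\<in>?E. v \<in> loc.fixed_space \<longleftrightarrow> (\<forall>g\<in>carrier G. dir_deriv (local_rep c c (\<Phi> g)) ?x0 v = v)"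
    by (simp add: loc.fixed_space_def loc.A_def)
  ultimately show ?thesis using qe by blast
qed

lemma fixed_points_submanifold: "smooth_submanifold M fixed_points"
  unfolding smooth_submanifold_def
proof (intro conjI ballI)
  show "fixed_points \<subseteq> points M" by (auto simp: fixed_points_def)
  fix q assume q: "q \<in> fixed_points"
  then obtain c where "c \<in> charts_at M q" using chart_at_exists by (auto simp: fixed_points_def)
  then show "\<exists>c F. slice_chart M fixed_points c F \<and> q \<in> chart_dom c"
    using slice_at_fixed_point [OF charts_atD(1,2) q] by blast
qed

lemma fixed_points_tangent_space:
  assumes q: "q \<in> fixed_points"
  shows "submanifold_tangent_space M fixed_points q = fixed_tangent_vectors M \<Phi> (carrier G) q"
proof -
  obtain c where c: "c \<in> charts_at M q" using q chart_at_exists by (auto simp: fixed_points_def)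
  note c' = charts_atD [OF c]
  obtain e F where e: "slice_chart M fixed_points e F" "q \<in> chart_dom e" "deriv_at c e (\<lambda>x. x) q (\<lambda>v. v)"
    "\<And>v. v \<in> chart_space c \<Longrightarrow> v \<in> F \<longleftrightarrow> (\<forall>g\<in>carrier G. dir_deriv (local_rep c c (\<Phi> g)) (chart_map c q) v = v)"
    using slice_at_fixed_point [OF c'(1,2) q] by blast
  note e' = slice_chartD [OF e(1)]
  have iff: "(\<forall>d\<in>charts_at M q. trans d e q (w d) \<in> F) \<longleftrightarrow> (\<forall>g\<in>carrier G. tangent_map M M (\<Phi> g) q w = w)"
    if w: "w \<in> tangent_space M q" for w
  proof -
    have wc: "w c \<in> chart_space c" by (rule tangent_spaceD(1) [OF w c])
    have "trans d e q (w d) = w c" if d: "d \<in> charts_at M q" for d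
    proof -
      have "trans d e q (w d) = trans c e q (trans d c q (w d))"
        by (rule trans_trans [OF charts_atD(3,2) [OF d] c'(3,2) e'(1) e(2) tangent_spaceD(1) [OF w d], symmetric])
      also have "trans d c q (w d) = w c" unfolding trans_def by (rule tangent_spaceD(2) [OF w d c, symmetric])
      also have "trans c e q (w c) = w c" by (rule trans_eq [OF c'(3,2) e'(1) e(2,3) wc])
      finally show ?thesis .
    qed
    then have "(\<forall>d\<in>charts_at M q. trans d e q (w d) \<in> F) \<longleftrightarrow> w c \<in> F" using c by auto
    also have "\<dots> \<longleftrightarrow> (\<forall>g\<in>carrier G. dir_deriv (local_rep c c (\<Phi> g)) (chart_map c q) (w c) = w c)" by (rule e(4) [OF wc])
    also have "\<dots> \<longleftrightarrow> (\<forall>g\<in>carrier G. tangent_map M M (\<Phi> g) q w = w)"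
    proof (rule ball_cong [OF refl])
      fix g assume g: "g \<in> carrier G"
      have gq: "\<Phi> g q = q" using q g by (simp add: fixed_points_def)
      have f: "continuous_map T T (\<Phi> g)" "Ck_on \<infinity> (chart_space c) (local_dom c c (\<Phi> g)) (local_rep c c (\<Phi> g))"
        using act_smooth [OF g] c'(1) by (auto simp: Ck_map_def)
      have "deriv_at c c (\<Phi> g) q (dir_deriv (local_rep c c (\<Phi> g)) (chart_map c q))"
        by (rule Ck_on_deriv_at [OF c'(4) c'(4) f(1) c'(2) _ f(2)]) (simp add: gq c')
      from tangent_map_fixed_iff [OF act_smooth [OF g] gq c w this]
      show "dir_deriv (local_rep c c (\<Phi> g)) (chart_map c q) (w c) = w c \<longleftrightarrow> tangent_map M M (\<Phi> g) q w = w" by simp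
    qed
    finally show ?thesis .
  qed
  show ?thesis
    unfolding submanifold_tangent_space_slice [OF e(1) q e(2)] fixed_tangent_vectors_def using iff by blast
qed

end

lemma compact_subgroup:
  assumes L: "lie_group G L" and H: "subgroup H G" "compactin (mtop L) H"
  shows "compact_group (G\<lparr>carrier := H\<rparr>) (subtopology (mtop L) H)"
proof -
  have G: "group G" and pts: "points L = carrier G" and Hd: "Hausdorff_space (mtop L)"
    using L by (auto simp: lie_group_def smooth_manifold_def)
  interpret group G by (rule G)
  interpret K: group "G\<lparr>carrier := H\<rparr>" by (rule subgroup.subgroup_is_group [OF H(1) G])
  have HG: "H \<subseteq> carrier G" by (rule subgroup.subset [OF H(1)])
  have mult: "continuous_map (prod_topology (mtop L) (mtop L)) (mtop L) (\<lambda>(g, h). g \<otimes>\<^bsub>G\<^esub> h)"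
    and inv: "continuous_map (mtop L) (mtop L) (\<lambda>g. inv\<^bsub>G\<^esub> g)"
    using L by (auto simp: lie_group_def Ck_map_def prod_manifold_def)
  show ?thesis
  proof (unfold_locales)
    show "topspace (subtopology (mtop L) H) = carrier (G\<lparr>carrier := H\<rparr>)"
      using HG pts by auto
    show "compact_space (subtopology (mtop L) H)" using H(2) by (rule compact_space_subtopology)
    show "Hausdorff_space (subtopology (mtop L) H)" using Hd by (rule Hausdorff_space_subtopology)
    have "continuous_map (prod_topology (subtopology (mtop L) H) (subtopology (mtop L) H)) (mtop L) (\<lambda>(g, h). g \<otimes>\<^bsub>G\<^esub> h)"
      using continuous_map_from_subtopology [OF mult, of "H \<times> H"] unfolding subtopology_Times .
    then have "continuous_map (prod_topology (subtopology (mtop L) H) (subtopology (mtop L) H)) (subtopology (mtop L) H) (\<lambda>(g, h). g \<otimes>\<^bsub>G\<^esub> h)"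
      by (rule continuous_map_into_subtopology) (use subgroup.m_closed [OF H(1)] in auto)
    then show "continuous_map (prod_topology (subtopology (mtop L) H) (subtopology (mtop L) H)) (subtopology (mtop L) H)
        (\<lambda>(g, h). g \<otimes>\<^bsub>G\<lparr>carrier := H\<rparr>\<^esub> h)" by simp
    have "continuous_map (subtopology (mtop L) H) (subtopology (mtop L) H) (\<lambda>g. inv\<^bsub>G\<^esub> g)"
      by (rule continuous_map_into_subtopology [OF continuous_map_from_subtopology [OF inv]])
        (use subgroup.m_inv_closed [OF H(1)] in auto)
    then show "continuous_map (subtopology (mtop L) H) (subtopology (mtop L) H) (\<lambda>g. inv\<^bsub>G\<lparr>carrier := H\<rparr>\<^esub> g)"
      by (rule continuous_map_eq) (auto simp: m_inv_consistent [OF H(1)])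
  qed
qed

theorem theorem3p7:
  fixes s0 :: real
    and Q :: "real \<Rightarrow> ('q, 'e::banach) manifold"
    and C :: "real \<Rightarrow> ('q \<times> 'q set \<times> ('q \<Rightarrow> ('q, 'e) tvec)) set"
    and \<gamma> :: "real \<Rightarrow> 'q \<Rightarrow> ('q, 'e) tvec \<Rightarrow> ('q, 'e) tvec \<Rightarrow> real"
    and G :: "('g, 'b) monoid_scheme"
    and L :: "('g, 'd::euclidean_space) manifold"
    and \<Phi> :: "real \<Rightarrow> 'g \<Rightarrow> 'q \<Rightarrow> 'q"
    and H :: "'g set"
  assumes "banach_chain s0 Q C"
    and "compatible_weak_metric s0 Q \<gamma>"
    and "lie_group G L"
    and "chain_action s0 Q G L \<Phi>"
    and "subgroup H G"
    and "compactin (mtop L) H"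
  shows "\<forall>s>s0.
    smooth_submanifold (Q s) (fixed_point_set (Q s) G (\<Phi> s) H) \<and>
    (\<forall>q\<in>fixed_point_set (Q s) G (\<Phi> s) H.
       submanifold_tangent_space (Q s) (fixed_point_set (Q s) G (\<Phi> s) H) q =
       fixed_tangent_vectors (Q s) (\<Phi> s) H q)"
proof (intro allI impI)
  fix s assume s: "s0 < s"
  have HG: "H \<subseteq> carrier G" by (rule subgroup.subset [OF assms(5)])
  interpret act: group_action G "points (Q s)" "\<Phi> s" using assms(4) s by (simp add: chain_action_def)
  interpret cg: compact_group "G\<lparr>carrier := H\<rparr>" "subtopology (mtop L) H"
    by (rule compact_subgroup [OF assms(3,5,6)])
  have M: "smooth_manifold (Q s)" using assms(1) s by (simp add: banach_chain_def)
  interpret bm: banach_manifold "Q s" by unfold_locales (rule M)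
  interpret cma: compact_manifold_action "G\<lparr>carrier := H\<rparr>" "subtopology (mtop L) H" "Q s" "\<Phi> s"
  proof (unfold_locales)
    show "\<Phi> s \<one>\<^bsub>G\<lparr>carrier := H\<rparr>\<^esub> p = p" if "p \<in> points (Q s)" for p
    proof -
      have "\<Phi> s \<one>\<^bsub>G\<^esub> p = (\<lambda>x\<in>points (Q s). x) p" by (simp only: act.id_eq_one)
      then show ?thesis using that by simp
    qed
    show "\<Phi> s (g \<otimes>\<^bsub>G\<lparr>carrier := H\<rparr>\<^esub> h) p = \<Phi> s g (\<Phi> s h p)"
      if "g \<in> carrier (G\<lparr>carrier := H\<rparr>)" "h \<in> carrier (G\<lparr>carrier := H\<rparr>)" "p \<in> points (Q s)" for g h p
      using act.composition_rule [OF that(3), of g h] that HG by auto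
    have "continuous_map (prod_topology (mtop L) (mtop (Q s))) (mtop (Q s)) (\<lambda>(g, q). \<Phi> s g q)"
      using assms(4) s by (simp add: chain_action_def)
    then have "continuous_map (subtopology (prod_topology (mtop L) (mtop (Q s))) (H \<times> points (Q s))) (mtop (Q s)) (\<lambda>(g, q). \<Phi> s g q)"
      by (rule continuous_map_from_subtopology)
    then show "continuous_map (prod_topology (subtopology (mtop L) H) (mtop (Q s))) (mtop (Q s)) (\<lambda>(g, p). \<Phi> s g p)"
      by (simp only: prod_topology_subtopology(1))
    show "Ck_map \<infinity> (Q s) (Q s) (\<Phi> s g)" if "g \<in> carrier (G\<lparr>carrier := H\<rparr>)" for g
      using assms(4) s HG that by (auto simp: chain_action_def)
  qed
  have fp: "fixed_point_set (Q s) G (\<Phi> s) H = cma.fixed_points"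
    unfolding fixed_point_set_def cma.fixed_points_def stabilizer_def using HG by auto
  show "smooth_submanifold (Q s) (fixed_point_set (Q s) G (\<Phi> s) H) \<and>
    (\<forall>q\<in>fixed_point_set (Q s) G (\<Phi> s) H.
       submanifold_tangent_space (Q s) (fixed_point_set (Q s) G (\<Phi> s) H) q =
       fixed_tangent_vectors (Q s) (\<Phi> s) H q)"
    unfolding fp using cma.fixed_points_submanifold cma.fixed_points_tangent_space by simp
qed

end
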